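(* Let $n\ge 3$ and $p\ge 1$ be integers, where $p=p_n$ may depend on (and grow with) $n$, such that $n\ge p+2$. Let $y_1,\dots,y_n$ be independent random vectors with distribution $N_p(\mu,\Lambda^{-1})$, where $\mu\in\mathbb{R}^p$ and the symmetric positive definite concentration matrix $\Lambda$ are unknown. Under the null hypothesis $$H_\psi:\ \mu=0_p\ \text{ and }\ \Lambda=I_p,$$ where $0_p$ is the zero vector and $I_p$ the identity matrix, the directional $p$-value $p(\psi)$ for $H_\psi$ (defined in the context) is exactly uniformly distributed on $(0,1)$.
   Context: The hypothesis is the standardized form of the hypothesis $\mu=\mu_0$, $\Lambda=\Lambda_0$ with $\mu_0\in\mathbb{R}^p$ and the non-singular $p\times p$ matrix $\Lambda_0$ completely specified: the $y_i$ here are the standardized data obtained by replacing each original observation $y_i$ with $\Lambda_0^{1/2}(y_i-\mu_0)$, and $\mu$, $\Lambda$ are the mean and concentration matrix of the standardized data. Notation. $y=[y_1\cdots y_n]^T$ is the $n\times p$ data matrix, $\bar y=y^T1_n/n$ with $1_n$ the vector of ones. The unconstrained maximum likelihood estimates are $\hat\mu=\bar y$ and $\hat\Lambda^{-1}=y^Ty/n-\bar y\bar y^T$. The number of constraints imposed by $H_\psi$ is $d=p(p+3)/2$; there is no nuisance parameter. Directional $p$-value (general definition in a linear exponential family). Let $\varphi$ be the canonical parameter, $u$ the canonical sufficient statistic, $u^0$ its observed value, $s=u-u^0$, and $\ell(\varphi;s)=\varphi^Ts+\ell^0(\varphi)$, where $\ell^0(\varphi)$ is the observed log-likelihood. Let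 $\hat\varphi^0_\psi$ be the constrained maximum likelihood estimate under $H_\psi$ (here the value specified by $H_\psi$), $s_\psi=-\partial\ell^0(\varphi)/\partial\varphi|_{\varphi=\hat\varphi^0_\psi}$, and $s(t)=(1-t)s_\psi$, $t\in\mathbb{R}$ (so $s(1)=0$ is the observed value and $s(0)=s_\psi$). Let $\hat\varphi(s)$ be the maximizer of $\ell(\varphi;s)$, let $J_{\varphi\varphi}(\varphi;s)=-\partial^2\ell(\varphi;s)/\partial\varphi\,\partial\varphi^T$, and let the saddlepoint approximation be $$h(s;\psi)=c\,\exp\left[\ell(\hat\varphi^0_\psi;s)-\ell\{\hat\varphi(s);s\}\right]\,|J_{\varphi\varphi}\{\hat\varphi(s);s\}|^{-1/2},$$ with $c$ a constant. Then $$p(\psi)=\frac{\int_1^{t_{sup}}t^{d-1}h\{s(t);\psi\}\,dt}{\int_0^{t_{sup}}t^{d-1}h\{s(t);\psi\}\,dt},$$ where $t_{sup}$ is the largest value (supremum) of $t$ for which the maximum likelihood estimate $\hat\varphi\{s(t)\}$ exists. In the present model, $\varphi$ has components $\xi=\Lambda\mu$ and the distinct entries of $\Lambda$, and $$\ell\{\varphi;s(t)\}=n\xi^T\{\bar y-(1-t)\bar y\}-\frac n2\mathrm{tr}\left[\Lambda\left\{\frac{y^Ty}{n}+(1-t)\left(I_p-\frac{y^Ty}{n}\right)\right\}\right]+\frac n2\log|\Lambda|-\frac n2\xi^T\Lambda^{-1}\xi .$$ Its maximizer corresponds to $\hat\mu(t)=t\bar y$ and $\hat\Lambda(t)^{-1}=(1-t)I_p+t\hat\Lambda^{-1}+t(1-t)\bar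 y\bar y^T$, and explicitly $$h\{s(t);\psi\}=c\,\exp\left\{\frac{n-p-2}{2}\log|\hat\Lambda(t)^{-1}|+\frac{nt}{2}\mathrm{tr}\left(I_p-\frac{y^Ty}{n}\right)\right\},$$ with $c$ not depending on $t$ (it cancels in $p(\psi)$); $t_{sup}$ is the largest $t$ for which $\hat\Lambda(t)^{-1}$ is positive definite. *)

theory Defs
  imports "HOL-Probability.Probability" "HOL-Library.Uprod"
begin

section \<open>Directional p-values in linear exponential families\<close>

text \<open>
  The family is given by its canonical parameter space \<open>\<Phi>\<close> and its observed log-likelihood
  \<open>l0\<close>, an arbitrary function of the canonical parameter.
\<close>

definition partial_deriv :: "'k::finite \<Rightarrow> (real^'k \<Rightarrow> real) \<Rightarrow> real^'k \<Rightarrow> real" where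
  "partial_deriv k f x = deriv (\<lambda>h. f (x + h *\<^sub>R axis k 1)) 0"

definition gradient :: "(real^'k::finite \<Rightarrow> real) \<Rightarrow> real^'k \<Rightarrow> real^'k" where
  "gradient f x = (\<chi> k. partial_deriv k f x)"

definition hessian :: "(real^'k::finite \<Rightarrow> real) \<Rightarrow> real^'k \<Rightarrow> real^'k^'k" where
  "hessian f x = (\<chi> j k. partial_deriv j (partial_deriv k f) x)"

definition tilted_loglik :: "(real^'k::finite \<Rightarrow> real) \<Rightarrow> real^'k \<Rightarrow> real^'k \<Rightarrow> real" where
  "tilted_loglik l0 s \<phi> = \<phi> \<bullet> s + l0 \<phi>"

definition mle_exists :: "(real^'k::finite) set \<Rightarrow> (real^'k \<Rightarrow> real) \<Rightarrow> real^'k \<Rightarrow> bool" where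
  "mle_exists \<Phi> l0 s \<longleftrightarrow> (\<exists>\<phi>. is_arg_max (tilted_loglik l0 s) (\<lambda>\<phi>. \<phi> \<in> \<Phi>) \<phi>)"

definition mle :: "(real^'k::finite) set \<Rightarrow> (real^'k \<Rightarrow> real) \<Rightarrow> real^'k \<Rightarrow> real^'k" where
  "mle \<Phi> l0 s = arg_max_on (tilted_loglik l0 s) \<Phi>"

definition obs_information :: "(real^'k::finite \<Rightarrow> real) \<Rightarrow> real^'k \<Rightarrow> real^'k \<Rightarrow> real^'k^'k" where
  "obs_information l0 s \<phi> = - hessian (tilted_loglik l0 s) \<phi>"

text \<open>
  The argument \<open>\<phi>0\<close> is the constrained maximum likelihood estimate. The saddlepoint
  approximation is only meaningful at those \<open>s\<close> for which the maximum likelihood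
  estimate exists; it is extended by 0 elsewhere.
\<close>

definition saddlepoint ::
  "real \<Rightarrow> (real^'k::finite) set \<Rightarrow> (real^'k \<Rightarrow> real) \<Rightarrow> real^'k \<Rightarrow> real^'k \<Rightarrow> real" where
  "saddlepoint c \<Phi> l0 \<phi>0 s =
     (if mle_exists \<Phi> l0 s
      then c * exp (tilted_loglik l0 s \<phi>0 - tilted_loglik l0 s (mle \<Phi> l0 s))
             * det (obs_information l0 s (mle \<Phi> l0 s)) powr (- 1 / 2)
      else 0)"

definition null_line :: "(real^'k::finite \<Rightarrow> real) \<Rightarrow> real^'k \<Rightarrow> real \<Rightarrow> real^'k" where
  "null_line l0 \<phi>0 t = (1 - t) *\<^sub>R (- gradient l0 \<phi>0)"

definition t_sup :: "(real^'k::finite) set \<Rightarrow> (real^'k \<Rightarrow> real) \<Rightarrow> real^'k \<Rightarrow> ereal" where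
  "t_sup \<Phi> l0 \<phi>0 = (SUP t \<in> {t. mle_exists \<Phi> l0 (null_line l0 \<phi>0 t)}. ereal t)"

text \<open>
  \<open>\<Phi>\<^sub>0 \<subseteq> \<Phi>\<close> is the set of canonical parameters satisfying the null hypothesis,
  and \<open>d\<close> is the number of constraints it imposes.
\<close>

definition directional_pvalue ::
  "real \<Rightarrow> nat \<Rightarrow> (real^'k::finite) set \<Rightarrow> (real^'k) set \<Rightarrow> (real^'k \<Rightarrow> real) \<Rightarrow> real" where
  "directional_pvalue c d \<Phi> \<Phi>\<^sub>0 l0 =
     (let \<phi>0 = arg_max_on l0 \<Phi>\<^sub>0;
          g = (\<lambda>t. t ^ (d - 1) * saddlepoint c \<Phi> l0 \<phi>0 (null_line l0 \<phi>0 t))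
      in (LBINT t=1..t_sup \<Phi> l0 \<phi>0. g t) / (LBINT t=0..t_sup \<Phi> l0 \<phi>0. g t))"


section \<open>The multivariate normal model\<close>

definition pos_def :: "real^'p^'p::finite \<Rightarrow> bool" where
  "pos_def A \<longleftrightarrow> transpose A = A \<and> (\<forall>x. x \<noteq> 0 \<longrightarrow> x \<bullet> (A *v x) > 0)"

text \<open>Parametrized by the mean \<open>\<mu>\<close> and the concentration (inverse covariance) matrix \<open>\<Lambda>\<close>.\<close>

definition mvn_density :: "real^'p::finite \<Rightarrow> real^'p^'p \<Rightarrow> real^'p \<Rightarrow> real" where
  "mvn_density \<mu> \<Lambda> x =
     sqrt (det \<Lambda> / (2 * pi) ^ CARD('p)) * exp (- ((x - \<mu>) \<bullet> (\<Lambda> *v (x - \<mu>))) / 2)"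

instance uprod :: (finite) finite
  by standard simp

text \<open>
  The canonical parameter consists of \<open>\<xi> = \<Lambda> \<mu>\<close> and of the distinct entries of the symmetric
  matrix \<open>\<Lambda>\<close>. The latter are indexed by unordered pairs (with repetition) of indices, so that the
  coordinates are indexed by \<open>'p + 'p uprod\<close>, a type with \<open>p (p + 3) / 2\<close> elements.
\<close>

type_synonym 'p canonical = "real ^ ('p + 'p uprod)"

definition xi_of :: "'p::finite canonical \<Rightarrow> real^'p" where
  "xi_of \<phi> = (\<chi> i. \<phi> $ Inl i)"

definition conc_of :: "'p::finite canonical \<Rightarrow> real^'p^'p" where
  "conc_of \<phi> = (\<chi> i j. \<phi> $ Inr (Upair i j))"

definition mean_of :: "'p::finite canonical \<Rightarrow> real^'p" where
  "mean_of \<phi> = matrix_inv (conc_of \<phi>) *v xi_of \<phi>"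

definition mvn_params :: "'p::finite canonical set" where
  "mvn_params = {\<phi>. pos_def (conc_of \<phi>)}"

definition mvn_null_params :: "'p::finite canonical set" where
  "mvn_null_params = {\<phi> \<in> mvn_params. mean_of \<phi> = 0 \<and> conc_of \<phi> = mat 1}"

definition mvn_loglik :: "nat \<Rightarrow> (nat \<Rightarrow> real^'p::finite) \<Rightarrow> 'p canonical \<Rightarrow> real" where
  "mvn_loglik n y \<phi> = (\<Sum>i=1..n. ln (mvn_density (mean_of \<phi>) (conc_of \<phi>) (y i)))"

definition mvn_directional_pvalue :: "real \<Rightarrow> nat \<Rightarrow> (nat \<Rightarrow> real^'p::finite) \<Rightarrow> real" where
  "mvn_directional_pvalue c n y =
     directional_pvalue c (CARD('p) * (CARD('p) + 3) div 2)
       mvn_params mvn_null_params (mvn_loglik n y)"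

end

theory Submission
  imports Defs
begin

text \<open>
  In the normal family the saddlepoint density is, up to a constant, the exact joint density of the
  sufficient statistic (sample mean, sample second moment) under the null hypothesis, restricted to
  the line through the null value and the observed one. As \<open>t\<^sup>d\<^sup>-\<^sup>1\<close> is the Jacobian of polar coordinates
  around the null value, the p-value is the conditional probability, given the ray, of falling beyond
  the observed point, and is therefore uniform on every ray.

  The density of the sufficient statistic is needed only up to a constant: the image of Lebesgue
  measure under (mean, covariance) is relatively invariant under the affine group, and by Tonelli's
  theorem such a measure is unique up to a factor. The curvature factor of the saddlepoint density is
  computed by equivariance as well: the determinant of the action of a matrix \<open>A\<close> on the canonical
  parameters is multiplicative in \<open>A\<close>, hence a power of \<open>det A\<close>.
\<close>

section \<open>Determinants of linear actions of matrices\<close>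

text \<open>The two densities can agree only if their exponents do. An affine map with linear part A
  scales Lebesgue measure on n observations by |det A|^n; the mean accounts for one power and the
  symmetric matrices for p + 1, which leaves (n - p - 2)/2 as the exponent of the determinant of the
  covariance. In the saddlepoint density the likelihood ratio gives exponent n/2 and the curvature
  -(p + 2)/2, the same number.

  Two coordinate systems are needed: the affine group acts simply on (mean, covariance), while the
  null line is straight in (mean, second moment). A shear that preserves Lebesgue measure links
  them. The number d = p(p + 3)/2 is the dimension of this statistic.

  Normalising constants cancel in the p-value and have to be known only as positive and finite. The
  condition n >= p + 2 makes the exponent nonnegative, so the density stays bounded at the boundary
  of the positive definite cone. A ray with nonzero mean component leaves the cone after finite
  time; the other rays form a null set.\<close>

lemma swap_matrix_vector_mult:
  fixes x :: "real^'n"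
  shows "(\<chi> i j. (mat 1 :: real^'n^'n) $ i $ Transposition.transpose m n j) *v x =
    (\<chi> i. x $ Transposition.transpose m n i)" (is "?S *v x = _")
proof -
  have "i = Transposition.transpose m n j \<longleftrightarrow> j = Transposition.transpose m n i" for i j
    by (metis transpose_involutory)
  then have "?S $ i $ j * x $ j = (if j = Transposition.transpose m n i then x $ j else 0)" for i j
    by (simp add: mat_def)
  then have "(?S *v x) $ i = x $ Transposition.transpose m n i" for i
    unfolding matrix_vector_mult_def by (simp only: vec_lambda_beta) simp
  then show ?thesis
    by (simp add: vec_eq_iff)
qed

lemma swap_matrix_square:
  fixes m n :: "'n::finite"
  defines "S \<equiv> \<chi> i j. (mat 1 :: real^'n^'n) $ i $ Transposition.transpose m n j"
  shows "S ** S = mat 1" "\<bar>det S\<bar> = 1"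
proof -
  show *: "S ** S = mat 1"
    unfolding S_def by (simp only: matrix_eq swap_matrix_vector_mult flip: matrix_vector_mul_assoc) simp
  have "det S * det S = 1" using det_mul[of S S] * by simp
  then show "\<bar>det S\<bar> = 1" by (metis abs_mult_self_eq abs_one real_sqrt_abs2 real_sqrt_one)
qed

text \<open>Elementary matrices generate all square matrices, so it remains to evaluate
  \<open>F\<close> on the generators. A swap squares to the identity and \<open>F\<close> is
  nonnegative, hence \<open>F\<close> is 1 there. A transvection T satisfies T T D = D T, where D
  doubles one coordinate; cancelling leaves \<open>F\<close> = 1 at T, and in the same way det T =
  1.\<close>

lemma multiplicative_matrix_function_eq_det_power:
  fixes F :: "real^'n^'n \<Rightarrow> real"
  assumes mult: "\<And>A B. F (A ** B) = F A * F B"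
    and nonneg: "\<And>A. F A \<ge> 0"
    and one: "F (mat 1) = 1"
    and zero_row: "\<And>A i. row i A = 0 \<Longrightarrow> F A = 0"
    and diagonal: "\<And>A. (\<And>i j. i \<noteq> j \<Longrightarrow> A $ i $ j = 0) \<Longrightarrow> F A = \<bar>det A\<bar> ^ k"
    and "k > 0"
  shows "F A = \<bar>det A\<bar> ^ k"
proof (induction A rule: induct_matrix_elementary_alt)
  case (1 A B)
  then show ?case by (simp add: mult det_mul abs_mult power_mult_distrib)
next
  case (2 A i)
  moreover have "det A = 0" using 2 by (rule det_zero_row)
  ultimately show ?case using assms(4)[OF 2] \<open>k > 0\<close> by simp
next
  case (3 A)
  then show ?case by (rule assms(5))
next
  case (4 m n)
  let ?S = "\<chi> i j. (mat 1 :: real^'n^'n) $ i $ Transposition.transpose m n j"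
  note sq = swap_matrix_square[of m n]
  have "F ?S * F ?S = 1" using mult[of ?S ?S] sq(1) one by simp
  then have "F ?S = 1"
    using nonneg[of ?S] by (metis abs_of_nonneg power2_eq_square real_sqrt_abs real_sqrt_one)
  with sq(2) show ?case by simp
next
  case (5 m n)
  let ?T = "(\<chi> i j. of_bool (i = m \<and> j = n \<or> i = j)) :: real^'n^'n"
  let ?T' = "(\<chi> i j. of_bool (i = j) - of_bool (i = m \<and> j = n)) :: real^'n^'n"
  let ?D = "(\<chi> i j. if i = j then (if i = m then 2 else 1) else 0) :: real^'n^'n"
  have T: "?T *v x = (\<chi> i. if i = m then x $ m + x $ n else x $ i)" for x
  proof -
    have "of_bool (i = m \<and> j = n \<or> i = j) * x $ j
        = (if j = n then of_bool (i = m) * x $ j else 0) + (if j = i then x $ j else 0)" for i j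
      using 5 by (auto simp: of_bool_def)
    then show ?thesis
      by (simp add: matrix_vector_mult_def vec_eq_iff sum.distrib)
  qed
  have T': "?T' *v x = (\<chi> i. if i = m then x $ m - x $ n else x $ i)" for x
  proof -
    have "(of_bool (i = j) - of_bool (i = m \<and> j = n)) * x $ j
        = (if j = i then x $ j else 0) - (if j = n then of_bool (i = m) * x $ j else 0)" for i j
      by (auto simp: of_bool_def)
    then show ?thesis
      by (simp add: matrix_vector_mult_def vec_eq_iff sum_subtractf)
  qed
  have D: "?D *v x = (\<chi> i. if i = m then 2 * x $ m else x $ i)" for x
  proof -
    have "(if i = j then (if i = m then 2 else 1) else 0) * x $ j
        = (if j = i then (if i = m then 2 else 1) * x $ i else 0)" for i j
      by simp
    then show ?thesis
      by (simp add: matrix_vector_mult_def vec_eq_iff)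
  qed
  have "?T *v (?T *v (?D *v x)) = ?D *v (?T *v x)" for x
    unfolding T D using 5 by (auto simp: vec_eq_iff)
  then have "?T ** ?T ** ?D = ?D ** ?T"
    by (simp only: matrix_eq matrix_vector_mul_assoc[symmetric]) blast
  then have *: "F (?T ** ?T ** ?D) = F (?D ** ?T)" "det (?T ** ?T ** ?D) = det (?D ** ?T)"
    by (rule arg_cong)+
  have detD: "det ?D = 2"
    by (subst det_diagonal) simp_all
  then have FD: "F ?D = 2 ^ k"
    by (subst diagonal) simp_all
  \<comment> \<open>\<open>?T'\<close> is the inverse of \<open>?T\<close>; it rules out the value 0
    at \<open>?T\<close>, so that the cancellation is possible.\<close>
  have "?T' *v (?T *v x) = x" for x
    unfolding T T' using 5 by (auto simp: vec_eq_iff)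
  then have B: "?T' ** ?T = mat 1"
    by (simp only: matrix_eq matrix_vector_mul_assoc[symmetric] matrix_vector_mul_lid) blast
  have nz: "F ?T \<noteq> 0" "det ?T \<noteq> 0"
    using arg_cong[OF B, of F] arg_cong[OF B, of det] by (auto simp only: mult det_mul one det_I)
  have "F ?T = 1" using *(1) FD nz by (simp only: mult) simp
  moreover have "det ?T = 1" using *(2) detD nz by (simp only: det_mul) simp
  ultimately show ?case by (simp only:) simp
qed

section \<open>Linear change of variables for Lebesgue measure\<close>

lemma nn_integral_lborel_shear:
  fixes f :: "'a::euclidean_space \<Rightarrow> ennreal"
  assumes [measurable]: "f \<in> borel_measurable borel" and b: "b \<in> Basis" "b' \<in> Basis" "b \<noteq> b'"
  shows "(\<integral>\<^sup>+x. f (x + (c * (x \<bullet> b')) *\<^sub>R b) \<partial>lborel) = (\<integral>\<^sup>+x. f x \<partial>lborel)"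
proof -
  interpret product_sigma_finite "\<lambda>_::'a. lborel :: real measure" ..
  let ?B = "Basis - {b}" and ?S = "\<lambda>g. \<Sum>b\<in>Basis. g b *\<^sub>R (b::'a)"
  have ins: "Basis = insert b ?B" using b by auto
  have int: "(\<integral>\<^sup>+x. h x \<partial>lborel) =
      (\<integral>\<^sup>+g. \<integral>\<^sup>+t. h (?S (g(b := t))) \<partial>lborel \<partial>(\<Pi>\<^sub>M b\<in>?B. lborel))"
    if [measurable]: "h \<in> borel_measurable borel" for h :: "'a \<Rightarrow> ennreal"
  proof -
    have "(\<integral>\<^sup>+x. h x \<partial>lborel) = (\<integral>\<^sup>+g. h (?S g) \<partial>(\<Pi>\<^sub>M b\<in>Basis. lborel))"
      by (subst lborel_eq) (simp add: nn_integral_distr)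
    also have "\<dots> = (\<integral>\<^sup>+g. h (?S g) \<partial>(\<Pi>\<^sub>M b\<in>insert b ?B. lborel))"
      using ins by simp
    also have "\<dots> = (\<integral>\<^sup>+g. \<integral>\<^sup>+t. h (?S (g(b := t))) \<partial>lborel \<partial>(\<Pi>\<^sub>M b\<in>?B. lborel))"
      by (rule product_nn_integral_insert) (simp_all flip: ins)
    finally show ?thesis .
  qed
  have S: "?S (g(b := t)) = t *\<^sub>R b + (\<Sum>b\<in>?B. g b *\<^sub>R b)" for g t
    using b by (subst sum.remove[of _ b]) (auto intro!: sum.cong)
  have inner: "?S (g(b := t)) \<bullet> b' = g b'" for g t
    unfolding S using b by (simp add: inner_add_left inner_sum_left inner_Basis if_distrib[of "(*) _"] cong: if_cong)
  have shear: "?S (g(b := t)) + (c * (?S (g(b := t)) \<bullet> b')) *\<^sub>R b = ?S (g(b := c * g b' + t))" for g t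
    unfolding inner unfolding S by (simp add: algebra_simps)
  \<comment> \<open>With all other coordinates held fixed, \<open>b'\<close> among them, the shear
    merely translates coordinate \<open>b\<close>.\<close>
  have "(\<integral>\<^sup>+t. f (?S (g(b := c * g b' + t))) \<partial>lborel) = (\<integral>\<^sup>+t. f (?S (g(b := t))) \<partial>lborel)" for g
    unfolding S
    by (subst nn_integral_real_affine[where c = 1 and t = "c * g b'"  and f = "\<lambda>t. f (t *\<^sub>R b + _)"]) simp_all
  then show ?thesis
    by (simp only: int[OF assms(1)]) (subst int, simp, simp only: shear)
qed

lemma prod_Basis_vec: "(\<Prod>b\<in>(Basis :: (real^'n) set). h b) = (\<Prod>i\<in>UNIV. h (axis i 1))"
proof -
  have "(Basis :: (real^'n) set) = (\<lambda>i. axis i 1) ` UNIV"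
    by (auto simp: Basis_vec_def)
  moreover have inj: "inj (\<lambda>i::'n. axis i (1::real))" by (auto simp: inj_on_def axis_eq_axis)
  ultimately show ?thesis using prod.reindex[OF inj, of h] by (simp only: o_def)
qed

text \<open>Boxes determine Lebesgue measure. Since \<open>q\<close> is its own inverse, the
  preimage of a box is the box with permuted corners, and permuting the side lengths leaves the
  volume unchanged.\<close>

lemma nn_integral_lborel_permute_coords:
  fixes f :: "real^'n \<Rightarrow> ennreal"
  assumes [measurable]: "f \<in> borel_measurable borel" and q: "\<And>i. q (q i) = i"
  shows "(\<integral>\<^sup>+x. f (\<chi> i. x $ q i) \<partial>lborel) = (\<integral>\<^sup>+x. f x \<partial>lborel)"
proof -
  let ?T = "\<lambda>x::real^'n. (\<chi> i. x $ q i) :: real^'n"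
  have bij: "bij q" by (rule involuntory_imp_bij) (rule q)
  have T[measurable]: "?T \<in> borel_measurable borel"
    by (intro borel_measurable_continuous_onI continuous_intros)
  have eq: "lborel = distr lborel borel ?T"
  proof (rule lborel_eqI)
    fix l u :: "real^'n" assume le: "\<And>b. b \<in> Basis \<Longrightarrow> l \<bullet> b \<le> u \<bullet> b"
    have le': "l $ i \<le> u $ i" for i using le[of "axis i 1"] by (simp add: inner_axis)
    have "?T -` box l u = box (?T l) (?T u)"
      by (auto simp: mem_box_cart) (metis q)+
    then have "emeasure (distr lborel borel ?T) (box l u) = emeasure lborel (box (?T l) (?T u))"
      by (simp add: emeasure_distr)
    also have "\<dots> = (\<Prod>i\<in>UNIV. (?T u - ?T l) $ i)"
      using le' by (subst emeasure_lborel_box_eq)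
        (simp only: prod_Basis_vec inner_axis, auto simp: Basis_vec_def inner_axis)
    also have "(\<Prod>i\<in>UNIV. (?T u - ?T l) $ i) = (\<Prod>i\<in>UNIV. (u - l) $ i)"
      using prod.reindex_bij_betw[OF bij, of "\<lambda>i. (u - l) $ i"] by simp
    finally show "emeasure (distr lborel borel ?T) (box l u) = (\<Prod>b\<in>Basis. (u - l) \<bullet> b)"
      by (simp add: prod_Basis_vec inner_axis)
  qed simp
  have "(\<integral>\<^sup>+x. f (?T x) \<partial>lborel) = (\<integral>\<^sup>+x. f x \<partial>distr lborel borel ?T)"
    by (simp add: nn_integral_distr)
  then show ?thesis by (simp only: eq[symmetric])
qed

lemma measurable_matrix_vector_mult [measurable]:
  "(\<lambda>x. (A :: real^'n^'m) *v x) \<in> borel_measurable borel"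
  by (intro borel_measurable_continuous_onI continuous_intros)

text \<open>Induction over elementary matrices: diagonal maps scale, swaps permute, shears preserve
  the measure. \<open>f\<close> must vary because the hypotheses are applied to \<open>f\<close>
  composed with a factor. The determinant stands on the transformed side, so nothing has to be
  divided in \<open>ennreal\<close>.\<close>

lemma nn_integral_lborel_matrix:
  fixes f :: "real^'n \<Rightarrow> ennreal" and A :: "real^'n^'n"
  assumes "f \<in> borel_measurable borel" and "det A \<noteq> 0"
  shows "ennreal \<bar>det A\<bar> * (\<integral>\<^sup>+x. f (A *v x) \<partial>lborel) = (\<integral>\<^sup>+x. f x \<partial>lborel)"
  using assms
proof (induction A arbitrary: f rule: induct_matrix_elementary)
  case (1 A B)
  note [measurable] = "1.prems"(1)
  have "(\<integral>\<^sup>+x. f x \<partial>lborel) = ennreal \<bar>det A\<bar> * (\<integral>\<^sup>+x. f (A *v x) \<partial>lborel)"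
    using 1 by (simp add: det_mul)
  also have "\<dots> = ennreal \<bar>det A\<bar> * (ennreal \<bar>det B\<bar> * (\<integral>\<^sup>+x. f (A *v (B *v x)) \<partial>lborel))"
    using 1 by (subst "1.IH"(2)[of "\<lambda>x. f (A *v x)"]) (simp_all add: det_mul)
  finally show ?case
    by (simp add: det_mul abs_mult ennreal_mult mult.assoc matrix_vector_mul_assoc)
next
  case (2 A i)
  then show ?case using det_zero_row by blast
next
  case (3 A)
  note [measurable] = "3.prems"(1)
  have det: "det A = (\<Prod>i\<in>UNIV. A $ i $ i)" using 3 by (intro det_diagonal) auto
  then have nz: "A $ i $ i \<noteq> 0" for i using 3 by auto
  let ?T = "\<lambda>x. 0 + (\<Sum>j\<in>Basis. ((A *v j) \<bullet> j * (x \<bullet> j)) *\<^sub>R j) :: real^'n"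
  have Ax: "(A *v x) $ i = A $ i $ i * x $ i" for x i
  proof -
    have "(\<Sum>j\<in>UNIV. A $ i $ j * x $ j) = (\<Sum>j\<in>UNIV. if j = i then A $ i $ i * x $ i else 0)"
      by (rule sum.cong) (use 3 in auto)
    then show ?thesis by (simp add: matrix_vector_mult_def)
  qed
  have "?T x = A *v x" for x
  proof -
    have "?T x \<bullet> b = (A *v x) \<bullet> b" if "b \<in> Basis" for b
      using that by (auto simp: inner_sum_left inner_Basis if_distrib sum.delta Basis_vec_def inner_axis Ax  cong: if_cong)
    then show ?thesis by (rule euclidean_eqI)
  qed
  moreover have "lborel = density (distr lborel borel ?T) (\<lambda>_. \<Prod>j\<in>Basis. \<bar>(A *v j) \<bullet> j\<bar>)"
    by (rule lborel_affine_euclidean) (use nz in \<open>auto simp: Basis_vec_def inner_axis Ax\<close>)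
  ultimately have *: "lborel = density (distr lborel borel (\<lambda>x. A *v x)) (\<lambda>_. \<bar>det A\<bar>)"
    by (simp add: prod_Basis_vec inner_axis Ax det abs_prod)
  show ?case
    by (subst (2) *) (simp add: nn_integral_density nn_integral_distr nn_integral_cmult)
next
  case (4 m n)
  let ?S = "\<chi> i j. (mat 1 :: real^'n^'n) $ i $ Transposition.transpose m n j"
  show ?case
    using nn_integral_lborel_permute_coords[OF 4(2), of "Transposition.transpose m n"]
    by (simp add: swap_matrix_vector_mult swap_matrix_square)
next
  case (5 m n c)
  let ?T = "(\<chi> i j. if i = m \<and> j = n then c else of_bool (i = j)) :: real^'n^'n"
  have "?T = (\<chi> k. if k = m then row m (mat 1) + c *s row n (mat 1) else row k (mat 1))"
    using 5(1) by (auto simp: vec_eq_iff row_def mat_def)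
  then have "det ?T = 1"
    using det_row_operation[OF 5(1), where A = "mat 1" and c = c] by (simp only: det_I)
  moreover have "?T *v x = x + (c * (x \<bullet> axis n 1)) *\<^sub>R axis m 1" for x
  proof -
    have "(if i = m \<and> j = n then c else of_bool (i = j)) * x $ j
        = (if j = n then of_bool (i = m) * c * x $ j else 0) + (if j = i then x $ j else 0)" for i j
      using 5 by (auto simp: of_bool_def)
    then show ?thesis
      by (simp add: matrix_vector_mult_def vec_eq_iff sum.distrib inner_axis) (simp add: axis_def)
  qed
  ultimately show ?case
    using nn_integral_lborel_shear[OF 5(2), of "axis m 1" "axis n 1" c] 5(1)
    by (simp add: axis_in_Basis_iff axis_eq_axis)
qed

section \<open>Determinants of matrix actions on coordinate spaces\<close>

lemma det_matrix_compose:
  fixes f g :: "real^'k \<Rightarrow> real^'k"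
  assumes "linear f" "linear g"
  shows "det (matrix (\<lambda>x. f (g x))) = det (matrix f) * det (matrix g)"
  using matrix_compose[OF assms(2,1)] by (simp add: o_def det_mul)

lemma det_matrix_coordinatewise:
  fixes f :: "real^'k \<Rightarrow> real^'k"
  assumes "\<And>v u. f v $ u = w u * v $ u"
  shows "det (matrix f) = (\<Prod>u\<in>UNIV. w u)"
  by (subst det_diagonal) (simp_all add: matrix_def assms axis_def)

text \<open>The absolute determinant of the representing matrix is multiplicative in
  \<open>A\<close>, hence a power of |det A|. Diagonal matrices act by the weights \<open>w\<close>
  and reveal the exponent \<open>k\<close>; a zero row of \<open>A\<close> kills a coordinate and so
  makes the action singular.\<close>

lemma det_matrix_action:
  fixes f :: "real^'n^'n \<Rightarrow> real^'k \<Rightarrow> real^'k"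
  assumes lin: "\<And>A. linear (f A)"
    and mult: "\<And>A B x. f (A ** B) x = f A (f B x)"
    and one: "\<And>x. f (mat 1) x = x"
    and zero_row: "\<And>A i. row i A = 0 \<Longrightarrow> \<exists>u. \<forall>x. f A x $ u = 0"
    and diagonal: "\<And>A x u. (\<And>i j. i \<noteq> j \<Longrightarrow> A $ i $ j = 0) \<Longrightarrow> f A x $ u = w (\<lambda>i. A $ i $ i) u * x $ u"
    and w: "\<And>a. (\<Prod>u\<in>UNIV. \<bar>w a u\<bar>) = \<bar>\<Prod>i\<in>UNIV. a i\<bar> ^ k" and "k > 0"
  shows "\<bar>det (matrix (f A))\<bar> = \<bar>det A\<bar> ^ k"
proof (rule multiplicative_matrix_function_eq_det_power[where F = "\<lambda>A. \<bar>det (matrix (f A))\<bar>"])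
  show "\<bar>det (matrix (f (A ** B)))\<bar> = \<bar>det (matrix (f A))\<bar> * \<bar>det (matrix (f B))\<bar>" for A B
  proof -
    have "f (A ** B) = (\<lambda>x. f A (f B x))" using mult by (rule ext)
    then show ?thesis using det_matrix_compose[OF lin lin, of A B] by (simp add: abs_mult)
  qed
  show "\<bar>det (matrix (f (mat 1)))\<bar> = 1"
  proof -
    have "f (mat 1) = id" using one by (auto simp: fun_eq_iff)
    then show ?thesis by simp
  qed
  show "\<bar>det (matrix (f A))\<bar> = 0" if z: "row i A = 0" for A i
  proof -
    obtain u where "\<forall>x. f A x $ u = 0" using zero_row[OF z] by blast
    then have "row u (matrix (f A)) = 0" by (simp add: row_def matrix_def vec_eq_iff)
    then show ?thesis using det_zero_row by auto
  qed
  show "\<bar>det (matrix (f A))\<bar> = \<bar>det A\<bar> ^ k" if "\<And>i j. i \<noteq> j \<Longrightarrow> A $ i $ j = 0" for A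
  proof -
    have "det (matrix (f A)) = (\<Prod>u\<in>UNIV. w (\<lambda>i. A $ i $ i) u)"
      by (rule det_matrix_coordinatewise) (rule diagonal[OF that])
    moreover have "det A = (\<Prod>i\<in>UNIV. A $ i $ i)" using that by (intro det_diagonal) auto
    ultimately show ?thesis using w by (simp add: abs_prod)
  qed
qed (simp_all add: \<open>k > 0\<close>)

text \<open>Compare with the product over ordered pairs: a pair of distinct indices has two
  preimages, a repeated index only one. After the diagonal factors are inserted once more, every
  unordered pair counts twice, so the square of the product is a^(2p) times a^2, where a is the
  absolute product of all entries and p the number of indices.\<close>

lemma prod_uprod:
  fixes a :: "'n::finite \<Rightarrow> real"
  assumes g: "\<And>i j. g (Upair i j) = a i * a j"
  shows "(\<Prod>u\<in>UNIV. \<bar>g u\<bar>) = \<bar>\<Prod>i\<in>UNIV. a i\<bar> ^ (CARD('n) + 1)"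
proof -
  let ?U = "\<lambda>q::'n \<times> 'n. Upair (fst q) (snd q)" and ?P = "\<Prod>u\<in>UNIV. \<bar>g u\<bar>" and ?a = "\<bar>\<Prod>i\<in>UNIV. a i\<bar>"
  have fiber: "(\<Prod>q | ?U q = u. \<bar>g (?U q)\<bar>) * (if proper_uprod u then 1 else \<bar>g u\<bar>) = \<bar>g u\<bar>^2" for u
  proof (cases u)
    case (Upair i j)
    have "{q. ?U q = Upair i j} = {(i, j), (j, i)}" by auto
    then show ?thesis unfolding Upair by (auto simp: power2_eq_square g mult_ac abs_mult)
  qed
  have "?P ^ 2 = (\<Prod>u\<in>UNIV. \<bar>g u\<bar>^2)" by (simp add: prod_power_distrib)
  also have "\<dots> = (\<Prod>u\<in>UNIV. (\<Prod>q | ?U q = u. \<bar>g (?U q)\<bar>)) * (\<Prod>u\<in>UNIV. if proper_uprod u then 1 else \<bar>g u\<bar>)"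
    by (simp only: fiber[symmetric] prod.distrib)
  also have "(\<Prod>u\<in>UNIV. (\<Prod>q | ?U q = u. \<bar>g (?U q)\<bar>)) = (\<Prod>q\<in>UNIV. \<bar>g (?U q)\<bar>)"
    using prod.group[of UNIV UNIV ?U "\<lambda>q. \<bar>g (?U q)\<bar>"] by simp
  also have "\<dots> = (\<Prod>i\<in>UNIV. \<Prod>j\<in>UNIV. \<bar>a i\<bar> * \<bar>a j\<bar>)"
    by (simp add: prod.cartesian_product g abs_mult split_def)
  also have "\<dots> = ?a ^ CARD('n) * ?a ^ CARD('n)"
    by (simp add: prod.distrib abs_prod prod_power_distrib)
  also have "(\<Prod>u\<in>UNIV. if proper_uprod u then 1 else \<bar>g u\<bar>) = (\<Prod>u | \<not> proper_uprod u. \<bar>g u\<bar>)"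
    by (rule prod.mono_neutral_cong_right) auto
  also have "{u::'n uprod. \<not> proper_uprod u} = (\<lambda>i. Upair i i) ` UNIV"
  proof -
    have "u \<in> range (\<lambda>i. Upair i i)" if "\<not> proper_uprod u" for u :: "'n uprod"
      using that by (cases u) auto
    then show ?thesis by auto
  qed
  also have "(\<Prod>u\<in>range (\<lambda>i. Upair i i). \<bar>g u\<bar>) = ?a ^ 2"
    by (subst prod.reindex) (auto simp: inj_on_def g prod.distrib power2_eq_square)
  finally have "?P ^ 2 = (?a ^ (CARD('n) + 1)) ^ 2"
    by (simp add: power2_eq_square mult_ac)
  then show ?thesis
    by (simp add: power2_eq_iff_nonneg prod_nonneg)
qed

section \<open>Symmetric and positive definite matrices\<close>

definition smat :: "real^('n::finite uprod) \<Rightarrow> real^'n^'n" where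
  "smat v = (\<chi> i j. v $ Upair i j)"

text \<open>One ordered representative is fixed for every unordered pair. For symmetric matrices the
  choice is irrelevant; for all others the map is still linear, as later linearity proofs
  require.\<close>

definition svec :: "real^'n^'n \<Rightarrow> real^('n::finite uprod)" where
  "svec A = (\<chi> u. let q = SOME q. Upair (fst q) (snd q) = u in A $ fst q $ snd q)"

lemma smat_nth [simp]: "smat v $ i $ j = v $ Upair i j"
  by (simp add: smat_def)

lemma transpose_smat [simp]: "transpose (smat v) = smat v"
  by (simp add: transpose_def vec_eq_iff) (metis Upair_inject)

lemma svec_nth:
  assumes "transpose A = A"
  shows "svec A $ Upair i j = A $ i $ j"
proof -
  let ?q = "SOME q. Upair (fst q) (snd q) = Upair i j"
  have "Upair (fst ?q) (snd ?q) = Upair i j"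
    by (rule someI_ex) (auto intro: exI[of _ "(i, j)"])
  moreover have "A $ j $ i = A $ i $ j"
    using assms by (metis transpose_def vec_lambda_beta)
  ultimately show ?thesis by (auto simp: svec_def Let_def)
qed

lemma smat_svec: "transpose A = A \<Longrightarrow> smat (svec A) = A"
  by (simp add: vec_eq_iff svec_nth)

lemma svec_smat [simp]: "svec (smat v) = v"
proof -
  have "svec (smat v) $ u = v $ u" for u by (cases u) (simp add: svec_nth)
  then show ?thesis by (simp add: vec_eq_iff)
qed

lemma linear_smat: "linear smat"
  by (intro linearI) (simp_all add: vec_eq_iff)

lemma linear_svec: "linear svec"
  by (intro linearI) (simp_all add: vec_eq_iff svec_def Let_def)

text \<open>This is how a covariance matrix transforms when the data are mapped by
  \<open>A\<close>.\<close>

definition congruence :: "real^'n^'n \<Rightarrow> real^'n^'n \<Rightarrow> real^'n^'n::finite" where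
  "congruence A X = A ** X ** transpose A"

lemma transpose_congruence: "transpose (congruence A X) = congruence A (transpose X)"
  by (simp add: congruence_def matrix_transpose_mul matrix_mul_assoc)

lemma congruence_mult: "congruence (A ** B) X = congruence A (congruence B X)"
  by (simp add: congruence_def matrix_transpose_mul matrix_mul_assoc)

lemma congruence_one [simp]: "congruence (mat 1) X = X"
  by (simp add: congruence_def transpose_mat)

lemma congruence_nth: "congruence A X $ i $ j = (\<Sum>k\<in>UNIV. \<Sum>l\<in>UNIV. A $ i $ k * X $ k $ l * A $ j $ l)"
  unfolding congruence_def matrix_matrix_mult_def
  by (simp add: transpose_def sum_distrib_right) (rule sum.swap)

lemma linear_congruence: "linear (congruence A)"
  by (intro linearI)
    (simp_all add: vec_eq_iff congruence_nth algebra_simps sum.distrib sum_distrib_left)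

lemma congruence_diagonal:
  assumes "\<And>i j. i \<noteq> j \<Longrightarrow> A $ i $ j = 0"
  shows "congruence A X $ i $ j = A $ i $ i * A $ j $ j * X $ i $ j"
proof -
  have "A $ i $ k * X $ k $ l * A $ j $ l =
      (if k = i then if l = j then A $ i $ i * A $ j $ j * X $ i $ j else 0 else 0)" for k l
    using assms by auto
  then have "(\<Sum>k\<in>UNIV. \<Sum>l\<in>UNIV. A $ i $ k * X $ k $ l * A $ j $ l) =
     (\<Sum>k\<in>UNIV. if k = i then (\<Sum>l\<in>UNIV. if l = j then A $ i $ i * A $ j $ j * X $ i $ j else 0) else 0)"
    by (intro sum.cong) auto
  then show ?thesis by (simp add: congruence_nth)
qed

lemma congruence_zero_row: "row i A = 0 \<Longrightarrow> congruence A X $ i $ j = 0"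
  by (simp add: congruence_nth row_def vec_eq_iff)

lemma det_congruence: "det (congruence A X) = det A ^ 2 * det X"
  by (simp add: congruence_def det_mul power2_eq_square)

text \<open>Congruence read in the distinct entries, the coordinates in which Lebesgue measure on
  symmetric matrices is taken.\<close>

definition scong :: "real^'n^'n \<Rightarrow> real^('n uprod) \<Rightarrow> real^('n::finite uprod)" where
  "scong A v = svec (congruence A (smat v))"

lemma smat_scong: "smat (scong A v) = congruence A (smat v)"
  by (simp add: scong_def smat_svec transpose_congruence)

lemma linear_scong: "linear (scong A)"
  unfolding scong_def
  using linear_compose[OF linear_compose[OF linear_smat linear_congruence] linear_svec]
  by (simp add: o_def)

lemma scong_nth: "scong A v $ Upair i j = congruence A (smat v) $ i $ j"
  by (metis smat_nth smat_scong)

lemma scong_mult: "scong (A ** B) v = scong A (scong B v)"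
  by (simp add: scong_def congruence_mult smat_svec transpose_congruence)

lemma scong_diagonal:
  assumes "\<And>i j. i \<noteq> j \<Longrightarrow> A $ i $ j = 0"
  shows "scong A v $ u = svec (\<chi> i j. A $ i $ i * A $ j $ j) $ u * v $ u"
  using assms
  by (cases u) (simp add: scong_nth congruence_diagonal svec_nth transpose_def vec_eq_iff mult_ac)

text \<open>A diagonal matrix multiplies the entry at {i, j} by its i-th and j-th diagonal entries,
  and over all unordered pairs each index is used p + 1 times: once with each other index and twice
  with itself.\<close>

lemma abs_det_scong: "\<bar>det (matrix (scong (A :: real^'n^'n)))\<bar> = \<bar>det A\<bar> ^ (CARD('n) + 1)"
proof (rule det_matrix_action[where w = "\<lambda>a u. svec (\<chi> i j. a i * a j) $ u"])
  show "\<exists>u. \<forall>x. scong A x $ u = 0" if "row i A = 0" for A :: "real^'n^'n" and i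
    using that by (intro exI[of _ "Upair i i"]) (simp add: scong_nth congruence_zero_row)
  show "(\<Prod>u\<in>UNIV. \<bar>svec (\<chi> i j. a i * a j) $ u\<bar>) = \<bar>\<Prod>i\<in>UNIV. a i\<bar> ^ (CARD('n) + 1)" for a :: "'n \<Rightarrow> real"
    by (rule prod_uprod) (simp add: svec_nth transpose_def vec_eq_iff mult_ac)
qed (simp_all add: linear_scong scong_mult scong_def[of "mat 1"] scong_diagonal)

section \<open>Inverses, continuity and measurability of matrix operations\<close>

declare transpose_matrix_vector [simp del]

lemma matrix_inv_right:
  fixes A :: "real^'n^'n"
  assumes "det A \<noteq> 0"
  shows "A ** matrix_inv A = mat 1" and "matrix_inv A ** A = mat 1"
proof -
  have "\<exists>A'. A ** A' = mat 1 \<and> A' ** A = mat 1"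
    using assms invertible_det_nz[of A] by (simp add: invertible_def)
  then have "A ** matrix_inv A = mat 1 \<and> matrix_inv A ** A = mat 1"
    unfolding matrix_inv_def by (rule someI_ex)
  then show "A ** matrix_inv A = mat 1" and "matrix_inv A ** A = mat 1" by auto
qed

lemma matrix_inv_unique_left:
  fixes A :: "real^'n^'n"
  assumes "B ** A = mat 1"
  shows "matrix_inv A = B"
proof -
  have "det A \<noteq> 0" using arg_cong[OF assms, of det] by (auto simp: det_mul)
  then have "B ** (A ** matrix_inv A) = B" by (simp add: matrix_inv_right)
  then show ?thesis by (simp add: matrix_mul_assoc assms)
qed

lemma det_matrix_inv:
  fixes A :: "real^'n^'n"
  assumes "det A \<noteq> 0"
  shows "det (matrix_inv A) = inverse (det A)"
  using arg_cong[OF matrix_inv_right(1)[OF assms], of det] assms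
  by (simp add: det_mul field_simps)

lemma matrix_inv_mult:
  fixes A B :: "real^'n^'n"
  assumes "det A \<noteq> 0" "det B \<noteq> 0"
  shows "matrix_inv (A ** B) = matrix_inv B ** matrix_inv A"
proof (rule matrix_inv_unique_left)
  have "matrix_inv B ** matrix_inv A ** (A ** B) = matrix_inv B ** (matrix_inv A ** A) ** B"
    by (simp only: matrix_mul_assoc)
  then show "matrix_inv B ** matrix_inv A ** (A ** B) = mat 1"
    using assms by (simp add: matrix_inv_right)
qed

text \<open>Continuity of inversion rests on this: every entry is exhibited as a quotient of
  polynomials.\<close>

lemma matrix_inv_cramer:
  fixes A :: "real^'n^'n"
  assumes "det A \<noteq> 0"
  shows "matrix_inv A = (\<chi> k l. det (\<chi> i j. if j = k then axis l 1 $ i else A $ i $ j) / det A)"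
proof -
  have "A *v (matrix_inv A *v axis l 1) = axis l 1" for l
    by (simp add: matrix_vector_mul_assoc matrix_inv_right[OF assms])
  then have "matrix_inv A *v axis l 1 = (\<chi> k. det (\<chi> i j. if j = k then axis l 1 $ i else A $ i $ j) / det A)" for l
    using cramer[OF assms, of "matrix_inv A *v axis l 1" "axis l 1"] by simp
  moreover have "matrix_inv A $ k $ l = (matrix_inv A *v axis l 1) $ k" for k l
    by (simp add: matrix_vector_mul_component inner_axis)
  ultimately show ?thesis by (simp add: vec_eq_iff)
qed

lemma continuous_on_det [continuous_intros]:
  fixes f :: "'a::topological_space \<Rightarrow> real^'n^'n"
  shows "continuous_on X f \<Longrightarrow> continuous_on X (\<lambda>x. det (f x))"
  unfolding det_def by (intro continuous_intros)

lemma continuous_on_matrix_inv [continuous_intros]: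
  fixes f :: "'a::topological_space \<Rightarrow> real^'n^'n"
  assumes "continuous_on X f" "\<And>x. x \<in> X \<Longrightarrow> det (f x) \<noteq> 0"
  shows "continuous_on X (\<lambda>x. matrix_inv (f x))"
proof -
  have "continuous_on X (\<lambda>x. if j = k then axis l 1 $ i else f x $ i $ j)" for i j k and l :: 'n
    by (cases "j = k") (auto intro!: continuous_intros assms)
  then have "continuous_on X (\<lambda>x. (\<chi> k l. det (\<chi> i j. if j = k then axis l 1 $ i else f x $ i $ j) / det (f x)))"
    using assms by (intro continuous_intros) auto
  then show ?thesis
    by (rule continuous_on_eq) (simp add: matrix_inv_cramer assms(2))
qed

lemma continuous_on_matrix_mult [continuous_intros]:
  fixes f :: "'a::topological_space \<Rightarrow> real^'n^'m" and g :: "'a \<Rightarrow> real^'k^'n"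
  shows "continuous_on X f \<Longrightarrow> continuous_on X g \<Longrightarrow> continuous_on X (\<lambda>x. f x ** g x)"
  unfolding matrix_matrix_mult_def by (intro continuous_intros)

lemma continuous_on_matrix_vector_mult [continuous_intros]:
  fixes f :: "'a::topological_space \<Rightarrow> real^'n^'m" and g :: "'a \<Rightarrow> real^'n"
  shows "continuous_on X f \<Longrightarrow> continuous_on X g \<Longrightarrow> continuous_on X (\<lambda>x. f x *v g x)"
  unfolding matrix_vector_mult_def by (intro continuous_intros)

lemma continuous_on_transpose [continuous_intros]:
  fixes f :: "'a::topological_space \<Rightarrow> real^'n^'m"
  shows "continuous_on X f \<Longrightarrow> continuous_on X (\<lambda>x. transpose (f x))"
  unfolding transpose_def by (intro continuous_intros)

lemma continuous_on_congruence [continuous_intros]: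
  fixes f g :: "'a::topological_space \<Rightarrow> real^'n^'n"
  shows "continuous_on X f \<Longrightarrow> continuous_on X g \<Longrightarrow> continuous_on X (\<lambda>x. congruence (f x) (g x))"
  unfolding congruence_def by (intro continuous_intros)

lemma continuous_on_smat [continuous_intros]:
  "continuous_on X f \<Longrightarrow> continuous_on X (\<lambda>x. smat (f x))"
  unfolding smat_def by (intro continuous_intros)

lemma continuous_on_svec [continuous_intros]:
  "continuous_on X f \<Longrightarrow> continuous_on X (\<lambda>x. svec (f x))"
  unfolding svec_def Let_def by (intro continuous_intros)

lemma measurable_det [measurable]: "(\<lambda>A::real^'n^'n. det A) \<in> borel_measurable borel"
  by (intro borel_measurable_continuous_onI continuous_intros)

lemma measurable_smat [measurable]: "smat \<in> borel_measurable borel"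
  by (intro borel_measurable_continuous_onI continuous_on_smat continuous_intros)

lemma measurable_svec [measurable]: "svec \<in> borel_measurable borel"
  by (intro borel_measurable_continuous_onI continuous_on_svec continuous_intros)

lemma measurable_matrix_vector_mult' [measurable (raw)]:
  fixes f :: "'a \<Rightarrow> real^'n^'m"
  assumes "f \<in> borel_measurable M" "g \<in> borel_measurable M"
  shows "(\<lambda>x. f x *v g x) \<in> borel_measurable M"
  using assms by (rule borel_measurable_continuous_Pair) (intro continuous_intros)

lemma measurable_congruence [measurable (raw)]:
  fixes f g :: "'a \<Rightarrow> real^'n^'n"
  assumes "f \<in> borel_measurable M" "g \<in> borel_measurable M"
  shows "(\<lambda>x. congruence (f x) (g x)) \<in> borel_measurable M"
  using assms by (rule borel_measurable_continuous_Pair) (intro continuous_intros)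

lemma measurable_matrix_inv [measurable]:
  "(matrix_inv :: real^'n^'n \<Rightarrow> _) \<in> borel_measurable borel"
proof -
  have "continuous_on {A::real^'n^'n. det A \<noteq> 0} (\<lambda>A. matrix_inv A)"
    by (intro continuous_intros) auto
  moreover have "open {A::real^'n^'n. det A \<noteq> 0}"
    by (intro open_Collect_neq continuous_intros)
  \<comment> \<open>On singular matrices the choice inside \<open>matrix_inv\<close> is over an
    unsatisfiable predicate, so its value there is one fixed matrix and the piecewise description is
    legitimate.\<close>
  ultimately have "(\<lambda>A. if A \<in> {A::real^'n^'n. det A \<noteq> 0} then matrix_inv A else (SOME B::real^'n^'n. False)) \<in> borel_measurable borel"
    by (intro borel_measurable_continuous_on_if) auto
  moreover have "(if A \<in> {A::real^'n^'n. det A \<noteq> 0} then matrix_inv A else (SOME B. False)) = matrix_inv A" for A :: "real^'n^'n"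
  proof (cases "det A = 0")
    case True
    have "\<not> (A ** B = mat 1 \<and> B ** A = mat 1)" for B
      using True det_mul[of A B] by auto
    then have "(\<lambda>B. A ** B = mat 1 \<and> B ** A = mat 1) = (\<lambda>B. False)" by auto
    then show ?thesis using True unfolding matrix_inv_def by simp
  qed simp
  ultimately show ?thesis by (simp cong: measurable_cong)
qed

section \<open>Positive definite matrices\<close>

lemma inner_matrix_transpose:
  fixes A :: "real^'n^'m"
  shows "x \<bullet> (A *v y) = (transpose A *v x) \<bullet> y"
  by (simp add: dot_lmul_matrix flip: vector_transpose_matrix)

lemma inner_congruence:
  "x \<bullet> (congruence B A *v y) = (transpose B *v x) \<bullet> (A *v (transpose B *v y))"
  by (simp add: congruence_def inner_matrix_transpose[of _ B] flip: matrix_vector_mul_assoc)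

lemma pos_def_one: "pos_def (mat 1)"
  by (simp add: pos_def_def transpose_mat)

lemma pos_def_congruence:
  assumes "pos_def A" "det B \<noteq> 0"
  shows "pos_def (congruence B A)"
proof -
  have "transpose B *v x \<noteq> 0" if "x \<noteq> 0" for x
  proof
    assume "transpose B *v x = 0"
    then have "matrix_inv (transpose B) *v (transpose B *v x) = 0" by simp
    then show False
      using that matrix_inv_right(2)[of "transpose B"] assms(2)
      by (simp add: matrix_vector_mul_assoc)
  qed
  then show ?thesis
    using assms by (auto simp: pos_def_def transpose_congruence inner_congruence)
qed

text \<open>Gram-Schmidt for the inner product given by \<open>A\<close>: below full dimension some
  nonzero vector is orthogonal to all \<open>A *v x i\<close>, and it only has to be
  normalised.\<close>

lemma pos_def_orthonormal_family:
  fixes A :: "real^'n^'n"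
  assumes A: "pos_def A" and "k \<le> CARD('n)"
  shows "\<exists>x :: nat \<Rightarrow> real^'n. \<forall>i<k. \<forall>j<k. x i \<bullet> (A *v x j) = of_bool (i = j)"
  using \<open>k \<le> CARD('n)\<close>
proof (induction k)
  case (Suc k)
  then obtain x :: "nat \<Rightarrow> real^'n" where x: "\<And>i j. i < k \<Longrightarrow> j < k \<Longrightarrow> x i \<bullet> (A *v x j) = of_bool (i = j)"
    by auto
  have sym: "v \<bullet> (A *v w) = w \<bullet> (A *v v)" for v w
    using A inner_matrix_transpose[of v A w] by (simp add: pos_def_def inner_commute)
  let ?W = "(\<lambda>i. A *v x i) ` {..<k}"
  have "dim (span ?W) \<le> k"
    using dim_le_card'[of ?W] card_image_le[of "{..<k}" "\<lambda>i. A *v x i"] by simp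
  then have "dim (span ?W) < DIM(real^'n)" using Suc.prems by simp
  then obtain v where v: "v \<noteq> 0" "\<And>y. y \<in> span (span ?W) \<Longrightarrow> orthogonal v y"
    using orthogonal_to_subspace_exists[of "span ?W"] by auto
  then have v0: "v \<bullet> (A *v x i) = 0" if "i < k" for i
    using that by (simp add: orthogonal_def span_base)
  have pos: "v \<bullet> (A *v v) > 0" using A v(1) by (simp add: pos_def_def)
  let ?v = "(1 / sqrt (v \<bullet> (A *v v))) *\<^sub>R v"
  let ?x = "x(k := ?v)"
  have "?v \<bullet> (A *v ?v) = 1" using pos by (simp add: matrix_vector_mult_scaleR field_simps)
  moreover have "?v \<bullet> (A *v x i) = 0" "x i \<bullet> (A *v ?v) = 0" if "i < k" for i
    using v0[OF that] sym[of "x i" v] by (simp_all add: matrix_vector_mult_scaleR)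
  ultimately have "\<forall>i<Suc k. \<forall>j<Suc k. ?x i \<bullet> (A *v ?x j) = of_bool (i = j)"
    using x by (auto simp: less_Suc_eq)
  then show ?case by (rule exI[of _ ?x])
qed simp

text \<open>If the columns of X are orthonormal for \<open>A\<close>, then X^T A X is the identity
  and the transposed inverse of X serves as \<open>B\<close>. Congruences thus carry the identity to
  every positive definite matrix, the transitivity on which the invariance argument depends.\<close>

lemma pos_def_factor:
  fixes A :: "real^'n^'n"
  assumes A: "pos_def A"
  obtains B where "det B \<noteq> 0" "A = congruence B (mat 1)"
proof -
  obtain x :: "nat \<Rightarrow> real^'n" where x: "\<And>i j. i < CARD('n) \<Longrightarrow> j < CARD('n) \<Longrightarrow> x i \<bullet> (A *v x j) = of_bool (i = j)"
    using pos_def_orthonormal_family[OF A, of "CARD('n)"] by auto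
  obtain e :: "'n \<Rightarrow> nat" where e: "bij_betw e UNIV {0..<CARD('n)}"
    using ex_bij_betw_finite_nat[of "UNIV :: 'n set"] by auto
  define X where "X = transpose (\<chi> i. x (e i))"
  have lt: "e i < CARD('n)" for i using e by (auto simp: bij_betw_def)
  have inj: "e i = e j \<longleftrightarrow> i = j" for i j using e by (auto simp: bij_betw_def inj_on_def)
  have Xa: "X *v axis i 1 = x (e i)" for i
    by (simp add: X_def vec_eq_iff matrix_vector_mul_component inner_axis transpose_def)
  have "(transpose X ** A ** X) $ i $ j = axis i 1 \<bullet> ((transpose X ** A ** X) *v axis j 1)" for i j
    by (simp add: inner_axis inner_axis' matrix_vector_mul_component)
  also have "\<dots> i j = of_bool (i = j)" for i j
    by (simp add: inner_matrix_transpose[of _ "transpose X"] Xa x lt inj flip: matrix_vector_mul_assoc)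
  finally have XAX: "transpose X ** A ** X = mat 1"
    by (simp add: vec_eq_iff mat_def)
  then have "det (transpose X ** A ** X) = 1" by (simp only: det_I)
  then have detX: "det X \<noteq> 0" by (auto simp: det_mul)
  let ?Y = "matrix_inv X"
  have "transpose ?Y ** (transpose X ** A ** X) ** ?Y = transpose (X ** ?Y) ** A ** (X ** ?Y)"
    by (simp add: matrix_transpose_mul matrix_mul_assoc)
  then have "A = congruence (transpose ?Y) (mat 1)"
    by (simp add: XAX matrix_inv_right[OF detX] congruence_def transpose_mat)
  moreover have "det (transpose ?Y) \<noteq> 0" by (simp add: det_matrix_inv detX)
  ultimately show ?thesis by (rule that[rotated])
qed

lemma pos_def_det_pos: "pos_def A \<Longrightarrow> det A > 0"
  by (erule pos_def_factor) (simp add: det_congruence)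

text \<open>The complement is the projection of a closed set along the unit sphere, and projection
  along a compact factor is closed. Symmetry is left out because the symmetric matrices are in
  general not open among all matrices.\<close>

lemma open_pos_quadratic: "open {A :: real^'n^'n. \<forall>x. x \<noteq> 0 \<longrightarrow> x \<bullet> (A *v x) > 0}"
proof -
  let ?S = "sphere (0 :: real^'n) 1"
  have "closed {y. \<exists>x. x \<in> ?S \<and> (x, y) \<in> {(x, A :: real^'n^'n). x \<bullet> (A *v x) \<le> 0}}"
  proof (rule closed_compact_projection)
    have "continuous_on UNIV (\<lambda>q :: (real^'n) \<times> (real^'n^'n). fst q \<bullet> (snd q *v fst q))"
      by (intro continuous_intros)
    then show "closed {(x, A :: real^'n^'n). x \<bullet> (A *v x) \<le> 0}"
      by (auto simp: split_def intro!: closed_Collect_le continuous_intros)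
  qed simp
  moreover have "(\<forall>x. x \<noteq> 0 \<longrightarrow> x \<bullet> (A *v x) > 0) \<longleftrightarrow> \<not> (\<exists>x. x \<in> ?S \<and> x \<bullet> (A *v x) \<le> 0)" for A :: "real^'n^'n"
  proof (intro iffI allI impI)
    fix x :: "real^'n"
    assume *: "\<not> (\<exists>x. x \<in> ?S \<and> x \<bullet> (A *v x) \<le> 0)" and "x \<noteq> 0"
    have "(1 / norm x) *\<^sub>R x \<in> ?S" using \<open>x \<noteq> 0\<close> by simp
    then have "((1 / norm x) *\<^sub>R x) \<bullet> (A *v ((1 / norm x) *\<^sub>R x)) > 0" using * by (meson not_le)
    then show "x \<bullet> (A *v x) > 0" using \<open>x \<noteq> 0\<close>
      by (simp add: matrix_vector_mult_scaleR zero_less_mult_iff zero_less_divide_iff)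
  next
    fix A :: "real^'n^'n"
    assume *: "\<forall>x. x \<noteq> 0 \<longrightarrow> x \<bullet> (A *v x) > 0"
    have "x \<noteq> 0" if "x \<in> ?S" for x using that by auto
    with * show "\<not> (\<exists>x. x \<in> ?S \<and> x \<bullet> (A *v x) \<le> 0)" by (meson not_le)
  qed
  then have *: "{A :: real^'n^'n. \<forall>x. x \<noteq> 0 \<longrightarrow> x \<bullet> (A *v x) > 0}
    = - {y. \<exists>x. x \<in> ?S \<and> (x, y) \<in> {(x, A :: real^'n^'n). x \<bullet> (A *v x) \<le> 0}}"
    by auto
  ultimately show ?thesis by (simp only: *) (rule open_Compl)
qed

lemma measurable_pos_def [measurable]: "Measurable.pred borel (pos_def :: real^'n^'n \<Rightarrow> bool)"
proof -
  have "{A :: real^'n^'n. pos_def A} = {A. transpose A = A} \<inter> {A. \<forall>x. x \<noteq> 0 \<longrightarrow> x \<bullet> (A *v x) > 0}"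
    by (auto simp: pos_def_def)
  moreover have "closed {A :: real^'n^'n. transpose A = A}"
    by (intro closed_Collect_eq continuous_intros)
  ultimately have "{A :: real^'n^'n. pos_def A} \<in> sets borel"
    using open_pos_quadratic by (auto intro: borel_open borel_closed)
  then show ?thesis by (simp add: pred_def)
qed

lemma open_pos_def_smat: "open {v :: real^('n::finite uprod). pos_def (smat v)}"
proof -
  have *: "{v. pos_def (smat v)} = smat -` {A :: real^'n^'n. \<forall>x. x \<noteq> 0 \<longrightarrow> x \<bullet> (A *v x) > 0}"
    by (auto simp: pos_def_def)
  have "continuous_on UNIV (smat :: _ \<Rightarrow> real^'n^'n)"
    by (intro continuous_on_smat continuous_intros)
  then show ?thesis unfolding * by (rule open_vimage[OF open_pos_quadratic])
qed

section \<open>Measures invariant under affine maps\<close>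

text \<open>Flattened matrices are vectors of type \<open>real^'k\<close>, so a linear map of
  matrices gets a representing square matrix with a determinant.\<close>

definition matp :: "real^('n \<times> 'n) \<Rightarrow> real^'n^'n::finite" where
  "matp a = (\<chi> i j. a $ (i, j))"

definition vecp :: "real^'n^'n \<Rightarrow> real^('n \<times> 'n::finite)" where
  "vecp A = (\<chi> u. A $ fst u $ snd u)"

lemma matp_vecp [simp]: "matp (vecp A) = A" and vecp_matp [simp]: "vecp (matp a) = a"
  by (simp_all add: matp_def vecp_def vec_eq_iff)

lemma matp_nth [simp]: "matp a $ i $ j = a $ (i, j)" and vecp_nth [simp]: "vecp A $ u = A $ fst u $ snd u"
  by (simp_all add: matp_def vecp_def)

lemma continuous_on_matp [continuous_intros]:
  "continuous_on X f \<Longrightarrow> continuous_on X (\<lambda>x. matp (f x))"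
  unfolding matp_def by (intro continuous_intros)

lemma measurable_matp [measurable]: "matp \<in> borel_measurable borel"
  by (intro borel_measurable_continuous_onI continuous_on_matp continuous_intros)

lemma measurable_matrix_mult [measurable (raw)]:
  fixes f :: "'a \<Rightarrow> real^'n^'m" and g :: "'a \<Rightarrow> real^'k^'n"
  assumes "f \<in> borel_measurable M" "g \<in> borel_measurable M"
  shows "(\<lambda>x. f x ** g x) \<in> borel_measurable M"
  using assms by (rule borel_measurable_continuous_Pair) (intro continuous_intros)

lemma prod_pairs_fst:
  fixes a :: "'n::finite \<Rightarrow> real"
  shows "(\<Prod>u\<in>(UNIV :: ('n \<times> 'n) set). \<bar>a (fst u)\<bar>) = \<bar>\<Prod>i\<in>UNIV. a i\<bar> ^ CARD('n)"
    and "(\<Prod>u\<in>(UNIV :: ('n \<times> 'n) set). \<bar>a (snd u)\<bar>) = \<bar>\<Prod>i\<in>UNIV. a i\<bar> ^ CARD('n)"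
proof -
  have UN: "(UNIV :: ('n \<times> 'n) set) = UNIV \<times> UNIV" by simp
  show "(\<Prod>u\<in>(UNIV :: ('n \<times> 'n) set). \<bar>a (fst u)\<bar>) = \<bar>\<Prod>i\<in>UNIV. a i\<bar> ^ CARD('n)"
    unfolding UN using prod.cartesian_product[of "\<lambda>i j. \<bar>a i\<bar>" "UNIV :: 'n set" "UNIV :: 'n set"]
    by (simp add: split_def abs_prod prod_power_distrib)
  show "(\<Prod>u\<in>(UNIV :: ('n \<times> 'n) set). \<bar>a (snd u)\<bar>) = \<bar>\<Prod>i\<in>UNIV. a i\<bar> ^ CARD('n)"
    unfolding UN using prod.cartesian_product[of "\<lambda>i j. \<bar>a j\<bar>" "UNIV :: 'n set" "UNIV :: 'n set"]
    by (simp add: split_def abs_prod)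
qed

lemma diagonal_matrix_mult_nth:
  fixes A X :: "real^'n^'n"
  assumes "\<And>i j. i \<noteq> j \<Longrightarrow> A $ i $ j = 0"
  shows "(A ** X) $ i $ j = A $ i $ i * X $ i $ j"
    and "(X ** transpose A) $ i $ j = X $ i $ j * A $ j $ j"
proof -
  have "(\<Sum>k\<in>UNIV. A $ i $ k * X $ k $ j) = (\<Sum>k\<in>UNIV. if k = i then A $ i $ i * X $ i $ j else 0)"
    by (rule sum.cong) (use assms in auto)
  then show "(A ** X) $ i $ j = A $ i $ i * X $ i $ j" by (simp add: matrix_matrix_mult_def)
  have "(\<Sum>k\<in>UNIV. X $ i $ k * A $ j $ k) = (\<Sum>k\<in>UNIV. if k = j then X $ i $ j * A $ j $ j else 0)"
    by (rule sum.cong) (use assms in auto)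
  then show "(X ** transpose A) $ i $ j = X $ i $ j * A $ j $ j"
    by (simp add: matrix_matrix_mult_def transpose_def)
qed

lemma abs_det_left_mult:
  "\<bar>det (matrix (\<lambda>a. vecp (A ** matp a)))\<bar> = \<bar>det (A :: real^'n^'n)\<bar> ^ CARD('n)"
proof (rule det_matrix_action[where w = "\<lambda>a u. a (fst u)"])
  show "linear (\<lambda>a. vecp (A ** matp a))" for A :: "real^'n^'n"
    by (intro linearI) (simp_all add: vec_eq_iff matrix_matrix_mult_def algebra_simps sum.distrib sum_distrib_left)
  show "\<exists>u. \<forall>x. vecp (A ** matp x) $ u = 0" if "row i A = 0" for A :: "real^'n^'n" and i
    using that by (intro exI[of _ "(i, i)"]) (simp add: matrix_matrix_mult_def row_def vec_eq_iff)
qed (simp_all add: matrix_mul_assoc diagonal_matrix_mult_nth prod_pairs_fst)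

text \<open>The transpose turns right multiplication into a left action of \<open>A\<close>, the
  form that \<open>det_matrix_action\<close> demands.\<close>

lemma abs_det_right_mult:
  "\<bar>det (matrix (\<lambda>a. vecp (matp a ** transpose A)))\<bar> = \<bar>det (A :: real^'n^'n)\<bar> ^ CARD('n)"
proof (rule det_matrix_action[where w = "\<lambda>a u. a (snd u)"])
  show "linear (\<lambda>a. vecp (matp a ** transpose A))" for A :: "real^'n^'n"
    by (intro linearI) (simp_all add: vec_eq_iff matrix_matrix_mult_def algebra_simps sum.distrib sum_distrib_left)
  show "\<exists>u. \<forall>x. vecp (matp x ** transpose A) $ u = 0" if "row i A = 0" for A :: "real^'n^'n" and i
    using that by (intro exI[of _ "(i, i)"]) (simp add: matrix_matrix_mult_def row_def vec_eq_iff transpose_def)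
qed (simp_all add: matrix_transpose_mul matrix_mul_assoc diagonal_matrix_mult_nth prod_pairs_fst transpose_mat)

lemma nn_integral_lborel_linear:
  fixes f :: "real^'n \<Rightarrow> ennreal"
  assumes "f \<in> borel_measurable borel" "linear g" "det (matrix g) \<noteq> 0"
  shows "ennreal \<bar>det (matrix g)\<bar> * (\<integral>\<^sup>+x. f (g x) \<partial>lborel) = (\<integral>\<^sup>+x. f x \<partial>lborel)"
proof -
  have "matrix g *v x = g x" for x using assms(2) by (simp add: matrix_works)
  then show ?thesis using nn_integral_lborel_matrix[OF assms(1,3)] by (simp only:)
qed

lemma nn_integral_matrix_left_mult:
  fixes f :: "real^'n^'n \<Rightarrow> ennreal"
  assumes [measurable]: "f \<in> borel_measurable borel" and "det B \<noteq> 0"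
  shows "ennreal (\<bar>det B\<bar> ^ CARD('n)) * (\<integral>\<^sup>+a. f (B ** matp a) \<partial>lborel) = (\<integral>\<^sup>+a. f (matp a) \<partial>lborel)"
proof -
  let ?g = "\<lambda>a. vecp (B ** matp a)"
  have "linear ?g"
    by (intro linearI) (simp_all add: vec_eq_iff matrix_matrix_mult_def algebra_simps sum.distrib sum_distrib_left)
  moreover have "det (matrix ?g) \<noteq> 0" using abs_det_left_mult[of B] assms(2) by auto
  ultimately show ?thesis
    using nn_integral_lborel_linear[of "\<lambda>a. f (matp a)" ?g] by (simp add: abs_det_left_mult)
qed

lemma nn_integral_matrix_right_mult:
  fixes f :: "real^'n^'n \<Rightarrow> ennreal"
  assumes [measurable]: "f \<in> borel_measurable borel" and "det B \<noteq> 0"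
  shows "ennreal (\<bar>det B\<bar> ^ CARD('n)) * (\<integral>\<^sup>+a. f (matp a ** B) \<partial>lborel) = (\<integral>\<^sup>+a. f (matp a) \<partial>lborel)"
proof -
  let ?g = "\<lambda>a. vecp (matp a ** B)"
  have "linear ?g"
    by (intro linearI) (simp_all add: vec_eq_iff matrix_matrix_mult_def algebra_simps sum.distrib sum_distrib_left)
  moreover have det: "\<bar>det (matrix ?g)\<bar> = \<bar>det B\<bar> ^ CARD('n)" using abs_det_right_mult[of "transpose B"] by simp
  moreover have "det (matrix ?g) \<noteq> 0" using det assms(2) by auto
  ultimately show ?thesis
    using nn_integral_lborel_linear[of "\<lambda>a. f (matp a)" ?g] by simp
qed

lemma nn_integral_lborel_translate:
  fixes f :: "'a::euclidean_space \<Rightarrow> ennreal"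
  assumes [measurable]: "f \<in> borel_measurable borel"
  shows "(\<integral>\<^sup>+x. f (x + b) \<partial>lborel) = (\<integral>\<^sup>+x. f x \<partial>lborel)"
proof -
  have "(\<integral>\<^sup>+x. f (b + x) \<partial>lborel) = (\<integral>\<^sup>+x. f x \<partial>distr lborel borel ((+) b))"
    by (simp add: nn_integral_distr)
  then show ?thesis by (simp add: lborel_distr_plus add.commute)
qed

lemma nn_integral_lborel_affine:
  fixes f :: "real^'n \<Rightarrow> ennreal"
  assumes [measurable]: "f \<in> borel_measurable borel" and "det A \<noteq> 0"
  shows "ennreal \<bar>det A\<bar> * (\<integral>\<^sup>+x. f (A *v x + b) \<partial>lborel) = (\<integral>\<^sup>+x. f x \<partial>lborel)"
  using nn_integral_lborel_matrix[of "\<lambda>x. f (x + b)" A] assms(2)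
  by (simp add: nn_integral_lborel_translate)

lemma nn_integral_lborel_affine_inv:
  fixes f :: "real^'n \<Rightarrow> ennreal"
  assumes [measurable]: "f \<in> borel_measurable borel" and "det A \<noteq> 0"
  shows "(\<integral>\<^sup>+b. f (matrix_inv A *v (x - b)) \<partial>lborel) = ennreal \<bar>det A\<bar> * (\<integral>\<^sup>+b. f b \<partial>lborel)"
proof -
  let ?B = "- matrix_inv A"
  \<comment> \<open>The sign (-1)^p of the reflection disappears when determinants are
    squared.\<close>
  have "?B ** ?B = matrix_inv A ** matrix_inv A" by (simp add: matrix_matrix_mult_def vec_eq_iff)
  then have "det ?B * det ?B = det (matrix_inv A) * det (matrix_inv A)" by (metis det_mul)
  then have "\<bar>det ?B\<bar> = \<bar>det (matrix_inv A)\<bar>"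
    by (simp only: abs_eq_iff square_eq_iff)
  then have detB: "\<bar>det ?B\<bar> = inverse \<bar>det A\<bar>"
    using assms(2) by (simp add: det_matrix_inv)
  have "matrix_inv A *v (x - b) = ?B *v b + matrix_inv A *v x" for b
    by (simp add: algebra_simps matrix_vector_mult_def vec_eq_iff sum_negf sum_subtractf)
  moreover have "det ?B \<noteq> 0" using detB assms(2) by (metis abs_eq_0 inverse_nonzero_iff_nonzero)
  ultimately have "ennreal \<bar>det ?B\<bar> * (\<integral>\<^sup>+b. f (matrix_inv A *v (x - b)) \<partial>lborel) = (\<integral>\<^sup>+b. f b \<partial>lborel)"
    using nn_integral_lborel_affine[OF assms(1), of ?B "matrix_inv A *v x"] by simp
  then have "ennreal \<bar>det A\<bar> * ennreal (inverse \<bar>det A\<bar>) * (\<integral>\<^sup>+b. f (matrix_inv A *v (x - b)) \<partial>lborel) = ennreal \<bar>det A\<bar> * (\<integral>\<^sup>+b. f b \<partial>lborel)"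
    by (simp add: detB mult.assoc)
  then show ?thesis using assms(2) by (simp flip: ennreal_mult)
qed

lemma powr_mult_power:
  fixes x :: real
  assumes "x > 0" "q = r + real n"
  shows "x powr r * x ^ n = x powr q"
  using assms by (simp add: powr_add powr_realpow)

lemma ennreal_mult_eq:
  assumes "x * y = z" "0 \<le> x" "0 \<le> y"
  shows "ennreal x * (ennreal y * c) = ennreal z * c"
  using assms by (simp add: ennreal_mult mult.assoc flip: assms(1))

text \<open>Both sides evaluate the integral of \<open>\<psi> (m z, S z)\<close> times \<open>\<phi>\<close> at the image of \<open>(m z, S z)\<close> under the
  affine map \<open>x \<mapsto> A x + b\<close>, over all \<open>A\<close>, \<open>b\<close> and \<open>z\<close>.\<close>

theorem relatively_invariant_measure:
  fixes N :: "'z measure" and m :: "'z \<Rightarrow> real^'p" and S :: "'z \<Rightarrow> real^'p^'p" and n :: nat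
    and \<phi> \<psi> :: "(real^'p) \<times> (real^'p^'p) \<Rightarrow> ennreal"
  assumes N: "sigma_finite_measure N"
    and [measurable]: "m \<in> borel_measurable N" "S \<in> borel_measurable N"
      "\<phi> \<in> borel_measurable borel" "\<psi> \<in> borel_measurable borel"
    and pd: "AE z in N. pos_def (S z)"
    and inv: "\<And>A b f. det A \<noteq> 0 \<Longrightarrow> f \<in> borel_measurable borel \<Longrightarrow>
      ennreal (\<bar>det A\<bar> ^ n) * (\<integral>\<^sup>+z. f (A *v m z + b, congruence A (S z)) \<partial>N) = (\<integral>\<^sup>+z. f (m z, S z) \<partial>N)"
  shows "(\<integral>\<^sup>+a. ennreal (\<bar>det (matp a)\<bar> powr - real CARD('p)) *
        (\<integral>\<^sup>+b. \<psi> (b, congruence (matrix_inv (matp a)) (mat 1)) \<partial>lborel) \<partial>lborel) * (\<integral>\<^sup>+z. \<phi> (m z, S z) \<partial>N)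
    = (\<integral>\<^sup>+a. ennreal (\<bar>det (matp a)\<bar> powr (real n - 1 - CARD('p))) *
        (\<integral>\<^sup>+b. \<phi> (b, congruence (matp a) (mat 1)) \<partial>lborel) \<partial>lborel) *
      (\<integral>\<^sup>+z. \<psi> (m z, S z) * ennreal (det (S z) powr (- (real n - 1) / 2)) \<partial>N)"
proof -
  interpret N: sigma_finite_measure N by fact
  \<comment> \<open>\<open>?q\<close> is chosen so that, after a factor |det|^(-n) from the
    invariance of \<open>N\<close> and a factor |det| from the integral over \<open>b\<close>, the
    weight is |det|^(-p), which is Haar measure on the invertible matrices.\<close>
  let ?p = "real CARD('p)" and ?q = "real n - 1 - real CARD('p)"
  let ?l = "\<integral>\<^sup>+a. ennreal (\<bar>det (matp a)\<bar> powr - ?p) *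
        (\<integral>\<^sup>+b. \<psi> (b, congruence (matrix_inv (matp a)) (mat 1)) \<partial>lborel) \<partial>(lborel :: (real^('p \<times> 'p)) measure)"
  let ?k = "\<integral>\<^sup>+a. ennreal (\<bar>det (matp a)\<bar> powr ?q) *
        (\<integral>\<^sup>+b. \<phi> (b, congruence (matp a) (mat 1)) \<partial>lborel) \<partial>(lborel :: (real^('p \<times> 'p)) measure)"
  let ?X = "\<integral>\<^sup>+a. \<integral>\<^sup>+b. \<integral>\<^sup>+z. ennreal (\<bar>det (matp a)\<bar> powr ?q) *
      (\<psi> (m z, S z) * \<phi> (matp a *v m z + b, congruence (matp a) (S z))) \<partial>N \<partial>lborel \<partial>(lborel :: (real^('p \<times> 'p)) measure)"
  have swap: "(\<integral>\<^sup>+a. \<integral>\<^sup>+b. \<integral>\<^sup>+z. f (a, b, z) \<partial>N \<partial>lborel \<partial>lborel) = (\<integral>\<^sup>+z. \<integral>\<^sup>+a. \<integral>\<^sup>+b. f (a, b, z) \<partial>lborel \<partial>lborel \<partial>N)"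
    if [measurable]: "f \<in> borel_measurable (lborel \<Otimes>\<^sub>M lborel \<Otimes>\<^sub>M N)" for f :: "(real^('p \<times> 'p)) \<times> (real^'p) \<times> 'z \<Rightarrow> ennreal"
  proof -
    interpret p2: pair_sigma_finite "lborel :: (real^'p) measure" N ..
    interpret p3: pair_sigma_finite "lborel :: (real^('p \<times> 'p)) measure" N ..
    have "(\<integral>\<^sup>+a. \<integral>\<^sup>+b. \<integral>\<^sup>+z. f (a, b, z) \<partial>N \<partial>lborel \<partial>lborel) = (\<integral>\<^sup>+a. \<integral>\<^sup>+z. \<integral>\<^sup>+b. f (a, b, z) \<partial>lborel \<partial>N \<partial>lborel)"
      by (intro nn_integral_cong p2.Fubini'[symmetric]) simp
    also have "\<dots> = (\<integral>\<^sup>+z. \<integral>\<^sup>+a. \<integral>\<^sup>+b. f (a, b, z) \<partial>lborel \<partial>lborel \<partial>N)"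
      by (intro p3.Fubini'[symmetric]) simp
    finally show ?thesis .
  qed
  have powr_q: "x powr q = y powr - q * (x * y) powr q" if "x \<ge> 0" "y > 0" for x y q :: real
    using that by (simp add: powr_mult powr_minus)
  \<comment> \<open>First evaluation, for fixed \<open>z\<close>: translating \<open>b\<close>
    removes the mean. With \<Sigma> = B B^T, passing from \<open>matp a\<close> to
    \<open>matp a ** B\<close> costs |det B|^(-q) from the weight and |det B|^(-p) from Lebesgue
    measure, in total det \<Sigma> to the power -(n - 1)/2.\<close>
  have psi_k: "(\<integral>\<^sup>+a. \<integral>\<^sup>+b. ennreal (\<bar>det (matp a)\<bar> powr ?q) *
      (c * \<phi> (matp a *v x + b, congruence (matp a) \<Sigma>)) \<partial>lborel \<partial>lborel)
      = ?k * (c * ennreal (det \<Sigma> powr (- (real n - 1) / 2)))" if pd': "pos_def \<Sigma>" for c x \<Sigma>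
  proof -
    obtain B where B: "det B \<noteq> 0" "\<Sigma> = congruence B (mat 1)" using pos_def_factor[OF pd'] .
    let ?f = "\<lambda>A. ennreal (\<bar>det A\<bar> powr ?q) * (\<integral>\<^sup>+b. \<phi> (b, congruence A (mat 1)) \<partial>lborel)"
    have "(\<integral>\<^sup>+b. ennreal (\<bar>det (matp a)\<bar> powr ?q) *
        (c * \<phi> (matp a *v x + b, congruence (matp a) \<Sigma>)) \<partial>lborel)
      = c * (ennreal (\<bar>det B\<bar> powr - ?q) * ?f (matp a ** B))" for a
    proof -
      have "(\<integral>\<^sup>+b. ennreal (\<bar>det (matp a)\<bar> powr ?q) * (c * \<phi> (matp a *v x + b, congruence (matp a) \<Sigma>)) \<partial>lborel)
        = c * (ennreal (\<bar>det (matp a)\<bar> powr ?q) * (\<integral>\<^sup>+b. \<phi> (b + matp a *v x, congruence (matp a) \<Sigma>) \<partial>lborel))"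
        by (simp add: nn_integral_cmult mult.left_commute add.commute)
      also have "(\<integral>\<^sup>+b. \<phi> (b + matp a *v x, congruence (matp a) \<Sigma>) \<partial>lborel) = (\<integral>\<^sup>+b. \<phi> (b, congruence (matp a) \<Sigma>) \<partial>lborel)"
        by (rule nn_integral_lborel_translate) simp
      also have "c * (ennreal (\<bar>det (matp a)\<bar> powr ?q) * (\<integral>\<^sup>+b. \<phi> (b, congruence (matp a) \<Sigma>) \<partial>lborel))
        = c * (ennreal (\<bar>det B\<bar> powr - ?q * \<bar>det (matp a ** B)\<bar> powr ?q) * (\<integral>\<^sup>+b. \<phi> (b, congruence (matp a ** B) (mat 1)) \<partial>lborel))"
        using B(1) powr_q[of "\<bar>det (matp a)\<bar>" "\<bar>det B\<bar>" ?q] by (simp add: det_mul abs_mult B(2) congruence_mult)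
      finally show ?thesis by (simp only: ennreal_mult powr_ge_zero mult.assoc)
    qed
    then have "(\<integral>\<^sup>+a. \<integral>\<^sup>+b. ennreal (\<bar>det (matp a)\<bar> powr ?q) *
      (c * \<phi> (matp a *v x + b, congruence (matp a) \<Sigma>)) \<partial>lborel \<partial>lborel)
      = c * (ennreal (\<bar>det B\<bar> powr - ?q) * (\<integral>\<^sup>+a. ?f (matp a ** B) \<partial>lborel))"
      by (simp add: nn_integral_cmult)
    also have "(\<integral>\<^sup>+a. ?f (matp a ** B) \<partial>lborel) = ennreal (\<bar>det B\<bar> powr - ?p) * ?k"
    proof -
      have "ennreal (\<bar>det B\<bar> powr - ?p) * (ennreal (\<bar>det B\<bar> ^ CARD('p)) * (\<integral>\<^sup>+a. ?f (matp a ** B) \<partial>lborel))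
        = ennreal (\<bar>det B\<bar> powr - ?p) * ?k"
        by (subst nn_integral_matrix_right_mult[OF _ B(1)]) simp_all
      moreover have "\<bar>det B\<bar> powr - ?p * \<bar>det B\<bar> ^ CARD('p) = 1"
        using B(1) by (simp add: powr_minus powr_realpow)
      ultimately show ?thesis by (simp flip: ennreal_mult mult.assoc)
    qed
    also have "ennreal (\<bar>det B\<bar> powr - ?q) * (ennreal (\<bar>det B\<bar> powr - ?p) * ?k) = ennreal (det \<Sigma> powr (- (real n - 1) / 2)) * ?k"
    proof -
      have "\<bar>det B\<bar> powr - ?q * \<bar>det B\<bar> powr - ?p = \<bar>det B\<bar> powr (- (real n - 1))"
        by (simp flip: powr_add)
      also have "\<dots> = (\<bar>det B\<bar> powr 2) powr (- (real n - 1) / 2)"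
        by (simp only: powr_powr) (simp add: diff_divide_distrib)
      also have "\<bar>det B\<bar> powr 2 = det \<Sigma>"
        using B by (simp add: det_congruence powr_numeral)
      finally show ?thesis by (simp flip: ennreal_mult mult.assoc)
    qed
    finally show ?thesis by (simp add: mult_ac)
  qed
  have "?X = (\<integral>\<^sup>+z. \<integral>\<^sup>+a. \<integral>\<^sup>+b. ennreal (\<bar>det (matp a)\<bar> powr ?q) *
      (\<psi> (m z, S z) * \<phi> (matp a *v m z + b, congruence (matp a) (S z))) \<partial>lborel \<partial>lborel \<partial>N)"
    using swap[of "\<lambda>(a, b, z). ennreal (\<bar>det (matp a)\<bar> powr ?q) *
      (\<psi> (m z, S z) * \<phi> (matp a *v m z + b, congruence (matp a) (S z)))"] by simp
  also have "\<dots> = (\<integral>\<^sup>+z. ?k * (\<psi> (m z, S z) * ennreal (det (S z) powr (- (real n - 1) / 2))) \<partial>N)"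
    by (intro nn_integral_cong_AE eventually_mono[OF pd] psi_k)
  also have "\<dots> = ?k * (\<integral>\<^sup>+z. \<psi> (m z, S z) * ennreal (det (S z) powr (- (real n - 1) / 2)) \<partial>N)"
    by (rule nn_integral_cmult) simp
  finally have X1: "?X = \<dots>" .

  let ?h = "\<lambda>a. \<bar>det (matp a)\<bar> powr (?q - n)"
  \<comment> \<open>Second evaluation: for fixed \<open>a\<close> and \<open>b\<close> the
    invariance of \<open>N\<close> shifts the affine map from the argument of \<phi> to its inverse
    in the argument of \<psi>. For singular \<open>matp a\<close> both sides vanish, since 0
    \<open>powr\<close> anything is 0.\<close>
  have "(\<integral>\<^sup>+z. ennreal (\<bar>det (matp a)\<bar> powr ?q) * (\<psi> (m z, S z) * \<phi> (matp a *v m z + b, congruence (matp a) (S z))) \<partial>N)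
      = (\<integral>\<^sup>+z. ennreal (?h a) *
          (\<psi> (matrix_inv (matp a) *v (m z - b), congruence (matrix_inv (matp a)) (S z)) * \<phi> (m z, S z)) \<partial>N)" for a b
  proof (cases "det (matp a) = 0")
    case False
    let ?A = "matp a"
    let ?f = "\<lambda>q. \<psi> (matrix_inv ?A *v (fst q - b), congruence (matrix_inv ?A) (snd q)) * \<phi> q"
    have [measurable]: "(fst :: (real^'p) \<times> (real^'p^'p) \<Rightarrow> _) \<in> borel_measurable borel"
      "(snd :: (real^'p) \<times> (real^'p^'p) \<Rightarrow> _) \<in> borel_measurable borel"
      by (intro borel_measurable_continuous_onI continuous_intros)+
    have "?f \<in> borel_measurable borel" by measurable
    moreover
have "?f (?A *v m z + b, congruence ?A (S z)) = \<psi> (m z, S z) * \<phi> (?A *v m z + b, congruence ?A (S z))" for z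
      by (simp add: matrix_vector_mul_assoc matrix_inv_right[OF False] flip: congruence_mult)
    ultimately have "ennreal (\<bar>det ?A\<bar> ^ n) * (\<integral>\<^sup>+z. \<psi> (m z, S z) * \<phi> (?A *v m z + b, congruence ?A (S z)) \<partial>N)
        = (\<integral>\<^sup>+z. ?f (m z, S z) \<partial>N)"
      using inv[OF False, of ?f b] by simp
    then have "ennreal (?h a) * (ennreal (\<bar>det ?A\<bar> ^ n) * (\<integral>\<^sup>+z. \<psi> (m z, S z) * \<phi> (?A *v m z + b, congruence ?A (S z)) \<partial>N))
        = ennreal (?h a) * (\<integral>\<^sup>+z. ?f (m z, S z) \<partial>N)"
      by (rule arg_cong)
    moreover have "?h a * \<bar>det ?A\<bar> ^ n = \<bar>det ?A\<bar> powr ?q"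
      by (rule powr_mult_power) (use False in simp_all)
    ultimately have "ennreal (\<bar>det ?A\<bar> powr ?q) * (\<integral>\<^sup>+z. \<psi> (m z, S z) * \<phi> (?A *v m z + b, congruence ?A (S z)) \<partial>N)
        = ennreal (?h a) * (\<integral>\<^sup>+z. ?f (m z, S z) \<partial>N)"
      by (subst (asm) ennreal_mult_eq) simp_all
    then show ?thesis by (simp add: nn_integral_cmult)
  qed simp
  then have "?X = (\<integral>\<^sup>+a. \<integral>\<^sup>+b. \<integral>\<^sup>+z. ennreal (?h a) *
          (\<psi> (matrix_inv (matp a) *v (m z - b), congruence (matrix_inv (matp a)) (S z)) * \<phi> (m z, S z)) \<partial>N \<partial>lborel \<partial>lborel)"
    by simp
  also have "\<dots> = (\<integral>\<^sup>+z. \<integral>\<^sup>+a. \<integral>\<^sup>+b. ennreal (?h a) *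
          (\<psi> (matrix_inv (matp a) *v (m z - b), congruence (matrix_inv (matp a)) (S z)) * \<phi> (m z, S z)) \<partial>lborel \<partial>lborel \<partial>N)"
    using swap[of "\<lambda>(a, b, z). ennreal (?h a) *
          (\<psi> (matrix_inv (matp a) *v (m z - b), congruence (matrix_inv (matp a)) (S z)) * \<phi> (m z, S z))"] by simp
  also have "\<dots> = (\<integral>\<^sup>+z. ?l * \<phi> (m z, S z) \<partial>N)"
  proof (intro nn_integral_cong_AE eventually_mono[OF pd])
    fix z assume "pos_def (S z)"
    then obtain B where B: "det B \<noteq> 0" "S z = congruence B (mat 1)" by (rule pos_def_factor)
    let ?f = "\<lambda>A. ennreal (\<bar>det A\<bar> powr - ?p) * (\<integral>\<^sup>+b. \<psi> (b, congruence (matrix_inv A) (S z)) \<partial>lborel)"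
    have "(\<integral>\<^sup>+b. ennreal (?h a) *
          (\<psi> (matrix_inv (matp a) *v (m z - b), congruence (matrix_inv (matp a)) (S z)) * \<phi> (m z, S z)) \<partial>lborel)
        = \<phi> (m z, S z) * ?f (matp a)" for a
    proof (cases "det (matp a) = 0")
      case False
      have 1: "(\<integral>\<^sup>+b. \<psi> (matrix_inv (matp a) *v (m z - b), congruence (matrix_inv (matp a)) (S z)) \<partial>lborel)
         = ennreal \<bar>det (matp a)\<bar> * (\<integral>\<^sup>+b. \<psi> (b, congruence (matrix_inv (matp a)) (S z)) \<partial>lborel)"
        by (rule nn_integral_lborel_affine_inv[OF _ False, where f = "\<lambda>b. \<psi> (b, _)"]) simp
      have "?h a * \<bar>det (matp a)\<bar> = \<bar>det (matp a)\<bar> powr - ?p"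
        using powr_mult_power[of "\<bar>det (matp a)\<bar>" "- ?p" "?q - n" 1] False by simp
      then have 2: "ennreal (?h a) * (ennreal \<bar>det (matp a)\<bar> * x) = ennreal (\<bar>det (matp a)\<bar> powr - ?p) * x" for x
        by (rule ennreal_mult_eq) simp_all
      have "(\<integral>\<^sup>+b. ennreal (?h a) *
          (\<psi> (matrix_inv (matp a) *v (m z - b), congruence (matrix_inv (matp a)) (S z)) * \<phi> (m z, S z)) \<partial>lborel)
        = \<phi> (m z, S z) * (ennreal (?h a) * (\<integral>\<^sup>+b. \<psi> (matrix_inv (matp a) *v (m z - b), congruence (matrix_inv (matp a)) (S z)) \<partial>lborel))"
        by (simp add: nn_integral_cmult nn_integral_multc mult_ac)
      then show ?thesis by (simp only: 1 2)
    qed simp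
    then have "(\<integral>\<^sup>+a. \<integral>\<^sup>+b. ennreal (?h a) *
          (\<psi> (matrix_inv (matp a) *v (m z - b), congruence (matrix_inv (matp a)) (S z)) * \<phi> (m z, S z)) \<partial>lborel \<partial>lborel)
        = \<phi> (m z, S z) * (\<integral>\<^sup>+a. ?f (matp a) \<partial>lborel)"
      by (simp add: nn_integral_cmult)
    \<comment> \<open>Haar measure is left invariant, and replacing \<open>matp a\<close> by
      \<open>B ** matp a\<close> cancels the factor \<open>B\<close> of \<open>S z\<close>, so the
      integral no longer depends on \<open>z\<close>.\<close>
    also have "(\<integral>\<^sup>+a. ?f (matp a) \<partial>lborel) = ennreal (\<bar>det B\<bar> ^ CARD('p)) * (\<integral>\<^sup>+a. ?f (B ** matp a) \<partial>lborel)"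
      by (rule nn_integral_matrix_left_mult[symmetric, OF _ B(1)]) simp
    also have "\<dots> = (\<integral>\<^sup>+a. ennreal (\<bar>det B\<bar> ^ CARD('p)) * ?f (B ** matp a) \<partial>lborel)"
      by (rule nn_integral_cmult[symmetric]) simp
    also have "\<dots> = ?l"
    proof (rule nn_integral_cong)
      fix a :: "real^('p \<times> 'p)"
      show "ennreal (\<bar>det B\<bar> ^ CARD('p)) * ?f (B ** matp a) = ennreal (\<bar>det (matp a)\<bar> powr - ?p) *
          (\<integral>\<^sup>+b. \<psi> (b, congruence (matrix_inv (matp a)) (mat 1)) \<partial>lborel)"
      proof (cases "det (matp a) = 0")
        case False
        have "congruence (matrix_inv (B ** matp a)) (S z) = congruence (matrix_inv (matp a)) (mat 1)"
          using B(1) by (simp add: B(2) matrix_inv_mult False congruence_mult)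
            (simp add: matrix_inv_right flip: congruence_mult)
        moreover have "\<bar>det B\<bar> ^ CARD('p) * \<bar>det (B ** matp a)\<bar> powr - ?p = \<bar>det (matp a)\<bar> powr - ?p"
          using B(1) by (simp add: det_mul abs_mult powr_mult powr_minus powr_realpow)
        ultimately show ?thesis by (simp flip: ennreal_mult mult.assoc)
      qed (simp add: det_mul)
    qed
    finally show "(\<integral>\<^sup>+a. \<integral>\<^sup>+b. ennreal (?h a) *
          (\<psi> (matrix_inv (matp a) *v (m z - b), congruence (matrix_inv (matp a)) (S z)) * \<phi> (m z, S z)) \<partial>lborel \<partial>lborel)
        = ?l * \<phi> (m z, S z)" by (simp add: mult.commute)
  qed
  also have "\<dots> = ?l * (\<integral>\<^sup>+z. \<phi> (m z, S z) \<partial>N)"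
    by (rule nn_integral_cmult) simp
  finally show ?thesis using X1 by simp
qed

section \<open>Sample moments\<close>

declare One_nat_def [simp del]

lemma mat_mult_vector: "mat k *v (x :: real^'n) = k *\<^sub>R x"
proof -
  have "(mat k :: real^'n^'n) $ i $ j * x $ j = (if j = i then k * x $ i else 0)" for i j
    by (simp add: mat_def)
  then show ?thesis by (simp add: matrix_vector_mult_def vec_eq_iff)
qed

definition outer :: "real^'n \<Rightarrow> real^'n^'n" where
  "outer x = (\<chi> i j. x $ i * x $ j)"

definition smean :: "nat \<Rightarrow> (nat \<Rightarrow> real^'n) \<Rightarrow> real^'n" where
  "smean n y = (1 / real n) *\<^sub>R (\<Sum>i=1..n. y i)"

definition smom :: "nat \<Rightarrow> (nat \<Rightarrow> real^'n) \<Rightarrow> real^'n^'n" where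
  "smom n y = (1 / real n) *\<^sub>R (\<Sum>i=1..n. outer (y i))"

definition scov :: "nat \<Rightarrow> (nat \<Rightarrow> real^'n) \<Rightarrow> real^'n^'n" where
  "scov n y = (1 / real n) *\<^sub>R (\<Sum>i=1..n. outer (y i - smean n y))"

lemma outer_nth [simp]: "outer x $ i $ j = x $ i * x $ j"
  by (simp add: outer_def)

lemma transpose_outer [simp]: "transpose (outer x) = outer x"
  by (simp add: transpose_def vec_eq_iff mult.commute)

lemma outer_mult_vector: "outer x *v v = (x \<bullet> v) *\<^sub>R x"
  by (simp add: vec_eq_iff matrix_vector_mult_def inner_vec_def sum_distrib_left mult_ac)

lemma congruence_outer: "congruence A (outer x) = outer (A *v x)"
  by (simp add: vec_eq_iff congruence_nth matrix_vector_mult_def sum_product mult_ac)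

lemma continuous_on_outer [continuous_intros]:
  "continuous_on X f \<Longrightarrow> continuous_on X (\<lambda>x. outer (f x))"
  unfolding outer_def by (intro continuous_intros)

lemma measurable_outer [measurable]: "outer \<in> borel_measurable borel"
  by (intro borel_measurable_continuous_onI continuous_on_outer continuous_intros)

lemma transpose_scaleR_matrix: "transpose (c *\<^sub>R A) = c *\<^sub>R transpose (A :: real^'n^'m)"
  by (simp add: transpose_def vec_eq_iff)

lemma transpose_sum: "transpose (\<Sum>i\<in>I. A i) = (\<Sum>i\<in>I. transpose (A i :: real^'n^'m))"
  by (simp add: transpose_def vec_eq_iff)

lemma transpose_scov [simp]: "transpose (scov n y) = scov n y"
  by (simp add: scov_def transpose_scaleR_matrix transpose_sum)

lemma transpose_smom [simp]: "transpose (smom n y) = smom n y"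
  by (simp add: smom_def transpose_scaleR_matrix transpose_sum)

lemma scov_eq_smom:
  assumes "n > 0"
  shows "scov n y = smom n y - outer (smean n y)"
proof -
  have "(\<Sum>i=1..n. (y i - smean n y) $ a * (y i - smean n y) $ b)
      = (\<Sum>i=1..n. y i $ a * y i $ b) - real n * (smean n y $ a * smean n y $ b)" for a b
  proof -
    have s: "(\<Sum>i=1..n. y i $ c) = real n * smean n y $ c" for c
      using assms by (simp add: smean_def)
    have "(\<Sum>i=1..n. (y i - smean n y) $ a * (y i - smean n y) $ b)
       = (\<Sum>i=1..n. y i $ a * y i $ b) - (\<Sum>i=1..n. y i $ a) * smean n y $ b
         - smean n y $ a * (\<Sum>i=1..n. y i $ b) + real n * (smean n y $ a * smean n y $ b)"
      by (simp add: algebra_simps sum.distrib sum_subtractf sum_distrib_left)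
    then show ?thesis unfolding s by simp
  qed
  then show ?thesis
    using assms by (simp add: scov_def smom_def vec_eq_iff field_simps)
qed

lemma smean_affine:
  assumes "n > 0"
  shows "smean n (\<lambda>i. A *v y i + b i) = A *v smean n y + smean n b"
  using assms
  by (simp add: smean_def sum.distrib matrix_vector_mult_scaleR scaleR_add_right linear_sum[OF matrix_vector_mul_linear])

lemma scov_affine:
  assumes "n > 0"
  shows "scov n (\<lambda>i. A *v y i + b) = congruence A (scov n y)"
proof -
  have "smean n (\<lambda>i. A *v y i + b) = A *v smean n y + b"
    using assms by (subst smean_affine) (simp_all add: smean_def sum_constant_scaleR del: sum_constant)
  then have "scov n (\<lambda>i. A *v y i + b) = (1 / real n) *\<^sub>R (\<Sum>i=1..n. congruence A (outer (y i - smean n y)))"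
    by (simp add: scov_def congruence_outer matrix_vector_mult_diff_distrib)
  then show ?thesis
    by (simp add: scov_def linear_cmul[OF linear_congruence] linear_sum[OF linear_congruence])
qed

lemma smean_restrict [simp]: "smean n (restrict y {1..n}) = smean n y"
  by (simp add: smean_def)

lemma smom_restrict [simp]: "smom n (restrict y {1..n}) = smom n y"
  by (simp add: smom_def)

lemma scov_restrict [simp]: "scov n (restrict y {1..n}) = scov n y"
proof -
  have "(\<Sum>i=1..n. outer (restrict y {1..n} i - smean n y)) = (\<Sum>i=1..n. outer (y i - smean n y))"
    by (rule sum.cong) simp_all
  then show ?thesis unfolding scov_def smean_restrict by (simp only:)
qed

lemma inner_scov: "x \<bullet> (scov n y *v x) = (1 / real n) * (\<Sum>i=1..n. ((y i - smean n y) \<bullet> x)\<^sup>2)"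
proof -
  have "scov n y *v x = (1 / real n) *\<^sub>R (\<Sum>i=1..n. outer (y i - smean n y) *v x)"
    by (simp add: scov_def scaleR_matrix_vector_assoc[symmetric] matrix_vector_mult_def vec_eq_iff sum_distrib_right sum_distrib_left)
      (auto intro: sum.swap)
  then show ?thesis
    by (simp add: outer_mult_vector inner_sum_right inner_commute power2_eq_square)
qed

text \<open>The quadratic form is a sum of squares. A direction where it vanishes is orthogonal to
  every centred observation and therefore lies in the kernel, so the determinant alone detects
  degeneracy.\<close>

lemma pos_def_scov_iff:
  assumes "n > 0"
  shows "pos_def (scov n y) \<longleftrightarrow> det (scov n y) \<noteq> 0"
proof
  assume nz: "det (scov n y) \<noteq> 0"
  have "x \<bullet> (scov n y *v x) > 0" if "x \<noteq> 0" for x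
  proof (rule ccontr)
    assume "\<not> x \<bullet> (scov n y *v x) > 0"
    moreover have "(\<Sum>i=1..n. ((y i - smean n y) \<bullet> x)\<^sup>2) \<ge> 0" by (intro sum_nonneg) auto
    ultimately have "(\<Sum>i=1..n. ((y i - smean n y) \<bullet> x)\<^sup>2) = 0"
      using assms by (simp add: inner_scov zero_less_divide_iff)
    then have "\<forall>i\<in>{1..n}. (y i - smean n y) \<bullet> x = 0"
      by (subst (asm) sum_nonneg_eq_0_iff) auto
    moreover have "scov n y *v x = (1 / real n) *\<^sub>R (\<Sum>i=1..n. outer (y i - smean n y) *v x)"
      by (simp add: scov_def scaleR_matrix_vector_assoc[symmetric] matrix_vector_mult_def vec_eq_iff sum_distrib_right sum_distrib_left)
        (auto intro: sum.swap)
    ultimately have "scov n y *v x = 0" by (simp add: outer_mult_vector)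
    then have "matrix_inv (scov n y) *v (scov n y *v x) = 0" by simp
    then show False using \<open>x \<noteq> 0\<close> by (simp add: matrix_vector_mul_assoc matrix_inv_right[OF nz])
  qed
  then show "pos_def (scov n y)" by (simp add: pos_def_def)
qed (use pos_def_det_pos in force)

lemma measurable_smean [measurable]: "smean n \<in> borel_measurable (\<Pi>\<^sub>M i\<in>{1..n}. lborel)"
  unfolding smean_def by measurable

lemma measurable_smom [measurable]: "smom n \<in> borel_measurable (\<Pi>\<^sub>M i\<in>{1..n}. lborel)"
  unfolding smom_def by measurable

lemma measurable_scov [measurable]: "scov n \<in> borel_measurable (\<Pi>\<^sub>M i\<in>{1..n}. lborel)"
  unfolding scov_def by measurable

text \<open>Each observation contributes one factor |det A|, which is checked on product sets. The
  shifts may differ between observations because the sample is later moved by a whole configuration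
  of vectors.\<close>

lemma nn_integral_PiM_affine:
  fixes f :: "('i \<Rightarrow> real^'n) \<Rightarrow> ennreal"
  assumes [measurable]: "f \<in> borel_measurable (\<Pi>\<^sub>M i\<in>I. lborel)" and "finite I" and A: "det A \<noteq> 0"
  shows "ennreal (\<bar>det A\<bar> ^ card I) * (\<integral>\<^sup>+y. f (\<lambda>i\<in>I. A *v y i + b i) \<partial>(\<Pi>\<^sub>M i\<in>I. lborel)) = (\<integral>\<^sup>+y. f y \<partial>(\<Pi>\<^sub>M i\<in>I. lborel))"
proof -
  interpret product_sigma_finite "\<lambda>_::'i. lborel :: (real^'n) measure" ..
  let ?P = "\<Pi>\<^sub>M i\<in>I. (lborel :: (real^'n) measure)" and ?g = "\<lambda>y. \<lambda>i\<in>I. A *v y i + b i"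
  have [measurable]: "?g \<in> ?P \<rightarrow>\<^sub>M ?P" by measurable
  have "density (distr ?P ?P ?g) (\<lambda>_. ennreal (\<bar>det A\<bar> ^ card I)) = ?P"
  proof (rule PiM_eqI)
    fix X :: "'i \<Rightarrow> (real^'n) set" assume X: "\<And>i. i \<in> I \<Longrightarrow> X i \<in> sets lborel"
    have [measurable]: "(\<lambda>x. A *v x + b i) \<in> borel_measurable borel" for i by measurable
    have pre: "(\<lambda>x. A *v x + b i) -` X i \<in> sets lborel" if "i \<in> I" for i
      using measurable_sets[of "\<lambda>x. A *v x + b i" borel borel "X i"] X[OF that] by simp
    have "?g -` (Pi\<^sub>E I X) \<inter> space ?P = Pi\<^sub>E I (\<lambda>i. (\<lambda>x. A *v x + b i) -` X i)"
      by (auto simp: space_PiM PiE_def extensional_def Pi_iff)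
    then have "emeasure (density (distr ?P ?P ?g) (\<lambda>_. ennreal (\<bar>det A\<bar> ^ card I))) (Pi\<^sub>E I X)
        = ennreal (\<bar>det A\<bar> ^ card I) * emeasure ?P (Pi\<^sub>E I (\<lambda>i. (\<lambda>x. A *v x + b i) -` X i))"
      using X \<open>finite I\<close> by (subst emeasure_density_const) (simp_all add: emeasure_distr sets_PiM_I_finite)
    also have "emeasure ?P (Pi\<^sub>E I (\<lambda>i. (\<lambda>x. A *v x + b i) -` X i)) = (\<Prod>i\<in>I. emeasure lborel ((\<lambda>x. A *v x + b i) -` X i))"
      using pre \<open>finite I\<close> by (intro emeasure_PiM) auto
    also have "ennreal (\<bar>det A\<bar> ^ card I) * \<dots> = (\<Prod>i\<in>I. ennreal \<bar>det A\<bar> * emeasure lborel ((\<lambda>x. A *v x + b i) -` X i))"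
      by (simp add: prod.distrib ennreal_power)
    also have "\<dots> = (\<Prod>i\<in>I. emeasure lborel (X i))"
    proof (rule prod.cong)
      fix i assume "i \<in> I"
      then have [measurable]: "X i \<in> sets borel" using X by simp
      have "indicator (X i) (A *v x + b i) = (indicator ((\<lambda>x. A *v x + b i) -` X i) x :: ennreal)" for x
        by (simp add: indicator_def)
      then show "ennreal \<bar>det A\<bar> * emeasure lborel ((\<lambda>x. A *v x + b i) -` X i) = emeasure lborel (X i)"
        using nn_integral_lborel_affine[of "indicator (X i)" A "b i"] A pre[OF \<open>i \<in> I\<close>] by simp
    qed simp
    finally show "emeasure (density (distr ?P ?P ?g) (\<lambda>_. ennreal (\<bar>det A\<bar> ^ card I))) (Pi\<^sub>E I X) = (\<Prod>i\<in>I. emeasure lborel (X i))" .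
  qed (use \<open>finite I\<close> in simp_all)
  then have "(\<integral>\<^sup>+y. f y \<partial>?P) = (\<integral>\<^sup>+y. f y \<partial>density (distr ?P ?P ?g) (\<lambda>_. ennreal (\<bar>det A\<bar> ^ card I)))"
    by (simp only:)
  also have "\<dots> = ennreal (\<bar>det A\<bar> ^ card I) * (\<integral>\<^sup>+y. f (?g y) \<partial>?P)"
    by (simp add: nn_integral_density nn_integral_distr nn_integral_cmult)
  finally show ?thesis ..
qed

lemma det_of_polynomial_matrix:
  fixes M :: "real poly^'n^'n"
  shows "poly (det M) k = det (\<chi> i j. poly (M $ i $ j) k)"
  unfolding det_def by (simp add: poly_sum poly_prod poly_of_int)

text \<open>The determinant is a polynomial in k whose value at 0 is the nonzero determinant for
  \<open>e\<close>.\<close>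

lemma finite_singular_scov:
  fixes y e :: "nat \<Rightarrow> real^'n"
  assumes n: "n > 0" and e: "det (scov n e) \<noteq> 0"
  shows "finite {k. det (scov n (\<lambda>i. k *\<^sub>R y i + e i)) = 0}"
proof -
  let ?u = "\<lambda>i. y i - smean n y" and ?v = "\<lambda>i. e i - smean n e"
  define P :: "real poly^'n^'n" where
    "P = (\<chi> a b. smult (1 / real n) (\<Sum>i=1..n. [:?v i $ a, ?u i $ a:] * [:?v i $ b, ?u i $ b:]))"
  have mean: "smean n (\<lambda>i. k *\<^sub>R y i + e i) = k *\<^sub>R smean n y + smean n e" for k
    by (simp add: smean_def sum.distrib scaleR_add_right scaleR_sum_right mult.commute)
  have "scov n (\<lambda>i. k *\<^sub>R y i + e i) = (\<chi> a b. poly (P $ a $ b) k)" for k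
    by (simp add: vec_eq_iff scov_def P_def poly_sum mean) (simp add: algebra_simps)
  then have *: "det (scov n (\<lambda>i. k *\<^sub>R y i + e i)) = poly (det P) k" for k
    by (simp add: det_of_polynomial_matrix)
  have "poly (det P) 0 \<noteq> 0" using *[of 0] e by simp
  then have "det P \<noteq> 0" by auto
  then show ?thesis using poly_roots_finite by (simp add: *)
qed

lemma ex_nonsingular_scov:
  assumes "CARD('n) < n"
  shows "\<exists>e :: nat \<Rightarrow> real^'n. det (scov n e) \<noteq> 0"
proof -
  obtain f :: "nat \<Rightarrow> 'n" where f: "bij_betw f {1..CARD('n)} UNIV"
    using ex_bij_betw_nat_finite_1[of "UNIV :: 'n set"] by auto
  \<comment> \<open>Unit vectors padded with zeros. As n exceeds the dimension, observation n is
    zero; a degenerate direction is therefore orthogonal to the mean, and then to every unit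
    vector.\<close>
  define e :: "nat \<Rightarrow> real^'n" where "e i = (if i \<le> CARD('n) then axis (f i) 1 else 0)" for i
  have "x \<bullet> (scov n e *v x) > 0" if "x \<noteq> 0" for x
  proof (rule ccontr)
    assume "\<not> x \<bullet> (scov n e *v x) > 0"
    moreover have "(\<Sum>i=1..n. ((e i - smean n e) \<bullet> x)\<^sup>2) \<ge> 0" by (intro sum_nonneg) auto
    ultimately have "(\<Sum>i=1..n. ((e i - smean n e) \<bullet> x)\<^sup>2) = 0"
      using assms by (simp add: inner_scov zero_less_divide_iff)
    then have *: "\<forall>i\<in>{1..n}. (e i - smean n e) \<bullet> x = 0"
      by (subst (asm) sum_nonneg_eq_0_iff) auto
    then have "smean n e \<bullet> x = 0" using assms by (auto simp: e_def dest!: bspec[of _ _ n])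
    then have "e i \<bullet> x = 0" if "i \<in> {1..CARD('n)}" for i
      using * that assms by (auto simp: inner_diff_left)
    then have "x $ f i = 0" if "i \<in> {1..CARD('n)}" for i
      using that by (auto simp: e_def inner_axis')
    then have "x $ j = 0" for j using f by (metis UNIV_I bij_betw_iff_bijections)
    then show False using \<open>x \<noteq> 0\<close> by (simp add: vec_eq_iff)
  qed
  then have "pos_def (scov n e)" by (simp add: pos_def_def)
  then show ?thesis by (metis less_irrefl pos_def_det_pos)
qed

text \<open>Translating the sample by \<open>(1 / k) e\<close> preserves Lebesgue measure, and for fixed \<open>y\<close> only
  finitely many \<open>k\<close> make the translated sample degenerate.\<close>

lemma AE_pos_def_scov:
  assumes "CARD('n) < n"
  shows "AE y in (\<Pi>\<^sub>M i\<in>{1..n}. (lborel :: (real^'n) measure)). pos_def (scov n y)"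
proof -
  interpret product_sigma_finite "\<lambda>_::nat. lborel :: (real^'n) measure" ..
  let ?P = "\<Pi>\<^sub>M i\<in>{1..n}. (lborel :: (real^'n) measure)"
  interpret P: sigma_finite_measure ?P by (rule sigma_finite) simp
  interpret PL: pair_sigma_finite ?P "lborel :: real measure" ..
  have n: "n > 0" using assms by simp
  obtain e :: "nat \<Rightarrow> real^'n" where e: "det (scov n e) \<noteq> 0"
    using ex_nonsingular_scov[OF assms] by auto
  let ?F = "\<lambda>y. indicator {0} (det (scov n y)) :: ennreal"
  let ?G = "\<lambda>y k. ?F (\<lambda>i\<in>{1..n}. k *\<^sub>R y i + e i)"
  have shift: "(\<integral>\<^sup>+y. ?F y \<partial>?P) = (\<integral>\<^sup>+y. ?G y k \<partial>?P)" if "k > 0" for k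
  proof -
    have "?F (\<lambda>i\<in>{1..n}. mat 1 *v y i + (1 / k) *\<^sub>R e i) = ?G y k" for y
    proof -
      \<comment> \<open>k y + e is k times the translated sample, and scaling by k > 0 does not
        affect singularity.\<close>
      have "scov n (\<lambda>i. k *\<^sub>R y i + e i) = scov n (\<lambda>i. mat k *v (mat 1 *v y i + (1 / k) *\<^sub>R e i) + 0)"
        using that by (simp add: matrix_vector_right_distrib mat_mult_vector)
      also have "\<dots> = congruence (mat k) (scov n (\<lambda>i. mat 1 *v y i + (1 / k) *\<^sub>R e i))"
        by (rule scov_affine[OF n])
      finally have "scov n (\<lambda>i. k *\<^sub>R y i + e i) = congruence (mat k) (scov n (\<lambda>i. mat 1 *v y i + (1 / k) *\<^sub>R e i))" .
      moreover have "det (mat k :: real^'n^'n) = k ^ CARD('n)"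
        by (metis det_matrix_scaleR matrix_scaleR)
      ultimately show ?thesis using that by (simp add: det_congruence indicator_def)
    qed
    then show ?thesis
      using nn_integral_PiM_affine[of ?F "{1..n}" "mat 1" "\<lambda>i. (1 / k) *\<^sub>R e i"] by simp
  qed
  have null: "(\<integral>\<^sup>+k. ?G y k * indicator {0<..<1} k \<partial>lborel) = 0" for y
  proof -
    have [measurable]: "(\<lambda>k. scov n (\<lambda>i. k *\<^sub>R y i + e i)) \<in> borel_measurable borel"
      unfolding scov_def smean_def by measurable
    have "AE k in lborel. k \<notin> {k. det (scov n (\<lambda>i. k *\<^sub>R y i + e i)) = 0}"
      using finite_singular_scov[OF n e, of y]
      by (intro AE_not_in finite_imp_null_set_lborel)
    then have "AE k in lborel. ?G y k * indicator {0<..<1} k = 0"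
      by eventually_elim (simp add: indicator_def)
    then show ?thesis by (subst nn_integral_0_iff_AE) simp_all
  qed
  \<comment> \<open>The interval (0, 1) has measure one, so averaging over k leaves the integral
    unchanged; after the exchange of integrals the inner one is zero.\<close>
  have "(\<integral>\<^sup>+y. ?F y \<partial>?P) = (\<integral>\<^sup>+k. (\<integral>\<^sup>+y. ?F y \<partial>?P) * indicator {0<..<1} k \<partial>(lborel::real measure))"
    by (simp add: nn_integral_cmult)
  also have "\<dots> = (\<integral>\<^sup>+k. \<integral>\<^sup>+y. ?G y k * indicator {0<..<1} k \<partial>?P \<partial>lborel)"
  proof (rule nn_integral_cong)
    fix k :: real
    show "(\<integral>\<^sup>+y. ?F y \<partial>?P) * indicator {0<..<1} k = (\<integral>\<^sup>+y. ?G y k * indicator {0<..<1} k \<partial>?P)"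
    proof (cases "k \<in> {0<..<1}")
      case True
      then have "k > 0" by simp
      from shift[OF this] True show ?thesis by (simp only: indicator_simps mult_1_right)
    qed simp
  qed
  also have "\<dots> = (\<integral>\<^sup>+y. \<integral>\<^sup>+k. ?G y k * indicator {0<..<1} k \<partial>lborel \<partial>?P)"
    by (rule PL.Fubini') measurable
  also have "\<dots> = 0" by (simp only: null) simp
  finally have "AE y in ?P. ?F y = 0" by (subst (asm) nn_integral_0_iff_AE) simp_all
  then show ?thesis
    by eventually_elim (simp add: pos_def_scov_iff[OF n] indicator_def split: if_splits)
qed

lemma measurable_fst_borel [measurable]:
  "(fst :: 'a::second_countable_topology \<times> 'b::second_countable_topology \<Rightarrow> 'a) \<in> borel_measurable borel"
  by (intro borel_measurable_continuous_onI continuous_intros)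

lemma measurable_snd_borel [measurable]:
  "(snd :: 'a::second_countable_topology \<times> 'b::second_countable_topology \<Rightarrow> 'b) \<in> borel_measurable borel"
  by (intro borel_measurable_continuous_onI continuous_intros)

lemma nn_integral_lborel_prod:
  fixes f :: "'a::euclidean_space \<times> 'b::euclidean_space \<Rightarrow> ennreal"
  assumes [measurable]: "f \<in> borel_measurable borel"
  shows "(\<integral>\<^sup>+x. f x \<partial>lborel) = (\<integral>\<^sup>+a. \<integral>\<^sup>+b. f (a, b) \<partial>lborel \<partial>lborel)"
proof -
  have "f \<in> borel_measurable (lborel \<Otimes>\<^sub>M lborel)"
    by (simp add: lborel_prod)
  then show ?thesis by (simp add: lborel.nn_integral_fst lborel_prod)
qed

lemma emeasure_lborel_open_pos:
  fixes W :: "'a::euclidean_space set"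
  assumes "open W" "x \<in> W"
  shows "emeasure lborel W > 0"
proof -
  obtain r where r: "r > 0" "ball x r \<subseteq> W" using assms open_contains_ball by blast
  have "0 < emeasure lborel (ball x r)"
    using content_ball_pos[OF r(1), of x] by (auto simp: measure_def zero_less_iff_neq_zero)
  also have "\<dots> \<le> emeasure lborel W" using r assms(1) by (intro emeasure_mono) auto
  finally show ?thesis .
qed

lemma nn_integral_lborel_pos:
  fixes f :: "'a::euclidean_space \<Rightarrow> ennreal"
  assumes [measurable]: "f \<in> borel_measurable borel" and W: "open W" "x \<in> W" and pos: "\<And>y. y \<in> W \<Longrightarrow> f y > 0"
  shows "(\<integral>\<^sup>+y. f y \<partial>lborel) > 0"
proof (rule ccontr)
  assume "\<not> (\<integral>\<^sup>+y. f y \<partial>lborel) > 0"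
  then have "AE y in lborel. f y = 0" by (simp add: nn_integral_0_iff_AE)
  then have "AE y in lborel. y \<notin> W" by eventually_elim (use pos in force)
  then have "emeasure lborel W = 0" using W(1) by (subst (asm) AE_iff_measurable[of W]) auto
  then show False using emeasure_lborel_open_pos[OF W] by simp
qed

section \<open>The law of the sample moments under Lebesgue measure\<close>

text \<open>For e = (n - p - 2)/2 this is the Wishart density without its exponential factor and its
  constant. The case distinction excludes indefinite matrices of positive determinant.\<close>

definition wdens :: "real \<Rightarrow> real^('n::finite uprod) \<Rightarrow> real" where
  "wdens e s = (if pos_def (smat s) then det (smat s) powr e else 0)"

lemma wdens_nonneg [simp]: "wdens e s \<ge> 0"
  by (simp add: wdens_def)

lemma measurable_wdens [measurable]: "wdens e \<in> borel_measurable borel"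
  unfolding wdens_def by measurable

lemma pos_def_congruence_iff:
  assumes "det A \<noteq> 0"
  shows "pos_def (congruence A X) \<longleftrightarrow> pos_def X"
proof
  assume "pos_def (congruence A X)"
  then have "pos_def (congruence (matrix_inv A) (congruence A X))"
    by (rule pos_def_congruence) (use assms in \<open>simp add: det_matrix_inv\<close>)
  moreover have "congruence (matrix_inv A) (congruence A X) = X"
    by (simp add: matrix_inv_right[OF assms] flip: congruence_mult)
  ultimately show "pos_def X" by simp
qed (rule pos_def_congruence[OF _ assms])

lemma wdens_scong:
  assumes "det A \<noteq> 0"
  shows "wdens e s = \<bar>det A\<bar> powr (- 2 * e) * wdens e (scong A s)"
proof (cases "pos_def (smat s)")
  case True
  have "det (smat (scong A s)) powr e = \<bar>det A\<bar> powr (2 * e) * det (smat s) powr e"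
    using pos_def_det_pos[OF True] assms
    by (simp add: smat_scong det_congruence powr_mult powr_powr[of _ 2, symmetric])
  moreover have "\<bar>det A\<bar> powr (- 2 * e) * \<bar>det A\<bar> powr (2 * e) = 1"
    using assms by (simp flip: powr_add)
  ultimately show ?thesis
    using True assms by (simp add: wdens_def smat_scong pos_def_congruence_iff mult.assoc[symmetric])
qed (simp add: wdens_def smat_scong pos_def_congruence_iff assms)

text \<open>Powers of |det A|: 1 from the mean, p + 1 from the congruence and 2e from the density.
  With this \<open>e\<close> they add up to n, the scaling of n Lebesgue distributed
  observations.\<close>

lemma wdens_functional_invariant:
  fixes A :: "real^'p^'p" and f :: "(real^'p) \<times> (real^'p^'p) \<Rightarrow> ennreal"
  assumes A: "det A \<noteq> 0" and [measurable]: "f \<in> borel_measurable borel"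
    and e: "e = (real n - CARD('p) - 2) / 2"
  shows "ennreal (\<bar>det A\<bar> ^ n) *
      (\<integral>\<^sup>+x. ennreal (wdens e (snd x)) * f (A *v fst x + b, congruence A (smat (snd x))) \<partial>lborel)
    = (\<integral>\<^sup>+x. ennreal (wdens e (snd x)) * f (fst x, smat (snd x)) \<partial>lborel)"
proof -
  let ?p = "CARD('p)"
  have inner: "ennreal (\<bar>det A\<bar> powr (2 * e) * \<bar>det A\<bar> ^ (?p + 1)) *
      (\<integral>\<^sup>+s. ennreal (wdens e s) * f (v, congruence A (smat s)) \<partial>lborel)
    = (\<integral>\<^sup>+s. ennreal (wdens e s) * f (v, smat s) \<partial>lborel)" for v
  proof -
    have "(\<integral>\<^sup>+s. ennreal (wdens e s) * f (v, congruence A (smat s)) \<partial>lborel)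
      = (\<integral>\<^sup>+s. ennreal (\<bar>det A\<bar> powr (- 2 * e)) * (ennreal (wdens e (scong A s)) * f (v, smat (scong A s))) \<partial>lborel)"
      by (subst wdens_scong[OF A]) (simp add: ennreal_mult smat_scong mult.assoc)
    also have "\<dots> = ennreal (\<bar>det A\<bar> powr (- 2 * e)) * (\<integral>\<^sup>+s. ennreal (wdens e (scong A s)) * f (v, smat (scong A s)) \<partial>lborel)"
    proof -
      have [measurable]: "scong A \<in> borel_measurable borel"
        unfolding scong_def by measurable
      show ?thesis by (rule nn_integral_cmult) measurable
    qed
    finally have 1: "(\<integral>\<^sup>+s. ennreal (wdens e s) * f (v, congruence A (smat s)) \<partial>lborel) = \<dots>" .
    have 2: "ennreal (\<bar>det A\<bar> ^ (?p + 1)) * (\<integral>\<^sup>+s. ennreal (wdens e (scong A s)) * f (v, smat (scong A s)) \<partial>lborel)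
      = (\<integral>\<^sup>+s. ennreal (wdens e s) * f (v, smat s) \<partial>lborel)"
    proof -
      have "det (matrix (scong A)) \<noteq> 0" using abs_det_scong[of A] A by auto
      then show ?thesis
        using nn_integral_lborel_linear[of "\<lambda>s. ennreal (wdens e s) * f (v, smat s)" "scong A", OF _ linear_scong]
        by (simp add: abs_det_scong)
    qed
    have "\<bar>det A\<bar> powr (2 * e) * \<bar>det A\<bar> ^ (?p + 1) * \<bar>det A\<bar> powr (- 2 * e) = \<bar>det A\<bar> ^ (?p + 1)"
      using A by (simp add: powr_minus)
    then show ?thesis
      unfolding 1 by (subst ennreal_mult_eq) (use 2 in simp_all)
  qed
  have [measurable]: "(\<lambda>v. \<integral>\<^sup>+s. ennreal (wdens e s) * f (v, smat s) \<partial>lborel) \<in> borel_measurable borel"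
    by measurable
  have exps: "\<bar>det A\<bar> ^ n = \<bar>det A\<bar> * (\<bar>det A\<bar> powr (2 * e) * \<bar>det A\<bar> ^ (?p + 1))"
  proof -
    have "\<bar>det A\<bar> powr (2 * e) * \<bar>det A\<bar> ^ (?p + 2) = \<bar>det A\<bar> powr n"
      by (rule powr_mult_power) (use A e in simp_all)
    then show ?thesis using A by (simp add: powr_realpow mult_ac power2_eq_square power_add)
  qed
  have "ennreal (\<bar>det A\<bar> ^ n) *
      (\<integral>\<^sup>+x. ennreal (wdens e (snd x)) * f (A *v fst x + b, congruence A (smat (snd x))) \<partial>lborel)
    = ennreal \<bar>det A\<bar> * (ennreal (\<bar>det A\<bar> powr (2 * e) * \<bar>det A\<bar> ^ (?p + 1)) *
      (\<integral>\<^sup>+v. \<integral>\<^sup>+s. ennreal (wdens e s) * f (A *v v + b, congruence A (smat s)) \<partial>lborel \<partial>lborel))"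
    unfolding exps by (subst nn_integral_lborel_prod) (simp_all add: ennreal_mult mult.assoc)
  also have "\<dots> = ennreal \<bar>det A\<bar> * (\<integral>\<^sup>+v. ennreal (\<bar>det A\<bar> powr (2 * e) * \<bar>det A\<bar> ^ (?p + 1)) *
      (\<integral>\<^sup>+s. ennreal (wdens e s) * f (A *v v + b, congruence A (smat s)) \<partial>lborel) \<partial>lborel)"
    by (subst nn_integral_cmult) simp_all
  also have "\<dots> = ennreal \<bar>det A\<bar> * (\<integral>\<^sup>+v. (\<integral>\<^sup>+s. ennreal (wdens e s) * f (A *v v + b, smat s) \<partial>lborel) \<partial>lborel)"
    by (simp only: inner)
  also have "\<dots> = (\<integral>\<^sup>+v. (\<integral>\<^sup>+s. ennreal (wdens e s) * f (v, smat s) \<partial>lborel) \<partial>lborel)"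
    by (rule nn_integral_lborel_affine[OF _ A]) simp
  also have "\<dots> = (\<integral>\<^sup>+x. ennreal (wdens e (snd x)) * f (fst x, smat (snd x)) \<partial>lborel)"
    by (subst nn_integral_lborel_prod) simp_all
  finally show ?thesis .
qed

lemma compact_continuous_bound:
  fixes f :: "'a::topological_space \<Rightarrow> real"
  assumes "compact Q" "continuous_on Q f"
  obtains M where "M > 0" "\<And>x. x \<in> Q \<Longrightarrow> f x \<le> M"
proof -
  have "bounded (f ` Q)" using assms by (intro compact_imp_bounded compact_continuous_image)
  then obtain M where "M > 0" "\<forall>x\<in>f ` Q. norm x \<le> M" by (auto simp: bounded_pos)
  then show ?thesis using that[of M] by fastforce
qed

text \<open>Both sides define functionals, \<open>I\<close> and \<open>J\<close> below, with the
  same relative invariance. For a common test function \<psi>,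
  \<open>relatively_invariant_measure\<close> ties each of them to the same \<open>l\<close> and
  \<open>k\<close>, and eliminating these leaves proportionality. For the elimination \<psi> must
  make \<open>l\<close> and the weighted \<open>J\<close> positive and finite; it is the indicator
  of a product of balls around mean 0 and covariance the identity.\<close>

theorem sample_mean_cov_law:
  assumes n: "CARD('p::finite) < n" and e: "e = (real n - CARD('p) - 2) / 2"
  shows "\<exists>C. \<forall>f :: (real^'p) \<times> (real^'p^'p) \<Rightarrow> ennreal. f \<in> borel_measurable borel \<longrightarrow>
    (\<integral>\<^sup>+y. f (smean n y, scov n y) \<partial>(\<Pi>\<^sub>M i\<in>{1..n}. lborel))
    = C * (\<integral>\<^sup>+x. ennreal (wdens e (snd x)) * f (fst x, smat (snd x)) \<partial>lborel)"
proof -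
  interpret product_sigma_finite "\<lambda>_::nat. lborel :: (real^'p) measure" ..
  let ?P = "\<Pi>\<^sub>M i\<in>{1..n}. (lborel :: (real^'p) measure)"
  let ?p = "real CARD('p)"
  let ?s1 = "svec (mat 1 :: real^'p^'p)"
  have n0: "n > 0" using n by simp
  have sym1: "transpose (congruence A (mat 1)) = congruence A (mat 1 :: real^'p^'p)" for A
    by (simp add: transpose_congruence transpose_mat)
  have "?s1 \<in> {s. pos_def (smat s)}" using pos_def_one by (simp add: smat_svec transpose_mat)
  \<comment> \<open>A closed ball inside the cone is compact, so continuous functions are bounded on
    it: \<open>D\<close>, \<open>T\<close> and \<open>R\<close> bound the determinant, the trace of
    the inverse, and the density times the weight.\<close>
  then obtain \<epsilon> where \<epsilon>: "\<epsilon> > 0" "cball ?s1 \<epsilon> \<subseteq> {s. pos_def (smat s)}"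
    using open_pos_def_smat open_contains_cball by blast
  let ?Q = "cball ?s1 \<epsilon>"
  have pdQ: "pos_def (smat s)" if "s \<in> ?Q" for s using that \<epsilon> by auto
  then have detQ: "det (smat s) > 0" if "s \<in> ?Q" for s using that pos_def_det_pos by blast
  then have nzQ: "det (smat s) \<noteq> 0" if "s \<in> ?Q" for s using that by force
  have contQ: "continuous_on ?Q (\<lambda>s. det (smat s))" by (intro continuous_intros)
  obtain D where D: "D > 0" "\<And>s. s \<in> ?Q \<Longrightarrow> det (smat s) \<le> D"
    using compact_continuous_bound[OF compact_cball contQ] by metis
  have "continuous_on ?Q (\<lambda>s. trace (matrix_inv (smat s)))"
    unfolding trace_def by (intro continuous_intros nzQ)
  then obtain T where T: "T > 0" "\<And>s. s \<in> ?Q \<Longrightarrow> trace (matrix_inv (smat s)) \<le> T"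
    using compact_continuous_bound[OF compact_cball] by metis
  let ?r = "e - (real n - 1) / 2"
  have "continuous_on ?Q (\<lambda>s. det (smat s) powr ?r)"
    by (intro continuous_intros ballI) (rule nzQ)
  then obtain R where R: "R > 0" "\<And>s. s \<in> ?Q \<Longrightarrow> det (smat s) powr ?r \<le> R"
    using compact_continuous_bound[OF compact_cball] by metis
  define \<psi> :: "(real^'p) \<times> (real^'p^'p) \<Rightarrow> ennreal" where
    "\<psi> q = indicator (ball 0 1) (fst q) * indicator (ball ?s1 \<epsilon>) (svec (snd q))" for q
  have [measurable]: "ball (0 :: real^'p) 1 \<in> sets borel" "ball ?s1 \<epsilon> \<in> sets borel"
    by simp_all
  have [measurable]: "\<psi> \<in> borel_measurable borel" unfolding \<psi>_def by measurable
  define l where "l = (\<integral>\<^sup>+a. ennreal (\<bar>det (matp a)\<bar> powr - ?p) *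
        (\<integral>\<^sup>+b. \<psi> (b, congruence (matrix_inv (matp a)) (mat 1)) \<partial>lborel) \<partial>lborel)"
  define k where "k \<phi> = (\<integral>\<^sup>+a. ennreal (\<bar>det (matp a)\<bar> powr (real n - 1 - ?p)) *
        (\<integral>\<^sup>+b. \<phi> (b, congruence (matp a) (mat 1)) \<partial>lborel) \<partial>lborel)" for \<phi> :: "(real^'p) \<times> (real^'p^'p) \<Rightarrow> ennreal"
  let ?V = "emeasure lborel (ball (0 :: real^'p) 1)"
  have V: "0 < ?V" by (rule emeasure_lborel_open_pos[of _ 0]) auto
  have V': "?V < \<infinity>" by (rule emeasure_lborel_ball_finite)
  let ?h = "\<lambda>a. ennreal (\<bar>det (matp a)\<bar> powr - ?p) * indicator (ball ?s1 \<epsilon>) (svec (congruence (matrix_inv (matp a)) (mat 1)))"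
  have l: "l = ?V * (\<integral>\<^sup>+a. ?h a \<partial>lborel)"
    unfolding l_def \<psi>_def by (simp add: nn_integral_multc mult_ac flip: nn_integral_cmult)

  \<comment> \<open>If the inverse of A^T A lies in the ball, then |a|^2 = trace (A^T A) is at most
    \<open>T\<close> and |det A| is bounded away from 0, so the integrand is bounded with bounded
    support.\<close>
  have "(\<integral>\<^sup>+a. ?h a \<partial>lborel) \<le> (\<integral>\<^sup>+a. ennreal (D powr (?p / 2)) * indicator (cball 0 (sqrt T)) a \<partial>(lborel :: (real^('p \<times> 'p)) measure))"
  proof (rule nn_integral_mono)
    fix a :: "real^('p \<times> 'p)"
    let ?A = "matp a" and ?s = "svec (congruence (matrix_inv (matp a)) (mat 1))"
    show "?h a \<le> ennreal (D powr (?p / 2)) * indicator (cball 0 (sqrt T)) a"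
    proof (cases "det ?A \<noteq> 0 \<and> ?s \<in> ball ?s1 \<epsilon>")
      case True
      then have s: "?s \<in> ?Q" and dA: "det ?A \<noteq> 0" by auto
      have sm: "smat ?s = congruence (matrix_inv ?A) (mat 1)" by (simp add: smat_svec sym1)
      have "\<bar>det ?A\<bar> powr - ?p = (\<bar>det ?A\<bar> powr (- 2)) powr (?p / 2)" by (simp add: powr_powr)
      also have "\<bar>det ?A\<bar> powr (- 2) = det (smat ?s)"
        using dA by (simp add: sm det_congruence det_matrix_inv powr_minus power_inverse)
      also have "\<dots> powr (?p / 2) \<le> D powr (?p / 2)"
        using D(2)[OF s] detQ[OF s] by (intro powr_mono2) auto
      finally have 1: "\<bar>det ?A\<bar> powr - ?p \<le> D powr (?p / 2)" .
      have "transpose ?A ** ?A ** (matrix_inv ?A ** transpose (matrix_inv ?A))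
          = transpose ?A ** (?A ** matrix_inv ?A) ** transpose (matrix_inv ?A)"
        by (simp only: matrix_mul_assoc)
      also have "\<dots> = transpose (matrix_inv ?A ** ?A)" by (simp add: matrix_inv_right(1)[OF dA] matrix_transpose_mul)
      finally have "transpose ?A ** ?A ** (matrix_inv ?A ** transpose (matrix_inv ?A)) = mat 1"
        by (simp add: matrix_inv_right[OF dA] transpose_mat)
      then have "matrix_inv (smat ?s) = transpose ?A ** ?A"
        by (intro matrix_inv_unique_left) (simp only: sm, simp only: congruence_def matrix_mul_rid)
      then have "trace (matrix_inv (smat ?s)) = (\<Sum>i\<in>UNIV. \<Sum>j\<in>UNIV. (a $ (j, i))\<^sup>2)"
        by (simp add: trace_def matrix_matrix_mult_def transpose_def power2_eq_square)
      also have "\<dots> = (\<Sum>u\<in>UNIV. (a $ u)\<^sup>2)"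
        by (subst sum.swap) (simp add: sum.cartesian_product)
      also have "\<dots> = (norm a)\<^sup>2"
        by (simp add: norm_eq_sqrt_inner inner_vec_def sum_nonneg power2_eq_square)
      finally have "(norm a)\<^sup>2 \<le> T" using T(2)[OF s] by simp
      then have "a \<in> cball 0 (sqrt T)" by (simp add: real_le_rsqrt)
      then show ?thesis using 1 True by (simp add: ennreal_leI)
    qed auto
  qed
  also have "\<dots> < \<infinity>"
    by (subst nn_integral_cmult_indicator) (use emeasure_lborel_cball_finite[of "0 :: real^('p \<times> 'p)" "sqrt T"] in \<open>simp_all add: ennreal_mult_less_top\<close>)
  finally have h_fin: "(\<integral>\<^sup>+a. ?h a \<partial>lborel) < \<infinity>" .
  have h_pos: "(\<integral>\<^sup>+a. ?h a \<partial>lborel) > 0"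
  proof (rule nn_integral_lborel_pos)
    let ?U = "{a :: real^('p \<times> 'p). det (matp a) \<noteq> 0}"
    let ?g = "\<lambda>a :: real^('p \<times> 'p). svec (congruence (matrix_inv (matp a)) (mat 1))"
    show "open (?U \<inter> ?g -` ball ?s1 \<epsilon>)"
      by (intro continuous_open_preimage continuous_intros open_Collect_neq open_ball) auto
    have "matrix_inv (mat 1) = (mat 1 :: real^'p^'p)" by (rule matrix_inv_unique_left) simp
    then show "vecp (mat 1) \<in> ?U \<inter> ?g -` ball ?s1 \<epsilon>" using \<epsilon> by simp
  qed (auto simp: ennreal_zero_less_mult_iff)
  have lpos: "l > 0" and lfin: "l < \<infinity>"
    using V V' h_fin h_pos by (simp_all add: l ennreal_zero_less_mult_iff ennreal_mult_less_top)

  define I where "I f = (\<integral>\<^sup>+y. f (smean n y, scov n y) \<partial>?P)" for f :: "(real^'p) \<times> (real^'p^'p) \<Rightarrow> ennreal"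
  define J where "J f = (\<integral>\<^sup>+x. ennreal (wdens e (snd x)) * f (fst x, smat (snd x)) \<partial>lborel)" for f :: "(real^'p) \<times> (real^'p^'p) \<Rightarrow> ennreal"
  let ?\<psi>' = "\<lambda>q. \<psi> q * ennreal (det (snd q) powr (- (real n - 1) / 2))"
  have lI: "l * I \<phi> = k \<phi> * I ?\<psi>'" if [measurable]: "\<phi> \<in> borel_measurable borel" for \<phi>
    unfolding l_def k_def I_def snd_conv
  proof (rule relatively_invariant_measure[where m = "smean n" and S = "scov n"])
    show "sigma_finite_measure ?P" by (rule sigma_finite) simp
    show "AE y in ?P. pos_def (scov n y)" by (rule AE_pos_def_scov[OF n])
    show "ennreal (\<bar>det A\<bar> ^ n) * (\<integral>\<^sup>+y. f (A *v smean n y + b, congruence A (scov n y)) \<partial>?P)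
        = (\<integral>\<^sup>+y. f (smean n y, scov n y) \<partial>?P)"
      if A: "det A \<noteq> 0" and [measurable]: "f \<in> borel_measurable borel" for A b and f :: "(real^'p) \<times> (real^'p^'p) \<Rightarrow> ennreal"
    proof -
      have "smean n (\<lambda>i. A *v y i + b) = A *v smean n y + b" for y
        using n0 by (subst smean_affine) (simp_all add: smean_def sum_constant_scaleR del: sum_constant)
      then show ?thesis
        using nn_integral_PiM_affine[of "\<lambda>y. f (smean n y, scov n y)" "{1..n}" A "\<lambda>_. b"] A
        by (simp add: scov_affine[OF n0])
    qed
  qed simp_all
  have lJ: "l * J \<phi> = k \<phi> * J ?\<psi>'" if [measurable]: "\<phi> \<in> borel_measurable borel" for \<phi>
  proof -
    let ?N = "density (lborel :: ((real^'p) \<times> (real^('p uprod))) measure) (\<lambda>x. ennreal (wdens e (snd x)))"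
    have J: "J f = (\<integral>\<^sup>+x. f (fst x, smat (snd x)) \<partial>?N)" if [measurable]: "f \<in> borel_measurable borel" for f
      unfolding J_def by (subst nn_integral_density) simp_all
    have "l * (\<integral>\<^sup>+x. \<phi> (fst x, smat (snd x)) \<partial>?N) = k \<phi> * (\<integral>\<^sup>+x. \<psi> (fst x, smat (snd x)) * ennreal (det (smat (snd x)) powr (- (real n - 1) / 2)) \<partial>?N)"
      unfolding l_def k_def
    proof (rule relatively_invariant_measure[where m = fst and S = "\<lambda>x. smat (snd x)"])
      show "sigma_finite_measure ?N"
        by (subst sigma_finite_measure.sigma_finite_iff_density_finite'[OF lborel.sigma_finite_measure_axioms]) simp_all
      show "AE x in ?N. pos_def (smat (snd x))"
        by (subst AE_density) (simp_all add: wdens_def)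
      show "ennreal (\<bar>det A\<bar> ^ n) * (\<integral>\<^sup>+x. f (A *v fst x + b, congruence A (smat (snd x))) \<partial>?N)
        = (\<integral>\<^sup>+x. f (fst x, smat (snd x)) \<partial>?N)"
        if A: "det A \<noteq> 0" and [measurable]: "f \<in> borel_measurable borel" for A b and f :: "(real^'p) \<times> (real^'p^'p) \<Rightarrow> ennreal"
        using wdens_functional_invariant[OF A that(2) e, of b]
        by (simp add: nn_integral_density)
    qed simp_all
    then show ?thesis by (simp add: J)
  qed
  have J_le: "J ?\<psi>' \<le> (\<integral>\<^sup>+x. ennreal R * indicator (ball 0 1 \<times> ball ?s1 \<epsilon>) x \<partial>(lborel :: ((real^'p) \<times> (real^('p uprod))) measure))"
    and J_ge: "\<And>x :: (real^'p) \<times> (real^('p uprod)). x \<in> ball 0 1 \<times> ball ?s1 \<epsilon> \<Longrightarrow>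
      ennreal (wdens e (snd x)) * ?\<psi>' (fst x, smat (snd x)) > 0"
  proof -
    have eq: "ennreal (wdens e s) * ?\<psi>' (v, smat s) = ennreal (det (smat s) powr ?r)"
      if "(v, s) \<in> ball 0 1 \<times> ball ?s1 \<epsilon>" for v s
    proof -
      have "s \<in> ?Q" using that by auto
      moreover have "det (smat s) powr e * det (smat s) powr (- (real n - 1) / 2) = det (smat s) powr ?r"
      proof -
        have "e + - (real n - 1) / 2 = ?r" by (simp add: field_simps)
        then show ?thesis by (simp only: powr_add[symmetric])
      qed
      ultimately show ?thesis using that pdQ by (simp add: wdens_def \<psi>_def flip: ennreal_mult)
    qed
    show "ennreal (wdens e (snd x)) * ?\<psi>' (fst x, smat (snd x)) > 0" if "x \<in> ball 0 1 \<times> ball ?s1 \<epsilon>" for x :: "(real^'p) \<times> (real^('p uprod))"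
      using eq[of "fst x" "snd x"] that detQ[of "snd x"] by auto
    show "J ?\<psi>' \<le> (\<integral>\<^sup>+x. ennreal R * indicator (ball 0 1 \<times> ball ?s1 \<epsilon>) x \<partial>(lborel :: ((real^'p) \<times> (real^('p uprod))) measure))"
      unfolding J_def
    proof (rule nn_integral_mono)
      fix x :: "(real^'p) \<times> (real^('p uprod))"
      show "ennreal (wdens e (snd x)) * ?\<psi>' (fst x, smat (snd x)) \<le> ennreal R * indicator (ball 0 1 \<times> ball ?s1 \<epsilon>) x"
      proof (cases "x \<in> ball 0 1 \<times> ball ?s1 \<epsilon>")
        case True
        then show ?thesis using eq[of "fst x" "snd x"] R(2)[of "snd x"] by (auto simp: ennreal_leI)
      next
        case False
        then have "\<psi> (fst x, smat (snd x)) = 0" by (cases x) (auto simp: \<psi>_def)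
        then show ?thesis by simp
      qed
    qed
  qed
  have Jfin: "J ?\<psi>' < \<infinity>"
  proof -
    have "bounded (ball (0 :: real^'p) 1 \<times> ball ?s1 \<epsilon>)" by (intro bounded_Times bounded_ball)
    moreover have "ball (0 :: real^'p) 1 \<times> ball ?s1 \<epsilon> \<in> sets borel" by (intro borel_open open_Times open_ball)
    ultimately have "(\<integral>\<^sup>+x. ennreal R * indicator (ball 0 1 \<times> ball ?s1 \<epsilon>) x \<partial>(lborel :: ((real^'p) \<times> (real^('p uprod))) measure)) < \<infinity>"
      using emeasure_bounded_finite[of "ball (0 :: real^'p) 1 \<times> ball ?s1 \<epsilon>"]
      by (subst nn_integral_cmult_indicator) (simp_all add: ennreal_mult_less_top)
    with J_le show ?thesis by (rule le_less_trans)
  qed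
  have Jpos: "J ?\<psi>' > 0"
    unfolding J_def
  proof (rule nn_integral_lborel_pos[OF _ _ _ J_ge])
    show "open (ball (0 :: real^'p) 1 \<times> ball ?s1 \<epsilon>)" by (intro open_Times open_ball)
    show "(0, ?s1) \<in> ball (0 :: real^'p) 1 \<times> ball ?s1 \<epsilon>" using \<epsilon>(1) by simp
  qed simp_all
  show ?thesis
  proof (intro exI[of _ "I ?\<psi>' / J ?\<psi>'"] allI impI)
    fix f :: "(real^'p) \<times> (real^'p^'p) \<Rightarrow> ennreal"
    assume f: "f \<in> borel_measurable borel"
    \<comment> \<open>The numerator might still be 0 or infinite, so the quotient lives in
      \<open>ennreal\<close>; the denominator is known to be positive and finite.\<close>
    define C where "C = I ?\<psi>' / J ?\<psi>'"
    have C: "C * J ?\<psi>' = I ?\<psi>'"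
    proof -
      have "J ?\<psi>' / J ?\<psi>' = 1" by (rule ennreal_divide_self) (use Jpos Jfin in \<open>simp_all only: less_top infinity_ennreal_def neq_iff simp_thms\<close>)
      then show ?thesis unfolding C_def by (simp only: ennreal_divide_times mult_1_right)
    qed
    have "l * (C * J f) = C * (l * J f)" by (simp only: mult_ac)
    also have "\<dots> = k f * (C * J ?\<psi>')" by (simp only: lJ[OF f] mult_ac)
    also have "\<dots> = l * I f" by (simp only: C lI[OF f])
    finally have "l * (C * J f) = l * I f" .
    moreover have "l \<noteq> 0" "l \<noteq> top" using lpos lfin by (simp_all only: infinity_ennreal_def neq_iff simp_thms)
    ultimately have "C * J f = I f" by (simp only: ennreal_mult_cancel_left simp_thms)
    then have "I f = C * J f" ..
    then show "(\<integral>\<^sup>+y. f (smean n y, scov n y) \<partial>?P)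
      = I ?\<psi>' / J ?\<psi>' * (\<integral>\<^sup>+x. ennreal (wdens e (snd x)) * f (fst x, smat (snd x)) \<partial>lborel)"
      by (simp only: I_def[symmetric] J_def[symmetric] C_def[symmetric])
  qed
qed

text \<open>The density \<open>wdens\<close> carried over to pairs of mean and second moment; the
  latter exceeds the covariance by the outer product of the mean.\<close>

definition mdens :: "real \<Rightarrow> (real^'n) \<times> (real^('n::finite uprod)) \<Rightarrow> real" where
  "mdens e x = wdens e (snd x - svec (outer (fst x)))"

lemma measurable_mdens [measurable]: "mdens e \<in> borel_measurable borel"
  unfolding mdens_def by measurable

text \<open>For a fixed mean the second moment is a translate of the covariance, so changing to
  second moments preserves Lebesgue measure. In these coordinates the null line is straight.\<close>

theorem sample_moment_law:
  assumes n: "CARD('p::finite) < n" and e: "e = (real n - CARD('p) - 2) / 2"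
  shows "\<exists>C. \<forall>f :: (real^'p) \<times> (real^('p uprod)) \<Rightarrow> ennreal. f \<in> borel_measurable borel \<longrightarrow>
    (\<integral>\<^sup>+y. f (smean n y, svec (smom n y)) \<partial>(\<Pi>\<^sub>M i\<in>{1..n}. lborel))
    = C * (\<integral>\<^sup>+x. ennreal (mdens e x) * f x \<partial>lborel)"
proof -
  obtain C where C: "\<And>f :: (real^'p) \<times> (real^'p^'p) \<Rightarrow> ennreal. f \<in> borel_measurable borel \<Longrightarrow>
    (\<integral>\<^sup>+y. f (smean n y, scov n y) \<partial>(\<Pi>\<^sub>M i\<in>{1..n}. lborel))
    = C * (\<integral>\<^sup>+x. ennreal (wdens e (snd x)) * f (fst x, smat (snd x)) \<partial>lborel)"
    using sample_mean_cov_law[OF assms] by blast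
  show ?thesis
  proof (intro exI[of _ C] allI impI)
    fix f :: "(real^'p) \<times> (real^('p uprod)) \<Rightarrow> ennreal"
    assume [measurable]: "f \<in> borel_measurable borel"
    let ?g = "\<lambda>q. f (fst q, svec (snd q) + svec (outer (fst q)))"
    have "svec (scov n y) + svec (outer (smean n y)) = svec (smom n y)" for y :: "nat \<Rightarrow> real^'p"
      using n by (simp add: scov_eq_smom flip: linear_add[OF linear_svec])
    then have "(\<integral>\<^sup>+y. f (smean n y, svec (smom n y)) \<partial>(\<Pi>\<^sub>M i\<in>{1..n}. lborel))
      = (\<integral>\<^sup>+y. ?g (smean n y, scov n y) \<partial>(\<Pi>\<^sub>M i\<in>{1..n}. lborel))" by simp
    also have "\<dots> = C * (\<integral>\<^sup>+x. ennreal (wdens e (snd x)) * ?g (fst x, smat (snd x)) \<partial>lborel)"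
      by (rule C) simp
    also have "(\<integral>\<^sup>+x. ennreal (wdens e (snd x)) * ?g (fst x, smat (snd x)) \<partial>lborel)
      = (\<integral>\<^sup>+v. \<integral>\<^sup>+s. ennreal (wdens e s) * f (v, s + svec (outer v)) \<partial>lborel \<partial>lborel)"
      by (subst nn_integral_lborel_prod) simp_all
    also have "\<dots> = (\<integral>\<^sup>+v. \<integral>\<^sup>+s. ennreal (mdens e (v, s)) * f (v, s) \<partial>lborel \<partial>lborel)"
    proof (rule nn_integral_cong)
      fix v :: "real^'p"
      show "(\<integral>\<^sup>+s. ennreal (wdens e s) * f (v, s + svec (outer v)) \<partial>lborel) = (\<integral>\<^sup>+s. ennreal (mdens e (v, s)) * f (v, s) \<partial>lborel)"
        using nn_integral_lborel_translate[of "\<lambda>s. ennreal (mdens e (v, s)) * f (v, s)" "svec (outer v)"]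
        by (simp add: mdens_def)
    qed
    also have "\<dots> = (\<integral>\<^sup>+x. ennreal (mdens e x) * f x \<partial>lborel)"
      by (subst nn_integral_lborel_prod) simp_all
    finally show "(\<integral>\<^sup>+y. f (smean n y, svec (smom n y)) \<partial>(\<Pi>\<^sub>M i\<in>{1..n}. lborel)) = C * (\<integral>\<^sup>+x. ennreal (mdens e x) * f x \<partial>lborel)" .
  qed
qed

section \<open>Uniformity of the tail along rays\<close>

text \<open>Substitution is applied to the increasing map r |-> -1/r on compact intervals, and a
  reflection undoes the sign. The exhausting intervals are stable under inversion; the offset 2
  keeps them nondegenerate at k = 0.\<close>

lemma nn_integral_inversion:
  fixes H :: "real \<Rightarrow> ennreal"
  assumes [measurable]: "H \<in> borel_measurable borel"
  shows "(\<integral>\<^sup>+r. H (1 / r) * ennreal (1 / r\<^sup>2) * indicator {0<..} r \<partial>lborel) = (\<integral>\<^sup>+s. H s * indicator {0<..} s \<partial>lborel)"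
proof -
  let ?I = "\<lambda>k::nat. {1 / (real k + 2)..real k + 2}"
  have sup: "(SUP k. indicator (?I k) r :: ennreal) = indicator {0<..} r" for r :: real
  proof (cases "r > 0")
    case True
    obtain k :: nat where "max (1 / r) r < real k" using reals_Archimedean2 by blast
    then have k: "1 / r < real k" "r < real k" by auto
    then have "1 < real k * r" using True by (simp add: divide_less_eq)
    then have "1 \<le> r * (real k + 2)" using True by (simp add: distrib_left mult.commute add_increasing2)
    then have "1 / (real k + 2) \<le> r" by (simp add: pos_divide_le_eq)
    then have "r \<in> ?I k" using k(2) by simp
    then have "indicator (?I k) r = (1 :: ennreal)" by simp
    moreover have "indicator (?I k) r \<le> (SUP k. indicator (?I k) r :: ennreal)"
      by (rule SUP_upper) simp
    ultimately have "1 \<le> (SUP k. indicator (?I k) r :: ennreal)" by (simp only:)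
    moreover have "(SUP k. indicator (?I k) r :: ennreal) \<le> 1"
      by (rule SUP_least) (simp add: indicator_def)
    ultimately have "(SUP k. indicator (?I k) r :: ennreal) = 1" by (rule antisym[rotated])
    moreover have "indicator {0<..} r = (1 :: ennreal)" using True by simp
    ultimately show ?thesis by (simp only:)
  next
    case False
    have "r \<notin> ?I k" for k :: nat
    proof
      assume "r \<in> ?I k"
      moreover have "0 < 1 / (real k + 2)" by simp
      ultimately show False using False by (simp del: zero_less_divide_1_iff)
    qed
    then show ?thesis using False by simp
  qed
  have inc: "incseq (\<lambda>k. indicator (?I k) r :: ennreal)" for r :: real
  proof (rule incseq_SucI)
    fix k :: nat
    have "1 / (real (Suc k) + 2) \<le> 1 / (real k + 2)" by (simp add: field_simps)
    then have "?I k \<subseteq> ?I (Suc k)" by auto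
    then show "indicator (?I k) r \<le> (indicator (?I (Suc k)) r :: ennreal)" by (auto split: split_indicator)
  qed
  have lim: "(\<integral>\<^sup>+r. F r * indicator {0<..} r \<partial>lborel) = (SUP k. \<integral>\<^sup>+r. F r * indicator (?I k) r \<partial>lborel)"
    if [measurable]: "F \<in> borel_measurable borel" for F :: "real \<Rightarrow> ennreal"
  proof -
    have "(\<integral>\<^sup>+r. F r * indicator {0<..} r \<partial>lborel) = (\<integral>\<^sup>+r. (SUP k. F r * indicator (?I k) r) \<partial>lborel)"
      by (simp only: sup[symmetric] SUP_mult_left_ennreal)
    also have "\<dots> = (SUP k. \<integral>\<^sup>+r. F r * indicator (?I k) r \<partial>lborel)"
    proof (rule nn_integral_monotone_convergence_SUP)
      show "incseq (\<lambda>k r. F r * indicator (?I k) r)"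
        using inc by (auto simp: incseq_def le_fun_def intro!: mult_left_mono)
    qed simp
    finally show ?thesis .
  qed
  have sub: "(\<integral>\<^sup>+r. H (1 / r) * ennreal (1 / r\<^sup>2) * indicator (?I k) r \<partial>lborel) = (\<integral>\<^sup>+s. H s * indicator (?I k) s \<partial>lborel)" for k
  proof -
    let ?a = "1 / (real k + 2)" and ?b = "real k + 2"
    have a: "0 < ?a" "?a < ?b" by (simp_all add: field_simps add_pos_nonneg)
    have "(\<integral>\<^sup>+x. H (- x) * indicator {- (1 / ?a)..- (1 / ?b)} x \<partial>lborel)
        = (\<integral>\<^sup>+r. H (- (- (1 / r))) * ennreal (1 / r\<^sup>2) * indicator {?a..?b} r \<partial>lborel)"
    proof (rule nn_integral_substitution_aux[where f = "\<lambda>x. H (- x)" and g = "\<lambda>r. - (1 / r)" and g' = "\<lambda>r. 1 / r\<^sup>2"])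
      show "(\<lambda>x. H (- x)) \<in> borel_measurable borel" by measurable
    next
      fix r assume "r \<in> {?a..?b}"
      then have "?a \<le> r" by simp
      with a(1) have "r > 0" by (rule less_le_trans)
      then show "((\<lambda>r. - (1 / r)) has_real_derivative 1 / r\<^sup>2) (at r)"
        by (auto intro!: derivative_eq_intros simp: power2_eq_square)
    next
      show "continuous_on {?a..?b} (\<lambda>r. 1 / r\<^sup>2)"
        using a(1) by (intro continuous_intros) auto
    qed (use a in auto)
    also have "(\<integral>\<^sup>+x. H (- x) * indicator {- (1 / ?a)..- (1 / ?b)} x \<partial>lborel) = (\<integral>\<^sup>+s. H s * indicator (?I k) s \<partial>lborel)"
    proof -
      have "indicator {- (1 / ?a)..- (1 / ?b)} (- s) = (indicator (?I k) s :: ennreal)" for s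
        by (auto simp: indicator_def)
      then show ?thesis
        by (subst nn_integral_real_affine[where c = "-1" and t = 0]) simp_all
    qed
    finally show ?thesis by simp
  qed
  show ?thesis by (simp add: lim sub)
qed

text \<open>The probability integral transform for upper tails. Continuity of the distribution
  function makes the set where it is at least 1 - \<alpha> a closed half-line whose endpoint has
  value exactly 1 - \<alpha>, and the endpoint carries no mass.\<close>

lemma (in real_distribution) upper_tail_uniform:
  assumes cont: "\<And>x. measure M {x} = 0" and \<alpha>: "0 < \<alpha>" "\<alpha> < 1"
  shows "measure M {s. measure M {s<..} \<le> \<alpha>} = \<alpha>"
    and "{s. measure M {s<..} \<le> \<alpha>} \<in> sets borel"
proof -
  have tail: "measure M {s<..} = 1 - cdf M s" for s
  proof -
    have "{s<..} = space M - {..s}" by auto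
    then show ?thesis unfolding cdf_def using prob_compl[of "{..s}"] by simp
  qed
  let ?S = "{s. 1 - \<alpha> \<le> cdf M s}"
  have contcdf: "isCont (cdf M) x" for x using cont isCont_cdf by simp
  then have cc: "continuous_on UNIV (cdf M)" by (simp add: continuous_at_imp_continuous_on)
  have "closed ?S" by (intro closed_Collect_le cc continuous_intros)
  moreover have "?S \<noteq> {}"
  proof -
    have "eventually (\<lambda>x. 1 - \<alpha> < cdf M x) at_top"
      using cdf_lim_at_top_prob \<alpha> by (intro order_tendstoD(1)) auto
    then obtain x where "1 - \<alpha> < cdf M x" using eventually_happens trivial_limit_at_top_linorder by blast
    then have "x \<in> ?S" by simp
    then show ?thesis by blast
  qed
  moreover have bdd: "bdd_below ?S"
  proof -
    have "eventually (\<lambda>x. cdf M x < 1 - \<alpha>) at_bot"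
      using cdf_lim_at_bot \<alpha> by (intro order_tendstoD(2)) auto
    then obtain x where x: "cdf M x < 1 - \<alpha>" using eventually_happens trivial_limit_at_bot_linorder by blast
    have "x \<le> s" if "s \<in> ?S" for s
      using that x cdf_nondecreasing[of s x] by (cases "x \<le> s") auto
    then show ?thesis by (rule bdd_belowI)
  qed
  ultimately have c: "Inf ?S \<in> ?S" by (metis closed_contains_Inf)
  let ?c = "Inf ?S"
  have "cdf M s \<le> 1 - \<alpha>" if "s < ?c" for s
    using that cInf_lower[OF _ bdd, of s] by force
  then have "eventually (\<lambda>s. cdf M s \<le> 1 - \<alpha>) (at_left ?c)"
    by (auto simp: eventually_at_filter)
  moreover have "(cdf M \<longlongrightarrow> cdf M ?c) (at_left ?c)"
    using contcdf[of ?c] by (simp add: isCont_def filterlim_at_split)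
  ultimately have "cdf M ?c \<le> 1 - \<alpha>" by (intro tendsto_upperbound[where F = "at_left ?c"]) auto
  then have cc: "cdf M ?c = 1 - \<alpha>" using c by simp
  have "{s. measure M {s<..} \<le> \<alpha>} = ?S" by (auto simp: tail)
  also have "?S = {?c..}"
  proof
    show "?S \<subseteq> {?c..}" using cInf_lower[OF _ bdd] by auto
    show "{?c..} \<subseteq> ?S" using c cdf_nondecreasing by (fastforce intro: order_trans)
  qed
  finally have S: "{s. measure M {s<..} \<le> \<alpha>} = {?c..}" .
  then show "{s. measure M {s<..} \<le> \<alpha>} \<in> sets borel" by simp
  have "measure M {?c..} = measure M ({?c} \<union> {?c<..})" by (rule arg_cong[where f = "measure M"]) auto
  also have "\<dots> = measure M {?c} + measure M {?c<..}" by (rule finite_measure_Union) auto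
  finally have "measure M {?c..} = \<alpha>" by (simp add: cont tail cc)
  then show "measure M {s. measure M {s<..} \<le> \<alpha>} = \<alpha>" by (simp only: S)
qed

text \<open>Normalising \<open>h\<close> on the positive half-line gives a distribution without
  atoms, to which the tail result applies.\<close>

lemma upper_tail_integral_uniform:
  fixes h :: "real \<Rightarrow> real"
  assumes [measurable]: "h \<in> borel_measurable borel" and nonneg: "\<And>t. t > 0 \<Longrightarrow> h t \<ge> 0"
    and int: "set_integrable lborel {0<..} h" and pos: "(LBINT t:{0<..}. h t) > 0"
    and \<alpha>: "0 < \<alpha>" "\<alpha> < 1"
  shows "(\<integral>\<^sup>+s. ennreal (h s) * indicator {s. (LBINT t:{s<..}. h t) / (LBINT t:{0<..}. h t) \<le> \<alpha>} s * indicator {0<..} s \<partial>lborel)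
    = ennreal (\<alpha> * (LBINT t:{0<..}. h t))"
proof -
  let ?H = "LBINT t:{0<..}. h t"
  define k where "k t = indicator {0<..} t * h t / ?H" for t
  have [measurable]: "k \<in> borel_measurable borel" unfolding k_def by measurable
  let ?M = "density lborel (\<lambda>t. ennreal (k t))"
  have k0: "k t \<ge> 0" for t using nonneg[of t] pos by (simp add: k_def indicator_def)
  have kint: "integrable lborel k"
    unfolding k_def using int by (simp add: set_integrable_def)
  have em: "emeasure ?M A = ennreal (LBINT t:A. k t)" if [measurable]: "A \<in> sets borel" for A
  proof -
    have "emeasure ?M A = (\<integral>\<^sup>+t. ennreal (indicator A t * k t) \<partial>lborel)"
      by (subst emeasure_density) (auto intro!: nn_integral_cong simp: indicator_def)
    also have "\<dots> = ennreal (\<integral>t. indicator A t * k t \<partial>lborel)"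
      by (rule nn_integral_eq_integral) (use k0 integrable_mult_indicator[OF _ kint, of A] in auto)
    finally show ?thesis by (simp add: set_lebesgue_integral_def)
  qed
  have "(LBINT t:UNIV. k t) = (\<integral>t. indicator {0<..} t * h t / ?H \<partial>lborel)"
    by (simp add: set_lebesgue_integral_def k_def)
  also have "\<dots> = ?H / ?H" by (simp add: set_lebesgue_integral_def)
  finally have "(LBINT t:UNIV. k t) = 1" using pos by simp
  then have "emeasure ?M UNIV = 1" using em[of UNIV] by simp
  then have "prob_space ?M" by (intro prob_spaceI) simp
  then interpret M: real_distribution ?M
    by (simp add: real_distribution_def real_distribution_axioms_def)
  have "emeasure ?M {x} = 0" for x
  proof -
    have "(LBINT t:{x}. k t) = 0"
    proof -
      have "AE t in lborel. indicator {x} t *\<^sub>R k t = 0"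
        using AE_lborel_singleton[of x] by eventually_elim simp
      then show ?thesis by (simp add: set_lebesgue_integral_def integral_eq_zero_AE)
    qed
    then show ?thesis by (subst em) simp_all
  qed
  then have "measure ?M {x} = 0" for x by (simp add: measure_def)
  note tail_unif = M.upper_tail_uniform[OF this \<alpha>]
  have tail: "measure ?M {s<..} = (LBINT t:{s<..}. h t) / ?H" if "s > 0" for s
  proof -
    have "(LBINT t:{s<..}. k t) = (\<integral>t. (indicator {s<..} t * h t) / ?H \<partial>lborel)"
      unfolding set_lebesgue_integral_def k_def using that by (intro Bochner_Integration.integral_cong) (auto simp: indicator_def)
    also have "\<dots> = (LBINT t:{s<..}. h t) / ?H" by (simp add: set_lebesgue_integral_def)
    moreover have "(LBINT t:{s<..}. k t) \<ge> 0"
      unfolding set_lebesgue_integral_def using k0 by (intro integral_nonneg_AE) auto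
    ultimately show ?thesis using em[of "{s<..}"] by (simp add: measure_def)
  qed
  have "ennreal \<alpha> = emeasure ?M {s. measure ?M {s<..} \<le> \<alpha>}"
    using tail_unif(1) by (simp add: M.emeasure_eq_measure)
  also have "\<dots> = (\<integral>\<^sup>+s. ennreal (k s) * indicator {s. measure ?M {s<..} \<le> \<alpha>} s \<partial>lborel)"
    using tail_unif(2) by (subst emeasure_density) simp_all
  finally have "ennreal ?H * ennreal \<alpha> = ennreal ?H * \<dots>" by simp
  also have "\<dots> = (\<integral>\<^sup>+s. ennreal ?H * (ennreal (k s) * indicator {s. measure ?M {s<..} \<le> \<alpha>} s) \<partial>lborel)"
    using tail_unif(2) by (intro nn_integral_cmult[symmetric]) simp
  also have "\<dots> = (\<integral>\<^sup>+s. ennreal (h s) * indicator {s. (LBINT t:{s<..}. h t) / ?H \<le> \<alpha>} s * indicator {0<..} s \<partial>lborel)"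
  proof (rule nn_integral_cong)
    fix s :: real
    show "ennreal ?H * (ennreal (k s) * indicator {s. measure ?M {s<..} \<le> \<alpha>} s)
      = ennreal (h s) * indicator {s. (LBINT t:{s<..}. h t) / ?H \<le> \<alpha>} s * indicator {0<..} s"
    proof (cases "s > 0")
      case True
      have "ennreal ?H * ennreal (k s) = ennreal (h s)"
        using True pos nonneg by (subst ennreal_mult[symmetric]) (simp_all add: k_def)
      then show ?thesis using True tail[OF True] by (simp add: indicator_def mult.assoc[symmetric])
    qed (simp add: k_def)
  qed
  finally show ?thesis using pos \<alpha> by (simp add: ennreal_mult mult.commute)
qed

text \<open>The power of t is the Jacobian of polar coordinates around the origin, where the null
  value will be placed.\<close>

definition ray :: "('a::euclidean_space \<Rightarrow> real) \<Rightarrow> 'a \<Rightarrow> real \<Rightarrow> real" where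
  "ray f z t = t ^ (DIM('a) - 1) * f (t *\<^sub>R z)"

text \<open>The point \<open>z\<close> sits at t = 1 on its own ray, so this is the directional
  p-value of \<open>z\<close> for the density \<open>f\<close>.\<close>

definition ray_tail :: "('a::euclidean_space \<Rightarrow> real) \<Rightarrow> 'a \<Rightarrow> real" where
  "ray_tail f z = (LBINT t:{1<..}. ray f z t) / (LBINT t:{0<..}. ray f z t)"

lemma measurable_ray [measurable (raw)]:
  assumes [measurable]: "f \<in> borel_measurable borel" "g \<in> borel_measurable M" "h \<in> borel_measurable M"
  shows "(\<lambda>x. ray f (g x) (h x)) \<in> borel_measurable M"
  unfolding ray_def by measurable

lemma measurable_ray_tail [measurable]:
  fixes f :: "'a::euclidean_space \<Rightarrow> real"
  assumes [measurable]: "f \<in> borel_measurable borel"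
  shows "ray_tail f \<in> borel_measurable borel"
proof -
  have "(\<lambda>z. LBINT t:A. ray f z t) \<in> borel_measurable borel" if [measurable]: "A \<in> sets borel" for A
  proof -
    have "(\<lambda>(z, t). indicator A t *\<^sub>R ray f z t) \<in> borel_measurable (borel \<Otimes>\<^sub>M lborel)"
      by measurable
    then show ?thesis unfolding set_lebesgue_integral_def
      by (rule lborel.borel_measurable_lebesgue_integral)
  qed
  then show ?thesis unfolding ray_tail_def by measurable
qed

lemma ray_scale:
  fixes f :: "'a::euclidean_space \<Rightarrow> real"
  assumes "s > 0"
  shows "ray f (s *\<^sub>R z) t = ray f z (s * t) / s ^ (DIM('a) - 1)"
  using assms by (simp add: ray_def power_mult_distrib mult.commute)

lemma set_integral_ray_scale:
  fixes f :: "'a::euclidean_space \<Rightarrow> real"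
  assumes "s > 0" "c \<ge> 0"
  shows "(LBINT t:{c<..}. ray f (s *\<^sub>R z) t) = (LBINT t:{s * c<..}. ray f z t) / s ^ DIM('a)"
proof -
  have ind: "indicator {s * c<..} (s * t) = (indicator {c<..} t :: real)" for t
    using assms(1) by (simp add: indicator_def)
  have "s * s ^ (DIM('a) - 1) = s ^ DIM('a)"
    by (metis DIM_positive Suc_pred' power_Suc)
  moreover have "(LBINT t:{s * c<..}. ray f z t) = s * (\<integral>t. indicator {c<..} t * ray f z (s * t) \<partial>lborel)"
    unfolding set_lebesgue_integral_def using assms(1)
    by (subst lborel_integral_real_affine[where c = s and t = 0]) (simp_all add: ind)
  moreover have "(LBINT t:{c<..}. ray f (s *\<^sub>R z) t) = (\<integral>t. indicator {c<..} t * ray f z (s * t) \<partial>lborel) / s ^ (DIM('a) - 1)"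
    unfolding set_lebesgue_integral_def using assms(1) by (simp add: ray_scale)
  ultimately show ?thesis using assms(1) by (simp flip: \<open>s * s ^ (DIM('a) - 1) = s ^ DIM('a)\<close>)
qed

text \<open>Moving along a ray multiplies both integrals by the same power of s, which cancels, and
  shifts the lower endpoint from 1 to s.\<close>

lemma ray_tail_scale:
  assumes "s > 0"
  shows "ray_tail f (s *\<^sub>R z) = (LBINT t:{s<..}. ray f z t) / (LBINT t:{0<..}. ray f z t)"
  using assms set_integral_ray_scale[OF assms, of 1 f z] set_integral_ray_scale[OF assms, of 0 f z]
  by (simp add: ray_tail_def)

lemma nn_integral_lborel_scale:
  fixes F :: "'a::euclidean_space \<Rightarrow> ennreal"
  assumes [measurable]: "F \<in> borel_measurable borel" and c: "c > 0"
  shows "(\<integral>\<^sup>+x. F x \<partial>lborel) = ennreal (c ^ DIM('a)) * (\<integral>\<^sup>+x. F (c *\<^sub>R x) \<partial>lborel)"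
  using c by (subst lborel_affine[of c 0]) (simp_all add: nn_integral_density nn_integral_distr nn_integral_cmult)

text \<open>Both sides are averages of \<open>f\<close> over rays; inserting the factor \<open>f (r x) / (\<integral> ray f x)\<close>, whose
  integral in \<open>r\<close> is one, and exchanging the roles of \<open>x\<close> and \<open>r x\<close> reduces the claim to a single ray
  without polar coordinates.\<close>

theorem nn_integral_ray_tail_le:
  fixes f :: "'a::euclidean_space \<Rightarrow> real"
  assumes [measurable]: "f \<in> borel_measurable borel" and nonneg: "\<And>x. f x \<ge> 0"
    and int: "AE z in lborel. set_integrable lborel {0<..} (ray f z)"
    and pos: "AE z in lborel. (LBINT t:{0<..}. ray f z t) > 0"
    and \<alpha>: "0 < \<alpha>" "\<alpha> < 1"
  shows "(\<integral>\<^sup>+x. ennreal (f x) * indicator {x. ray_tail f x \<le> \<alpha>} x \<partial>lborel) = ennreal \<alpha> * (\<integral>\<^sup>+x. ennreal (f x) \<partial>lborel)"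
proof -
  let ?d = "DIM('a)" and ?G = "\<lambda>z. LBINT t:{0<..}. ray f z t"
  let ?B = "indicator {x. ray_tail f x \<le> \<alpha>} :: 'a \<Rightarrow> ennreal"
  have ray0: "t > 0 \<Longrightarrow> ray f z t \<ge> 0" for z t using nonneg by (simp add: ray_def)
  have G0: "?G z \<ge> 0" for z
    unfolding set_lebesgue_integral_def using ray0 by (intro integral_nonneg_AE) (auto simp: indicator_def)
  have [measurable]: "?G \<in> borel_measurable borel"
  proof -
    have "(\<lambda>(z, t). indicator {0<..} t *\<^sub>R ray f z t) \<in> borel_measurable (borel \<Otimes>\<^sub>M lborel)"
      by measurable
    then show ?thesis unfolding set_lebesgue_integral_def
      by (rule lborel.borel_measurable_lebesgue_integral)
  qed
  have Gnn: "(\<integral>\<^sup>+t. ennreal (ray f z t) * indicator {0<..} t \<partial>lborel) = ennreal (?G z)"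
    if "set_integrable lborel {0<..} (ray f z)" for z
  proof -
    have "(\<integral>\<^sup>+t. ennreal (ray f z t) * indicator {0<..} t \<partial>lborel) = (\<integral>\<^sup>+t. ennreal (indicator {0<..} t *\<^sub>R ray f z t) \<partial>lborel)"
      by (intro nn_integral_cong) (simp add: indicator_def)
    also have "\<dots> = ennreal (?G z)"
      using that ray0 unfolding set_integrable_def set_lebesgue_integral_def
      by (intro nn_integral_eq_integral) (auto simp: indicator_def)
    finally show ?thesis .
  qed
  let ?F = "\<lambda>x r. ennreal (f x) * ?B x * (ennreal (ray f x r) * ennreal (1 / ?G x)) * indicator {0<..} r"
  let ?K = "\<lambda>x r. ennreal (f x) * ennreal (1 / ?G x) *
    (ennreal (ray f x (1 / r)) * ?B ((1 / r) *\<^sub>R x) * ennreal (1 / r\<^sup>2) * indicator {0<..} r)"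
  have [measurable]: "case_prod (\<lambda>x r. ?F x r) \<in> borel_measurable (lborel \<Otimes>\<^sub>M lborel)"
    by measurable
  have [measurable]: "case_prod (\<lambda>r x. ?F x r) \<in> borel_measurable (lborel \<Otimes>\<^sub>M lborel)"
    by measurable
  have [measurable]: "case_prod (\<lambda>r x. ?K x r) \<in> borel_measurable (lborel \<Otimes>\<^sub>M lborel)"
    by measurable
  have "(\<integral>\<^sup>+x. ennreal (f x) * ?B x \<partial>lborel) = (\<integral>\<^sup>+x. \<integral>\<^sup>+r. ?F x r \<partial>lborel \<partial>lborel)"
  proof (rule nn_integral_cong_AE, use int pos in eventually_elim)
    fix x :: 'a assume x: "set_integrable lborel {0<..} (ray f x)" "?G x > 0"
    have "(\<integral>\<^sup>+r. ?F x r \<partial>lborel) = (\<integral>\<^sup>+r. ennreal (f x) * ?B x * ennreal (1 / ?G x) * (ennreal (ray f x r) * indicator {0<..} r) \<partial>lborel)"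
      by (simp add: mult_ac)
    also have "\<dots> = ennreal (f x) * ?B x * ennreal (1 / ?G x) * ennreal (?G x)"
      by (subst nn_integral_cmult) (simp_all add: Gnn[OF x(1)])
    also have "\<dots> = ennreal (f x) * ?B x" using x(2) by (simp add: mult.assoc flip: ennreal_mult)
    finally show "ennreal (f x) * ?B x = (\<integral>\<^sup>+r. ?F x r \<partial>lborel)" ..
  qed
  also have "\<dots> = (\<integral>\<^sup>+r. \<integral>\<^sup>+x. ?F x r \<partial>lborel \<partial>lborel)"
    by (rule lborel_pair.Fubini') simp
  also have "\<dots> = (\<integral>\<^sup>+r. \<integral>\<^sup>+x. ?K x r \<partial>lborel \<partial>lborel)"
  proof (rule nn_integral_cong)
    fix r :: real
    show "(\<integral>\<^sup>+x. ?F x r \<partial>lborel) = (\<integral>\<^sup>+x. ?K x r \<partial>lborel)"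
    proof (cases "r > 0")
      case True
      have [measurable]: "(\<lambda>x. ray f x r) \<in> borel_measurable borel" by measurable
      have "(\<integral>\<^sup>+x. ?F x r \<partial>lborel) = ennreal ((1 / r) ^ ?d) * (\<integral>\<^sup>+x. ?F ((1 / r) *\<^sub>R x) r \<partial>lborel)"
        using True by (intro nn_integral_lborel_scale) simp_all
      also have "\<dots> = (\<integral>\<^sup>+x. ennreal ((1 / r) ^ ?d) * ?F ((1 / r) *\<^sub>R x) r \<partial>lborel)"
        by (rule nn_integral_cmult[symmetric]) measurable
      also have "\<dots> = (\<integral>\<^sup>+x. ?K x r \<partial>lborel)"
      proof (rule nn_integral_cong)
        fix x :: 'a
        have G: "?G ((1 / r) *\<^sub>R x) = ?G x * r ^ ?d"
          using set_integral_ray_scale[of "1 / r" 0 f x] True by (simp add: power_inverse divide_inverse)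
        have d: "r ^ ?d = r * r ^ (?d - 1)" by (metis DIM_positive Suc_pred' power_Suc)
        \<comment> \<open>Powers of r: -d from scaling Lebesgue measure, -d from the normaliser, and
          d - 1 from each of the points x and x / r. The sum -2 is the Jacobian of the inversion
          applied afterwards.\<close>
        have "(1 / r) ^ ?d * (f ((1 / r) *\<^sub>R x) * (ray f ((1 / r) *\<^sub>R x) r * (1 / ?G ((1 / r) *\<^sub>R x))))
          = f x * (1 / ?G x) * (ray f x (1 / r) * (1 / r\<^sup>2))"
        proof -
          have "(1 / r) ^ ?d * (f ((1 / r) *\<^sub>R x) * (ray f ((1 / r) *\<^sub>R x) r * (1 / (g * r ^ ?d))))
            = f x * (1 / g) * (ray f x (1 / r) * (1 / r\<^sup>2))" for g
            using True by (simp add: ray_def power_one_over d field_simps power2_eq_square)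
          then show ?thesis unfolding G .
        qed
        then have "ennreal ((1 / r) ^ ?d * (f ((1 / r) *\<^sub>R x) * (ray f ((1 / r) *\<^sub>R x) r * (1 / ?G ((1 / r) *\<^sub>R x)))))
          = ennreal (f x * (1 / ?G x) * (ray f x (1 / r) * (1 / r\<^sup>2)))" by simp
        then have "ennreal ((1 / r) ^ ?d) * (ennreal (f ((1 / r) *\<^sub>R x)) * (ennreal (ray f ((1 / r) *\<^sub>R x) r) * ennreal (1 / ?G ((1 / r) *\<^sub>R x))))
          = ennreal (f x) * ennreal (1 / ?G x) * (ennreal (ray f x (1 / r)) * ennreal (1 / r\<^sup>2))"
          using True nonneg ray0 G0 by (simp only: ennreal_mult mult_nonneg_nonneg zero_le_power divide_nonneg_nonneg zero_le_one less_imp_le zero_less_divide_1_iff zero_le_power2)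
        then show "ennreal ((1 / r) ^ ?d) * ?F ((1 / r) *\<^sub>R x) r = ?K x r"
          using True by (cases "ray_tail f ((1 / r) *\<^sub>R x) \<le> \<alpha>") (simp_all add: mult.assoc)
      qed
      finally show ?thesis .
    qed simp
  qed
  also have "\<dots> = (\<integral>\<^sup>+x. \<integral>\<^sup>+r. ?K x r \<partial>lborel \<partial>lborel)"
    by (rule lborel_pair.Fubini'[symmetric]) measurable
  also have "\<dots> = (\<integral>\<^sup>+x. ennreal \<alpha> * ennreal (f x) \<partial>lborel)"
  proof (rule nn_integral_cong_AE, use int pos in eventually_elim)
    fix x :: 'a assume x: "set_integrable lborel {0<..} (ray f x)" "?G x > 0"
    let ?H = "\<lambda>s. ennreal (ray f x s) * ?B (s *\<^sub>R x)"
    have "(\<integral>\<^sup>+r. ?K x r \<partial>lborel) = ennreal (f x) * ennreal (1 / ?G x) * (\<integral>\<^sup>+r. ?H (1 / r) * ennreal (1 / r\<^sup>2) * indicator {0<..} r \<partial>lborel)"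
      by (rule nn_integral_cmult) measurable
    also have "(\<integral>\<^sup>+r. ?H (1 / r) * ennreal (1 / r\<^sup>2) * indicator {0<..} r \<partial>lborel) = (\<integral>\<^sup>+s. ?H s * indicator {0<..} s \<partial>lborel)"
      by (rule nn_integral_inversion) measurable
    also have "\<dots> = (\<integral>\<^sup>+s. ennreal (ray f x s) * indicator {s. (LBINT t:{s<..}. ray f x t) / ?G x \<le> \<alpha>} s * indicator {0<..} s \<partial>lborel)"
      by (rule nn_integral_cong) (auto simp: indicator_def ray_tail_scale)
    also have "\<dots> = ennreal (\<alpha> * ?G x)"
      by (rule upper_tail_integral_uniform) (use x ray0 \<alpha> in auto)
    also have "ennreal (f x) * ennreal (1 / ?G x) * ennreal (\<alpha> * ?G x) = ennreal \<alpha> * ennreal (f x)"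
      using x(2) \<alpha> nonneg[of x] by (simp add: mult.commute flip: ennreal_mult)
    finally show "(\<integral>\<^sup>+r. ?K x r \<partial>lborel) = ennreal \<alpha> * ennreal (f x)" .
  qed
  also have "\<dots> = ennreal \<alpha> * (\<integral>\<^sup>+x. ennreal (f x) \<partial>lborel)"
    by (rule nn_integral_cmult) simp
  finally show ?thesis .
qed

text \<open>The distribution function is prescribed on the open unit interval only; outside,
  monotonicity and its values near 0 and 1 determine it.\<close>

lemma (in prob_space) distributed_uniformI:
  fixes X :: "'a \<Rightarrow> real"
  assumes [measurable]: "X \<in> borel_measurable M"
    and cdf: "\<And>\<alpha>. 0 < \<alpha> \<Longrightarrow> \<alpha> < 1 \<Longrightarrow> prob {\<omega> \<in> space M. X \<omega> \<le> \<alpha>} = \<alpha>"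
  shows "distributed M lborel X (indicator {0<..<1})"
proof -
  let ?U = "density lborel (indicator {0<..<1} :: real \<Rightarrow> ennreal)"
  interpret X: real_distribution "distr M borel X"
    by (intro real_distribution_distr) simp
  have "prob_space ?U" by (intro prob_spaceI) (simp add: emeasure_density)
  then interpret U: real_distribution ?U
    by (simp add: real_distribution_def real_distribution_axioms_def)
  have cX: "cdf (distr M borel X) \<alpha> = prob {\<omega> \<in> space M. X \<omega> \<le> \<alpha>}" for \<alpha>
    by (simp add: cdf_def measure_distr vimage_def Int_def conj_commute)
  have cX1: "cdf (distr M borel X) \<alpha> = \<alpha>" if "0 < \<alpha>" "\<alpha> < 1" for \<alpha>
    using cdf[OF that] by (simp add: cX)
  have cU: "cdf ?U x = max 0 (min 1 x)" for x
  proof -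
    have "indicator {0<..<1} t * indicator {..x} t = (indicator ({0<..<1} \<inter> {..x}) t :: ennreal)" for t
      by (simp add: indicator_def)
    then have "emeasure ?U {..x} = emeasure lborel ({0<..<1} \<inter> {..x})"
      by (simp add: emeasure_density)
    also have "{0<..<1} \<inter> {..x} = (if x < 1 then {0<..x} else {0<..<1})" by auto
    finally have "emeasure ?U {..x} = ennreal (max 0 (min 1 x))"
      by (cases "x \<le> 0") (auto simp: min_def max_def)
    then show ?thesis
      by (simp only: cdf_def measure_def) (rule enn2real_ennreal, simp)
  qed
  have "cdf (distr M borel X) x = cdf ?U x" for x
  proof (cases "0 < x \<and> x < 1")
    case False
    show ?thesis
    proof (cases "x \<le> 0")
      case True
      have "cdf (distr M borel X) x \<le> 0 + \<epsilon>" if "0 < \<epsilon>" for \<epsilon>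
      proof -
        let ?e = "min \<epsilon> (1 / 2)"
        have "cdf (distr M borel X) x \<le> cdf (distr M borel X) ?e"
          using True that by (intro X.cdf_nondecreasing) auto
        also have "\<dots> = ?e" using that by (intro cX1) auto
        finally show ?thesis by simp
      qed
      then have "cdf (distr M borel X) x \<le> 0" by (rule field_le_epsilon)
      then show ?thesis using True X.cdf_nonneg[of x] by (simp add: cU)
    next
      case f: False
      then have x: "x \<ge> 1" using False by auto
      have "1 \<le> cdf (distr M borel X) x + \<epsilon>" if "0 < \<epsilon>" for \<epsilon>
      proof -
        let ?e = "max (1 - \<epsilon>) (1 / 2)"
        have "?e = cdf (distr M borel X) ?e" using that by (intro cX1[symmetric]) auto
        also have "\<dots> \<le> cdf (distr M borel X) x"
          using x that by (intro X.cdf_nondecreasing) auto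
        finally show ?thesis by simp
      qed
      then have "1 \<le> cdf (distr M borel X) x" by (rule field_le_epsilon)
      then show ?thesis using x X.cdf_bounded_prob[of x] by (simp add: cU)
    qed
  qed (simp add: cX1 cU)
  then have "distr M borel X = ?U"
    by (intro cdf_unique X.real_distribution_axioms U.real_distribution_axioms) auto
  then have "distr M lborel X = ?U"
    by (metis distr_cong sets_lborel)
  then show ?thesis by (simp add: distributed_def)
qed

theorem (in prob_space) distributed_ray_tail:
  fixes f :: "'b::euclidean_space \<Rightarrow> real" and X :: "'a \<Rightarrow> 'b"
  assumes X: "distributed M lborel X (\<lambda>x. ennreal (f x))"
    and [measurable]: "f \<in> borel_measurable borel" and nonneg: "\<And>x. f x \<ge> 0"
    and int: "AE z in lborel. set_integrable lborel {0<..} (ray f z)"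
    and pos: "AE z in lborel. (LBINT t:{0<..}. ray f z t) > 0"
  shows "distributed M lborel (\<lambda>\<omega>. ray_tail f (X \<omega>)) (indicator {0<..<1})"
proof (rule distributed_uniformI)
  have [measurable]: "X \<in> borel_measurable M" using X by (simp add: distributed_def)
  show "(\<lambda>\<omega>. ray_tail f (X \<omega>)) \<in> borel_measurable M" by measurable
  have "(\<integral>\<^sup>+x. ennreal (f x) \<partial>lborel) = (\<integral>\<^sup>+\<omega>. 1 \<partial>M)"
    using distributed_nn_integral[OF X, of "\<lambda>_. 1"] by simp
  then have one: "(\<integral>\<^sup>+x. ennreal (f x) \<partial>lborel) = 1" by (simp add: emeasure_space_1)
  fix \<alpha> :: real assume \<alpha>: "0 < \<alpha>" "\<alpha> < 1"
  have "emeasure M {\<omega> \<in> space M. ray_tail f (X \<omega>) \<le> \<alpha>} = (\<integral>\<^sup>+\<omega>. indicator {x. ray_tail f x \<le> \<alpha>} (X \<omega>) \<partial>M)"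
  proof -
    have "(\<integral>\<^sup>+\<omega>. indicator {x. ray_tail f x \<le> \<alpha>} (X \<omega>) \<partial>M) = (\<integral>\<^sup>+\<omega>. indicator {\<omega> \<in> space M. ray_tail f (X \<omega>) \<le> \<alpha>} \<omega> \<partial>M)"
      by (rule nn_integral_cong) (simp add: indicator_def)
    also have "\<dots> = emeasure M {\<omega> \<in> space M. ray_tail f (X \<omega>) \<le> \<alpha>}"
      by (rule nn_integral_indicator) measurable
    finally show ?thesis ..
  qed
  also have "\<dots> = (\<integral>\<^sup>+x. ennreal (f x) * indicator {x. ray_tail f x \<le> \<alpha>} x \<partial>lborel)"
    by (rule distributed_nn_integral[OF X, symmetric]) simp
  also have "\<dots> = ennreal \<alpha>"
    by (simp add: nn_integral_ray_tail_le[OF assms(2) nonneg int pos \<alpha>] one)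
  finally show "prob {\<omega> \<in> space M. ray_tail f (X \<omega>) \<le> \<alpha>} = \<alpha>"
    using \<alpha> by (simp add: measure_def)
qed

section \<open>The normal family in canonical parameters\<close>

definition pack :: "real^'p \<Rightarrow> real^('p uprod) \<Rightarrow> 'p::finite canonical" where
  "pack a s = (\<chi> k. case k of Inl i \<Rightarrow> a $ i | Inr u \<Rightarrow> s $ u)"

definition sym_of :: "'p::finite canonical \<Rightarrow> real^('p uprod)" where
  "sym_of \<phi> = (\<chi> u. \<phi> $ Inr u)"

lemma pack_nth [simp]: "pack a s $ Inl i = a $ i" "pack a s $ Inr u = s $ u"
  by (simp_all add: pack_def)

lemma xi_of_pack [simp]: "xi_of (pack a s) = a" and sym_of_pack [simp]: "sym_of (pack a s) = s"
  by (simp_all add: xi_of_def sym_of_def)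

lemma pack_xi_sym [simp]: "pack (xi_of \<phi>) (sym_of \<phi>) = \<phi>"
  by (simp add: vec_eq_iff pack_def xi_of_def sym_of_def split: sum.split)

lemma conc_of_sym: "conc_of \<phi> = smat (sym_of \<phi>)"
  by (simp add: conc_of_def sym_of_def vec_eq_iff)

lemma conc_of_pack [simp]: "conc_of (pack a s) = smat s"
  by (simp add: conc_of_sym)

lemma transpose_conc_of [simp]: "transpose (conc_of \<phi>) = conc_of \<phi>"
  by (simp add: conc_of_sym)

lemma xi_of_add [simp]: "xi_of (v + w) = xi_of v + xi_of w"
  and xi_of_scaleR [simp]: "xi_of (c *\<^sub>R v) = c *\<^sub>R xi_of v"
  and conc_of_add [simp]: "conc_of (v + w) = conc_of v + conc_of w"
  and conc_of_scaleR [simp]: "conc_of (c *\<^sub>R v) = c *\<^sub>R conc_of v"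
  by (simp_all add: xi_of_def conc_of_def vec_eq_iff)

lemma canonical_eq_0: "xi_of v = 0 \<Longrightarrow> conc_of v = 0 \<Longrightarrow> v = 0"
proof -
  assume "xi_of v = 0" "conc_of v = 0"
  then have "v $ Inl i = 0" "v $ Inr (Upair i j) = 0" for i j
    by (simp_all add: xi_of_def conc_of_def vec_eq_iff)
  then have "v $ k = 0" for k by (cases k) (metis uprod_exhaust)+
  then show "v = 0" by (simp add: vec_eq_iff)
qed

lemma smat_0 [simp]: "smat 0 = 0"
  by (simp add: vec_eq_iff)

lemma continuous_on_xi_of [continuous_intros]:
  "continuous_on X f \<Longrightarrow> continuous_on X (\<lambda>x. xi_of (f x))"
  unfolding xi_of_def by (intro continuous_intros)

lemma continuous_on_conc_of [continuous_intros]: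
  "continuous_on X f \<Longrightarrow> continuous_on X (\<lambda>x. conc_of (f x))"
  unfolding conc_of_def by (intro continuous_intros)

lemma mvn_params_iff: "\<phi> \<in> mvn_params \<longleftrightarrow> pos_def (conc_of \<phi>)"
  by (simp add: mvn_params_def)

text \<open>\<open>conc_of\<close> is symmetric by construction, so the quadratic form is the only
  restriction; openness and convexity of the parameter set follow from this.\<close>

lemma mvn_params_iff': "\<phi> \<in> mvn_params \<longleftrightarrow> (\<forall>x. x \<noteq> 0 \<longrightarrow> x \<bullet> (conc_of \<phi> *v x) > 0)"
  by (simp add: mvn_params_iff pos_def_def)

lemma det_conc_pos: "\<phi> \<in> mvn_params \<Longrightarrow> det (conc_of \<phi>) > 0"
  by (simp add: mvn_params_iff pos_def_det_pos)

lemma open_mvn_params: "open (mvn_params :: 'p::finite canonical set)"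
proof -
  have *: "(mvn_params :: 'p canonical set) = conc_of -` {A. \<forall>x. x \<noteq> 0 \<longrightarrow> x \<bullet> (A *v x) > 0}"
    by (auto simp: mvn_params_iff')
  have "continuous_on UNIV (conc_of :: 'p canonical \<Rightarrow> _)"
    by (intro continuous_on_conc_of continuous_intros)
  then show ?thesis unfolding * by (rule open_vimage[OF open_pos_quadratic])
qed

lemma convex_mvn_params: "convex (mvn_params :: 'p::finite canonical set)"
proof (rule convexI)
  fix \<phi> \<theta> :: "'p canonical" and u v :: real
  assume a: "\<phi> \<in> mvn_params" "\<theta> \<in> mvn_params" "0 \<le> u" "0 \<le> v" "u + v = 1"
  have "x \<bullet> (conc_of (u *\<^sub>R \<phi> + v *\<^sub>R \<theta>) *v x) > 0" if "x \<noteq> 0" for x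
  proof -
    have pq: "x \<bullet> (conc_of \<phi> *v x) > 0" "x \<bullet> (conc_of \<theta> *v x) > 0" using a that by (auto simp: mvn_params_iff')
    have "x \<bullet> (conc_of (u *\<^sub>R \<phi> + v *\<^sub>R \<theta>) *v x) = u * (x \<bullet> (conc_of \<phi> *v x)) + v * (x \<bullet> (conc_of \<theta> *v x))"
      by (simp add: matrix_vector_mult_add_rdistrib inner_add_right scaleR_matrix_vector_assoc[symmetric])
    then show ?thesis using pq a(3-5) by (cases "u = 0") (auto intro: add_pos_nonneg)
  qed
  then show "u *\<^sub>R \<phi> + v *\<^sub>R \<theta> \<in> mvn_params" by (simp add: mvn_params_iff')
qed

lemma open_line: "open {h :: real. \<phi> + h *\<^sub>R v \<in> mvn_params}"
proof -
  have "continuous_on UNIV (\<lambda>h. \<phi> + h *\<^sub>R v)" by (intro continuous_intros)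
  then have "open ((\<lambda>h. \<phi> + h *\<^sub>R v) -` mvn_params)" by (rule open_vimage[OF open_mvn_params])
  then show ?thesis by (simp add: vimage_def)
qed

text \<open>Caratheodory's criterion. It suits the matrix inverse, whose increments factor exactly
  through h by the resolvent identity: a continuous quotient can be written down and evaluated at
  0.\<close>

lemma DERIV_quotientI:
  fixes f q :: "real \<Rightarrow> real"
  assumes U: "open U" "0 \<in> U" and q: "continuous_on U q" and eq: "\<And>h. h \<in> U \<Longrightarrow> f h - f 0 = h * q h"
    and D: "q 0 = D"
  shows "(f has_real_derivative D) (at 0)"
proof -
  have "isCont q 0" using continuous_on_eq_continuous_at[OF U(1)] q U(2) by blast
  then have lim: "(q \<longlongrightarrow> q 0) (at 0)" by (simp only: isCont_def)
  have "eventually (\<lambda>h. h \<in> U) (at 0)" using U by (rule eventually_at_in_open')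
  moreover have "eventually (\<lambda>h. h \<noteq> (0::real)) (at 0)" by (simp add: eventually_at_filter)
  ultimately have e: "eventually (\<lambda>h. (f h - f 0) / (h - 0) = q h) (at 0)"
    by eventually_elim (simp add: eq)
  have "((\<lambda>h. (f h - f 0) / (h - 0)) \<longlongrightarrow> q 0) (at 0)"
    by (rule iffD2[OF tendsto_cong[OF e] lim])
  then show ?thesis by (simp only: has_field_derivative_iff D)
qed

section \<open>Inner products of matrices and the derivative of the determinant\<close>

lemma matrix_inner_sum: "A \<bullet> B = (\<Sum>i\<in>UNIV. \<Sum>j\<in>UNIV. A $ i $ j * B $ i $ j)" for A B :: "real^'n^'m"
  by (simp add: inner_vec_def)

lemma matrix_inner_transpose: "transpose A \<bullet> transpose B = A \<bullet> B" for A B :: "real^'n^'m"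
  unfolding matrix_inner_sum transpose_def by simp (rule sum.swap)

lemma inner_matrix_mult_left: "(A ** B) \<bullet> C = B \<bullet> (transpose A ** C)"
  for A :: "real^'n^'m" and B :: "real^'k^'n"
proof -
  have "(A ** B) \<bullet> C = (\<Sum>i\<in>UNIV. \<Sum>j\<in>UNIV. \<Sum>k\<in>UNIV. A $ i $ k * B $ k $ j * C $ i $ j)"
    by (simp add: matrix_inner_sum matrix_matrix_mult_def sum_distrib_right)
  also have "\<dots> = (\<Sum>i\<in>UNIV. \<Sum>k\<in>UNIV. \<Sum>j\<in>UNIV. A $ i $ k * B $ k $ j * C $ i $ j)"
    by (intro sum.cong refl sum.swap)
  also have "\<dots> = (\<Sum>k\<in>UNIV. \<Sum>i\<in>UNIV. \<Sum>j\<in>UNIV. A $ i $ k * B $ k $ j * C $ i $ j)"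
    by (rule sum.swap)
  also have "\<dots> = (\<Sum>k\<in>UNIV. \<Sum>j\<in>UNIV. \<Sum>i\<in>UNIV. A $ i $ k * B $ k $ j * C $ i $ j)"
    by (intro sum.cong refl sum.swap)
  also have "\<dots> = B \<bullet> (transpose A ** C)"
    by (simp add: matrix_inner_sum matrix_matrix_mult_def transpose_def sum_distrib_left mult_ac)
  finally show ?thesis .
qed

lemma inner_matrix_mult_right: "(A ** B) \<bullet> C = A \<bullet> (C ** transpose B)"
  for A :: "real^'n^'m" and B :: "real^'k^'n"
proof -
  have "(A ** B) \<bullet> C = transpose (A ** B) \<bullet> transpose C" by (simp only: matrix_inner_transpose)
  also have "\<dots> = (transpose B ** transpose A) \<bullet> transpose C" by (simp only: matrix_transpose_mul)
  also have "\<dots> = transpose A \<bullet> (B ** transpose C)" by (simp only: inner_matrix_mult_left transpose_transpose)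
  also have "\<dots> = A \<bullet> transpose (B ** transpose C)" using matrix_inner_transpose[of A "transpose (B ** transpose C)"] by simp
  finally show ?thesis by (simp add: matrix_transpose_mul)
qed

lemma inner_outer: "A \<bullet> outer x = x \<bullet> (A *v x)"
  by (simp add: matrix_inner_sum matrix_vector_mult_def inner_vec_def sum_distrib_left mult_ac)

lemma inner_symmetric_swap:
  fixes A :: "real^'n^'n"
  shows "transpose A = A \<Longrightarrow> x \<bullet> (A *v y) = (A *v x) \<bullet> y"
  using inner_matrix_transpose[of x A y] by simp

lemma transpose_matrix_inv:
  fixes A :: "real^'n^'n"
  assumes "det A \<noteq> 0" "transpose A = A"
  shows "transpose (matrix_inv A) = matrix_inv A"
proof -
  have "transpose (matrix_inv A) ** A = transpose (A ** matrix_inv A)"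
    using assms(2) by (simp add: matrix_transpose_mul)
  then have "transpose (matrix_inv A) ** A = mat 1" by (simp add: matrix_inv_right[OF assms(1)] transpose_mat)
  then show ?thesis using matrix_inv_unique_left by metis
qed

text \<open>In the Leibniz expansion a permutation other than the identity moves at least two
  points, so every term of its derivative at 0 keeps an off-diagonal entry of the identity as a
  factor. The identity permutation contributes the trace.\<close>

lemma DERIV_det_one:
  "((\<lambda>h. det (mat 1 + h *\<^sub>R M)) has_real_derivative trace (M :: real^'n^'n)) (at 0)"
proof -
  let ?c = "\<lambda>q i. (mat 1 :: real^'n^'n) $ i $ q i" and ?d = "\<lambda>q i. M $ i $ q i"
  have D: "((\<lambda>h. \<Prod>i\<in>UNIV. ?c q i + h * ?d q i) has_derivative
      (\<lambda>y. \<Sum>i\<in>UNIV. (y * ?d q i) * (\<Prod>j\<in>UNIV - {i}. ?c q j + 0 * ?d q j))) (at 0)" for q :: "'n \<Rightarrow> 'n"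
    by (rule has_derivative_prod) (auto intro!: derivative_eq_intros)
  have eq: "det (mat 1 + h *\<^sub>R M) = (\<Sum>q | q permutes UNIV. of_int (sign q) * (\<Prod>i\<in>UNIV. ?c q i + h * ?d q i))" for h
    unfolding det_def by (simp only: vector_add_component vector_scaleR_component real_scaleR_def)
  have "((\<lambda>h. det (mat 1 + h *\<^sub>R M)) has_derivative
      (\<lambda>y. \<Sum>q | q permutes UNIV. of_int (sign q) * (\<Sum>i\<in>UNIV. (y * ?d q i) * (\<Prod>j\<in>UNIV - {i}. ?c q j + 0 * ?d q j)))) (at 0)"
    unfolding eq by (intro has_derivative_sum has_derivative_mult_right D)
  moreover have "(\<Sum>q | q permutes UNIV. of_int (sign q) * (\<Sum>i\<in>UNIV. (y * ?d q i) * (\<Prod>j\<in>UNIV - {i}. ?c q j + 0 * ?d q j)))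
      = trace M * y" (is "sum ?r _ = _") for y
  proof -
    have zero: "?r q = 0" if q: "q permutes UNIV" "q \<noteq> id" for q
    proof -
      have "(y * ?d q i) * (\<Prod>j\<in>UNIV - {i}. ?c q j + 0 * ?d q j) = 0" for i
      proof -
        have "\<exists>j. j \<noteq> i \<and> q j \<noteq> j"
        proof (rule ccontr)
          assume "\<not> ?thesis"
          then have fix': "\<And>j. j \<noteq> i \<Longrightarrow> q j = j" by blast
          have inj: "inj q" using q(1) by (rule permutes_inj)
          have "q i = i"
          proof (rule ccontr)
            assume *: "q i \<noteq> i"
            then have "q (q i) = q i" by (rule fix')
            then have "q i = i" by (rule injD[OF inj])
            with * show False ..
          qed
          then have "q j = j" for j using fix' by (cases "j = i") simp_all
          then show False using q(2) by (simp add: fun_eq_iff)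
        qed
        then obtain j where j: "j \<noteq> i" "q j \<noteq> j" by blast
        then have "?c q j + 0 * ?d q j = 0" by (simp add: mat_def)
        then have "(\<Prod>j\<in>UNIV - {i}. ?c q j + 0 * ?d q j) = 0"
          using j(1) by (intro prod_zero bexI[of _ j]) simp_all
        then show ?thesis by (simp only: mult_zero_right)
      qed
      then show ?thesis by (simp only: sum.neutral_const mult_zero_right)
    qed
    have "sum ?r {q. q permutes UNIV} = sum ?r {id}"
    proof (rule sum.mono_neutral_right)
      show "finite {q. q permutes (UNIV :: 'n set)}" by (simp add: finite_permutations)
      show "{id} \<subseteq> {q. q permutes (UNIV :: 'n set)}" using permutes_id by blast
      show "\<forall>q\<in>{q. q permutes UNIV} - {id}. ?r q = 0" using zero by blast
    qed
    also have "\<dots> = (\<Sum>i\<in>UNIV. y * M $ i $ i)" by (simp add: mat_def)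
    finally show ?thesis by (simp add: trace_def sum_distrib_left mult.commute)
  qed
  ultimately show ?thesis by (simp only: has_field_derivative_def)
qed

lemma matrix_inner_trace: "trace (A ** B) = transpose A \<bullet> B" for A :: "real^'m^'n"
  unfolding trace_def matrix_matrix_mult_def matrix_inner_sum transpose_def
  by simp (rule sum.swap)

text \<open>The log-normaliser of the family, per observation and up to an additive constant. Its
  first two derivatives follow as forms in the directions, expressed through vectors and matrices
  instead of coordinates.\<close>

definition cumulant :: "'p::finite canonical \<Rightarrow> real" where
  "cumulant \<phi> = (xi_of \<phi> \<bullet> mean_of \<phi> - ln (det (conc_of \<phi>))) / 2"

definition dcumulant :: "'p::finite canonical \<Rightarrow> 'p canonical \<Rightarrow> real" where
  "dcumulant \<phi> v = xi_of v \<bullet> mean_of \<phi>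
    - (mean_of \<phi> \<bullet> (conc_of v *v mean_of \<phi>) + matrix_inv (conc_of \<phi>) \<bullet> conc_of v) / 2"

text \<open>The square is completed: the first summand sees the mean direction recentred at
  \<open>mean_of \<phi>\<close>, the second only the concentration direction.\<close>

definition ddcumulant :: "'p::finite canonical \<Rightarrow> 'p canonical \<Rightarrow> 'p canonical \<Rightarrow> real" where
  "ddcumulant \<phi> v w =
    (xi_of v - conc_of v *v mean_of \<phi>) \<bullet> (matrix_inv (conc_of \<phi>) *v (xi_of w - conc_of w *v mean_of \<phi>))
    + (matrix_inv (conc_of \<phi>) ** conc_of w ** matrix_inv (conc_of \<phi>)) \<bullet> conc_of v / 2"

context
  fixes \<phi> v :: "'p::finite canonical"
  assumes \<phi>: "\<phi> \<in> mvn_params"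
begin

private abbreviation "A h \<equiv> conc_of (\<phi> + h *\<^sub>R v)"
private abbreviation "g h \<equiv> matrix_inv (conc_of (\<phi> + h *\<^sub>R v))"
private abbreviation "U \<equiv> {h. \<phi> + h *\<^sub>R v \<in> mvn_params}"

private lemma U: "open U" "0 \<in> U"
  using open_line \<phi> by auto

private lemma detU: "h \<in> U \<Longrightarrow> det (A h) \<noteq> 0"
  using det_conc_pos by force

private lemma cont_g: "continuous_on U g"
  by (intro continuous_intros detU)

private lemma sym_g: "h \<in> U \<Longrightarrow> transpose (g h) = g h"
  by (intro transpose_matrix_inv detU transpose_conc_of)

text \<open>The resolvent identity, exact for every admissible h.\<close>

lemma matrix_inv_conc_diff:
  assumes "h \<in> U"
  shows "g h - g 0 = - (h *\<^sub>R (g h ** conc_of v ** g 0))"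
proof -
  have "g h ** A h ** g 0 = g 0" using matrix_inv_right(2)[OF detU[OF assms]] by simp
  moreover have "g h ** A 0 ** g 0 = g h" using matrix_inv_right(1)[OF detU[OF U(2)]] by (simp add: matrix_mul_assoc[symmetric])
  moreover have "g h ** A h ** g 0 = g h ** A 0 ** g 0 + h *\<^sub>R (g h ** conc_of v ** g 0)"
    by (simp add: matrix_add_ldistrib vec_eq_iff matrix_matrix_mult_def sum_distrib_left sum_distrib_right algebra_simps sum.distrib)
  ultimately show ?thesis by (simp add: algebra_simps)
qed

lemma mean_of_diff:
  assumes "h \<in> U"
  shows "mean_of (\<phi> + h *\<^sub>R v) - mean_of \<phi> = h *\<^sub>R (g h *v (xi_of v - conc_of v *v mean_of \<phi>))"
proof -
  have "mean_of (\<phi> + h *\<^sub>R v) - mean_of \<phi> = (g h - g 0) *v xi_of \<phi> + h *\<^sub>R (g h *v xi_of v)"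
    by (simp add: mean_of_def matrix_vector_mult_diff_rdistrib matrix_vector_right_distrib matrix_vector_mult_scaleR)
  also have "(g h - g 0) *v xi_of \<phi> = - (h *\<^sub>R (g h *v (conc_of v *v mean_of \<phi>)))"
  proof -
    have "(- (h *\<^sub>R X)) *v x = - (h *\<^sub>R (X *v x))" for X :: "real^'p^'p" and x
      by (simp add: vec_eq_iff matrix_vector_mult_def sum_negf sum_distrib_left mult.assoc)
    then show ?thesis
      by (simp only: matrix_inv_conc_diff[OF assms]) (simp add: mean_of_def matrix_vector_mul_assoc matrix_mul_assoc)
  qed
  finally show ?thesis by (simp add: matrix_vector_mult_diff_distrib algebra_simps)
qed

private lemma cont_mean: "continuous_on U (\<lambda>h. mean_of (\<phi> + h *\<^sub>R v))"
  unfolding mean_of_def by (intro continuous_intros cont_g detU)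

lemma DERIV_cumulant_0: "((\<lambda>h. cumulant (\<phi> + h *\<^sub>R v)) has_real_derivative dcumulant \<phi> v) (at 0)"
proof -
  let ?m = "\<lambda>h. mean_of (\<phi> + h *\<^sub>R v)" and ?a = "xi_of v" and ?H = "conc_of v" and ?\<xi> = "xi_of \<phi>"
  have D1: "((\<lambda>h. xi_of (\<phi> + h *\<^sub>R v) \<bullet> ?m h) has_real_derivative 2 * (?a \<bullet> ?m 0) - ?m 0 \<bullet> (?H *v ?m 0)) (at 0)"
  proof (rule DERIV_quotientI[OF U])
    let ?q = "\<lambda>h. ?a \<bullet> ?m h + ?\<xi> \<bullet> (g h *v (?a - ?H *v ?m 0))"
    show "continuous_on U ?q" by (intro continuous_intros cont_mean cont_g detU)
    show "xi_of (\<phi> + h *\<^sub>R v) \<bullet> ?m h - xi_of (\<phi> + 0 *\<^sub>R v) \<bullet> ?m 0 = h * ?q h" if "h \<in> U" for h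
    proof -
      have "xi_of (\<phi> + h *\<^sub>R v) \<bullet> ?m h - xi_of (\<phi> + 0 *\<^sub>R v) \<bullet> ?m 0 = h * (?a \<bullet> ?m h) + ?\<xi> \<bullet> (?m h - mean_of \<phi>)"
        by (simp add: inner_add_left inner_diff_right)
      then show ?thesis by (simp add: mean_of_diff[OF that] distrib_left)
    qed
    have "?\<xi> \<bullet> (g 0 *v x) = ?m 0 \<bullet> x" for x
      using inner_symmetric_swap[OF sym_g[OF U(2)], of ?\<xi> x] by (simp add: mean_of_def)
    then show "?q 0 = 2 * (?a \<bullet> ?m 0) - ?m 0 \<bullet> (?H *v ?m 0)"
      by (simp add: inner_diff_right inner_commute)
  qed
  \<comment> \<open>Factoring out \<open>A 0\<close> reduces the derivative of the determinant to
    the one at the identity.\<close>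
  have "((\<lambda>h. det (A 0) * det (mat 1 + h *\<^sub>R (g 0 ** ?H))) has_real_derivative det (A 0) * trace (g 0 ** ?H)) (at 0)"
    by (intro DERIV_cmult DERIV_det_one)
  moreover have "det (A 0) * det (mat 1 + h *\<^sub>R (g 0 ** ?H)) = det (A h)" for h
  proof -
    have sc: "Y ** (h *\<^sub>R X) = h *\<^sub>R (Y ** X)" for X Y :: "real^'p^'p"
      by (simp add: vec_eq_iff matrix_matrix_mult_def sum_distrib_left mult.left_commute)
    have "A 0 ** (mat 1 + h *\<^sub>R (g 0 ** ?H)) = A 0 + h *\<^sub>R (A 0 ** g 0 ** ?H)"
      by (simp only: matrix_add_ldistrib sc matrix_mul_assoc matrix_mul_rid)
    then have "A 0 ** (mat 1 + h *\<^sub>R (g 0 ** ?H)) = A h"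
      by (simp only: matrix_inv_right(1)[OF detU[OF U(2)]]) simp
    then show ?thesis by (simp only: det_mul[symmetric])
  qed
  moreover have "trace (g 0 ** ?H) = g 0 \<bullet> ?H"
    using sym_g[OF U(2)] by (simp add: matrix_inner_trace)
  ultimately have "((\<lambda>h. det (A h)) has_real_derivative det (A 0) * (g 0 \<bullet> ?H)) (at 0)" by simp
  then have "((\<lambda>h. ln (det (A h))) has_real_derivative 1 / det (A 0) * (det (A 0) * (g 0 \<bullet> ?H))) (at 0)"
    using det_conc_pos[OF \<phi>] by (intro DERIV_chain2[OF DERIV_ln_divide]) simp_all
  then have D2: "((\<lambda>h. ln (det (A h))) has_real_derivative g 0 \<bullet> ?H) (at 0)"
    using det_conc_pos[OF \<phi>] by simp
  have "(2 * (?a \<bullet> ?m 0) - ?m 0 \<bullet> (?H *v ?m 0) - g 0 \<bullet> ?H) / 2 = dcumulant \<phi> v"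
    by (simp add: dcumulant_def field_simps)
  then show ?thesis
    using DERIV_cdivide[OF DERIV_diff[OF D1 D2], of 2] unfolding cumulant_def by (simp only:)
qed

lemma DERIV_dcumulant_0: "((\<lambda>h. dcumulant (\<phi> + h *\<^sub>R v) w) has_real_derivative ddcumulant \<phi> w v) (at 0)"
proof -
  let ?m = "\<lambda>h. mean_of (\<phi> + h *\<^sub>R v)" and ?a = "xi_of w" and ?H = "conc_of w"
  let ?e = "\<lambda>h. g h *v (xi_of v - conc_of v *v mean_of \<phi>)"
  let ?q = "\<lambda>h. ?a \<bullet> ?e h - (?e h \<bullet> (?H *v ?m h) + ?m 0 \<bullet> (?H *v ?e h) - (g h ** conc_of v ** g 0) \<bullet> ?H) / 2"
  show ?thesis
  proof (rule DERIV_quotientI[OF U, where q = ?q])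
    show "continuous_on U ?q" by (intro continuous_intros cont_mean cont_g detU) auto
    show "dcumulant (\<phi> + h *\<^sub>R v) w - dcumulant (\<phi> + 0 *\<^sub>R v) w = h * ?q h" if "h \<in> U" for h
    proof -
      have 1: "?a \<bullet> ?m h - ?a \<bullet> ?m 0 = h * (?a \<bullet> ?e h)"
        using mean_of_diff[OF that] by (simp flip: inner_diff_right)
      have "?m h \<bullet> (?H *v ?m h) - ?m 0 \<bullet> (?H *v ?m 0) = (?m h - ?m 0) \<bullet> (?H *v ?m h) + ?m 0 \<bullet> (?H *v (?m h - ?m 0))"
        by (simp add: inner_diff_left inner_diff_right matrix_vector_mult_diff_distrib)
      then have 2: "?m h \<bullet> (?H *v ?m h) - ?m 0 \<bullet> (?H *v ?m 0) = h * (?e h \<bullet> (?H *v ?m h) + ?m 0 \<bullet> (?H *v ?e h))"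
        using mean_of_diff[OF that] by (simp add: matrix_vector_mult_scaleR distrib_left)
      have 3: "g h \<bullet> ?H - g 0 \<bullet> ?H = - (h * ((g h ** conc_of v ** g 0) \<bullet> ?H))"
        using matrix_inv_conc_diff[OF that] by (simp flip: inner_diff_left)
      have "dcumulant (\<phi> + h *\<^sub>R v) w - dcumulant (\<phi> + 0 *\<^sub>R v) w = (?a \<bullet> ?m h - ?a \<bullet> ?m 0)
        - ((?m h \<bullet> (?H *v ?m h) - ?m 0 \<bullet> (?H *v ?m 0)) + (g h \<bullet> ?H - g 0 \<bullet> ?H)) / 2"
        by (simp add: dcumulant_def add_divide_distrib diff_divide_distrib)
      then show ?thesis unfolding 1 2 3 by (simp add: algebra_simps diff_divide_distrib add_divide_distrib)
    qed
    have "?m 0 \<bullet> (?H *v ?e 0) = ?e 0 \<bullet> (?H *v ?m 0)"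
      using inner_symmetric_swap[of ?H "?m 0" "?e 0"] by (simp add: inner_commute)
    then show "?q 0 = ddcumulant \<phi> w v"
      by (simp add: ddcumulant_def inner_diff_left inner_commute[of "?H *v mean_of \<phi>"] diff_divide_distrib)
  qed
qed

end

lemma line_add: "\<phi> + h *\<^sub>R v + k *\<^sub>R v = \<phi> + (k + h) *\<^sub>R (v :: 'a::real_vector)"
  by (simp add: scaleR_left_distrib)

lemma DERIV_cumulant:
  assumes "\<phi> + h *\<^sub>R v \<in> mvn_params"
  shows "((\<lambda>h. cumulant (\<phi> + h *\<^sub>R v)) has_real_derivative dcumulant (\<phi> + h *\<^sub>R v) v) (at h)"
proof -
  have "((\<lambda>k. cumulant (\<phi> + (k + h) *\<^sub>R v)) has_real_derivative dcumulant (\<phi> + h *\<^sub>R v) v) (at 0)"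
    using DERIV_cumulant_0[OF assms, of v] by (simp only: line_add)
  then show ?thesis
    using DERIV_shift[of "\<lambda>h. cumulant (\<phi> + h *\<^sub>R v)" "dcumulant (\<phi> + h *\<^sub>R v) v" 0 h] by (simp only: add_0)
qed

lemma DERIV_dcumulant:
  assumes "\<phi> + h *\<^sub>R v \<in> mvn_params"
  shows "((\<lambda>h. dcumulant (\<phi> + h *\<^sub>R v) w) has_real_derivative ddcumulant (\<phi> + h *\<^sub>R v) w v) (at h)"
proof -
  have "((\<lambda>k. dcumulant (\<phi> + (k + h) *\<^sub>R v) w) has_real_derivative ddcumulant (\<phi> + h *\<^sub>R v) w v) (at 0)"
    using DERIV_dcumulant_0[OF assms, of v w] unfolding line_add .
  then show ?thesis
    using DERIV_shift[of "\<lambda>h. dcumulant (\<phi> + h *\<^sub>R v) w" "ddcumulant (\<phi> + h *\<^sub>R v) w v" 0 h]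
    unfolding add_0 by (rule iffD2[rotated])
qed

lemma pos_def_inverse:
  assumes "pos_def A"
  shows "pos_def (matrix_inv A)"
proof -
  have nz: "det A \<noteq> 0" using pos_def_det_pos[OF assms] by simp
  then have dn: "det (matrix_inv A) \<noteq> 0" by (simp add: det_matrix_inv)
  have sym: "transpose A = A" using assms by (simp add: pos_def_def)
  have "congruence (matrix_inv A) A = matrix_inv A"
    by (simp add: congruence_def transpose_matrix_inv[OF nz sym] matrix_inv_right[OF nz])
  then show ?thesis using pos_def_congruence[OF assms dn] by simp
qed

text \<open>With the covariance written as B B^T the Hessian becomes a fixed inner product of the
  images of \<open>v\<close> and \<open>w\<close> under one linear map. Positivity and the
  determinant are both read off from this form.\<close>

lemma ddcumulant_factor:
  assumes "matrix_inv (conc_of \<phi>) = congruence B (mat 1)"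
  shows "ddcumulant \<phi> v w =
    (transpose B *v (xi_of v - conc_of v *v mean_of \<phi>)) \<bullet> (transpose B *v (xi_of w - conc_of w *v mean_of \<phi>))
    + congruence (transpose B) (conc_of w) \<bullet> congruence (transpose B) (conc_of v) / 2"
proof -
  have 1: "x \<bullet> (congruence B (mat 1) *v y) = (transpose B *v x) \<bullet> (transpose B *v y)" for x y
    by (simp add: inner_congruence)
  have "(B ** X ** transpose B) \<bullet> H = X \<bullet> (transpose B ** H ** B)" for X H :: "real^'a^'a"
    by (simp only: inner_matrix_mult_right[of "B ** X" "transpose B" H] transpose_transpose
        inner_matrix_mult_left[of B X] matrix_mul_assoc)
  then have "(B ** (transpose B ** G ** B) ** transpose B) \<bullet> H = congruence (transpose B) G \<bullet> congruence (transpose B) H" for G H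
    by (simp only: congruence_def transpose_transpose)
  then have 2: "(congruence B (mat 1) ** G ** congruence B (mat 1)) \<bullet> H = congruence (transpose B) G \<bullet> congruence (transpose B) H" for G H
    by (simp add: congruence_def matrix_mul_assoc)
  show ?thesis by (simp add: ddcumulant_def assms 1 2)
qed

text \<open>The linear map of \<open>ddcumulant_factor\<close> is injective: if the matrix component
  vanishes then so does \<open>conc_of v\<close>, and then the vector component determines
  \<open>xi_of v\<close>.\<close>

lemma ddcumulant_pos:
  assumes "\<phi> \<in> mvn_params" "v \<noteq> 0"
  shows "ddcumulant \<phi> v v > 0"
proof -
  have "pos_def (matrix_inv (conc_of \<phi>))" using assms(1) by (simp add: mvn_params_iff pos_def_inverse)
  then obtain B where B: "det B \<noteq> 0" "matrix_inv (conc_of \<phi>) = congruence B (mat 1)" by (rule pos_def_factor)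
  have dB: "det (transpose B) \<noteq> 0" using B(1) by simp
  let ?x = "transpose B *v (xi_of v - conc_of v *v mean_of \<phi>)" and ?C = "congruence (transpose B) (conc_of v)"
  have "?x \<noteq> 0 \<or> ?C \<noteq> 0"
  proof (rule ccontr)
    assume "\<not> ?thesis"
    then have x: "?x = 0" and C: "?C = 0" by auto
    have "congruence (matrix_inv (transpose B)) ?C = conc_of v"
      by (simp add: matrix_inv_right[OF dB] flip: congruence_mult)
    then have H: "conc_of v = 0" by (simp add: C linear_0[OF linear_congruence])
    have "matrix_inv (transpose B) *v ?x = xi_of v"
      by (simp add: H matrix_vector_mul_assoc matrix_inv_right[OF dB])
    then have "xi_of v = 0" by (simp add: x)
    then show False using H canonical_eq_0 assms(2) by blast
  qed
  then have "?x \<bullet> ?x + ?C \<bullet> ?C / 2 > 0"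
    by (metis add_nonneg_pos add_pos_nonneg half_gt_zero inner_ge_zero inner_gt_zero_iff zero_le_divide_iff zero_le_numeral)
  then show ?thesis by (simp add: ddcumulant_factor[OF B(2)])
qed

section \<open>Existence, uniqueness and form of the maximum likelihood estimate\<close>

lemma strictly_concave_max:
  fixes g g' g'' :: "real \<Rightarrow> real"
  assumes "\<And>h. 0 \<le> h \<Longrightarrow> h \<le> 1 \<Longrightarrow> (g has_real_derivative g' h) (at h)"
    and "\<And>h. 0 \<le> h \<Longrightarrow> h \<le> 1 \<Longrightarrow> (g' has_real_derivative g'' h) (at h)"
    and "\<And>h. 0 \<le> h \<Longrightarrow> h \<le> 1 \<Longrightarrow> g'' h < 0" and "g' 0 = 0"
  shows "g 1 < g 0"
proof -
  have neg: "g' h < 0" if "0 < h" "h \<le> 1" for h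
    using DERIV_neg_imp_decreasing[of 0 h g'] assms that by (metis order_trans)
  obtain z where "0 < z" "z < 1" "g 1 - g 0 = (1 - 0) * g' z"
    using MVT2[of 0 1 g g'] assms(1) by auto
  then show ?thesis using neg[of z] by simp
qed

text \<open>The log-likelihood per observation, up to a constant, for sample mean \<open>x\<close>
  and second moment \<open>X\<close>. They are free arguments because tilting along the null line
  replaces the observed values by others.\<close>

definition objective :: "real^'p \<Rightarrow> real^'p^'p \<Rightarrow> 'p::finite canonical \<Rightarrow> real" where
  "objective x X \<phi> = xi_of \<phi> \<bullet> x - conc_of \<phi> \<bullet> X / 2 - cumulant \<phi>"

definition dobjective :: "real^'p \<Rightarrow> real^'p^'p \<Rightarrow> 'p::finite canonical \<Rightarrow> 'p canonical \<Rightarrow> real" where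
  "dobjective x X \<phi> v = xi_of v \<bullet> x - conc_of v \<bullet> X / 2 - dcumulant \<phi> v"

lemma DERIV_objective:
  assumes "\<phi> + h *\<^sub>R v \<in> mvn_params"
  shows "((\<lambda>h. objective x X (\<phi> + h *\<^sub>R v)) has_real_derivative dobjective x X (\<phi> + h *\<^sub>R v) v) (at h)"
  unfolding objective_def dobjective_def
  by (auto intro!: derivative_eq_intros DERIV_cumulant assms simp: inner_add_left)

lemma DERIV_dobjective:
  assumes "\<phi> + h *\<^sub>R v \<in> mvn_params"
  shows "((\<lambda>h. dobjective x X (\<phi> + h *\<^sub>R v) w) has_real_derivative - ddcumulant (\<phi> + h *\<^sub>R v) w v) (at h)"
  unfolding dobjective_def
  by (auto intro!: derivative_eq_intros DERIV_dcumulant assms)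

text \<open>Moment matching: the canonical parameter of the normal law with mean \<open>x\<close>
  and covariance \<open>W\<close>.\<close>

definition mvn_mle :: "real^'p \<Rightarrow> real^'p^'p \<Rightarrow> 'p::finite canonical" where
  "mvn_mle x W = pack (matrix_inv W *v x) (svec (matrix_inv W))"

lemma mvn_mle:
  fixes W :: "real^'p^'p"
  assumes W: "pos_def W"
  shows "mvn_mle x W \<in> mvn_params" "conc_of (mvn_mle x W) = matrix_inv W"
    "matrix_inv (conc_of (mvn_mle x W)) = W" "mean_of (mvn_mle x W) = x"
proof -
  have nz: "det W \<noteq> 0" using pos_def_det_pos[OF W] by simp
  have sym: "transpose W = W" using W by (simp add: pos_def_def)
  show c: "conc_of (mvn_mle x W) = matrix_inv W"
    by (simp add: mvn_mle_def smat_svec transpose_matrix_inv[OF nz sym])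
  then show "mvn_mle x W \<in> mvn_params" by (simp add: mvn_params_iff pos_def_inverse W)
  show i: "matrix_inv (conc_of (mvn_mle x W)) = W"
    unfolding c by (rule matrix_inv_unique_left) (rule matrix_inv_right[OF nz])
  show "mean_of (mvn_mle x W) = x"
    unfolding mean_of_def i by (simp add: mvn_mle_def matrix_vector_mul_assoc matrix_inv_right[OF nz])
qed

lemma dobjective_mvn_mle:
  assumes "pos_def (X - outer x)"
  shows "dobjective x X (mvn_mle x (X - outer x)) v = 0"
  using mvn_mle[OF assms]
  by (simp add: dobjective_def dcumulant_def inner_diff_left inner_outer[of "conc_of v" x] inner_commute[of _ "conc_of v"] inner_diff_right)

text \<open>On the segment from the estimate to \<theta>, which stays in the convex parameter set,
  the objective is strictly concave and stationary at its start.\<close>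

lemma objective_less_mle:
  assumes W: "pos_def (X - outer x)" and \<theta>: "\<theta> \<in> mvn_params" "\<theta> \<noteq> mvn_mle x (X - outer x)"
  shows "objective x X \<theta> < objective x X (mvn_mle x (X - outer x))"
proof -
  let ?\<phi> = "mvn_mle x (X - outer x)"
  let ?v = "\<theta> - ?\<phi>"
  have mem: "?\<phi> + h *\<^sub>R ?v \<in> mvn_params" if "0 \<le> h" "h \<le> 1" for h
  proof -
    have "(1 - h) *\<^sub>R ?\<phi> + h *\<^sub>R \<theta> \<in> mvn_params"
      using convexD[OF convex_mvn_params mvn_mle(1)[OF W] \<theta>(1), of "1 - h" h] that by simp
    then show ?thesis by (simp add: algebra_simps)
  qed
  have "objective x X (?\<phi> + 1 *\<^sub>R ?v) < objective x X (?\<phi> + 0 *\<^sub>R ?v)"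
  proof (rule strictly_concave_max)
    fix h :: real assume h: "0 \<le> h" "h \<le> 1"
    show "((\<lambda>h. objective x X (?\<phi> + h *\<^sub>R ?v)) has_real_derivative dobjective x X (?\<phi> + h *\<^sub>R ?v) ?v) (at h)"
      by (rule DERIV_objective[OF mem[OF h]])
    show "((\<lambda>h. dobjective x X (?\<phi> + h *\<^sub>R ?v) ?v) has_real_derivative - ddcumulant (?\<phi> + h *\<^sub>R ?v) ?v ?v) (at h)"
      by (rule DERIV_dobjective[OF mem[OF h]])
    show "- ddcumulant (?\<phi> + h *\<^sub>R ?v) ?v ?v < 0"
      using ddcumulant_pos[OF mem[OF h], of ?v] \<theta>(2) by simp
  qed (use dobjective_mvn_mle[OF W] in simp)
  then show ?thesis by simp
qed

text \<open>The parameter set is open, so a maximiser is stationary in every direction. Taking the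
  discrepancy of the means, then that of the second moments, as the direction yields its own squared
  norm; both vanish, and X - x x^T is the covariance of a member of the family.\<close>

lemma maximizer_imp_pos_def:
  assumes \<phi>: "\<phi> \<in> mvn_params" and max: "\<And>\<theta>. \<theta> \<in> mvn_params \<Longrightarrow> objective x X \<theta> \<le> objective x X \<phi>"
    and X: "transpose X = X"
  shows "pos_def (X - outer x)"
proof -
  let ?\<Sigma> = "matrix_inv (conc_of \<phi>)" and ?m = "mean_of \<phi>"
  have stat: "dobjective x X \<phi> v = 0" for v
  proof -
    have D: "((\<lambda>h. objective x X (\<phi> + h *\<^sub>R v)) has_real_derivative dobjective x X \<phi> v) (at 0)"
      using DERIV_objective[of \<phi> 0 v x X] \<phi> by simp
    have "open {h. \<phi> + h *\<^sub>R v \<in> mvn_params}" "0 \<in> {h. \<phi> + h *\<^sub>R v \<in> mvn_params}" using open_line \<phi> by auto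
    then obtain d where d: "d > 0" "ball 0 d \<subseteq> {h. \<phi> + h *\<^sub>R v \<in> mvn_params}"
      using open_contains_ball by blast
    show ?thesis
    proof (rule DERIV_local_max[OF D d(1)])
      show "\<forall>h. \<bar>0 - h\<bar> < d \<longrightarrow> objective x X (\<phi> + h *\<^sub>R v) \<le> objective x X (\<phi> + 0 *\<^sub>R v)"
        using d(2) max by (auto simp: dist_real_def)
    qed
  qed
  have "(x - ?m) \<bullet> (x - ?m) = 0"
    using stat[of "pack (x - ?m) 0"]
    by (simp add: dobjective_def dcumulant_def inner_diff_right)
  then have m: "?m = x" by simp
  define D where "D = ?\<Sigma> + outer x - X"
  have nz: "det (conc_of \<phi>) \<noteq> 0" using det_conc_pos[OF \<phi>] by simp
  have "transpose (A + B - C) = transpose A + transpose B - transpose C" for A B C :: "real^'a^'a"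
    by (simp add: transpose_def vec_eq_iff)
  then have "transpose D = D" by (simp add: D_def transpose_matrix_inv[OF nz] X)
  then have sm: "smat (svec D) = D" by (rule smat_svec)
  have "D \<bullet> X = D \<bullet> outer x + D \<bullet> ?\<Sigma>"
    using stat[of "pack 0 (svec D)"]
    by (simp add: dobjective_def dcumulant_def sm m inner_outer inner_commute)
  then have "D \<bullet> (?\<Sigma> + outer x - X) = 0" by (simp add: inner_diff_right inner_add_right)
  then have "D = 0" by (simp only: D_def[symmetric] inner_eq_zero_iff)
  then have "X - outer x = ?\<Sigma>" by (simp add: D_def algebra_simps)
  then show ?thesis using \<phi> by (simp add: mvn_params_iff pos_def_inverse)
qed

section \<open>The determinant of the Hessian\<close>

definition canonical_congruence :: "real^'p^'p \<Rightarrow> 'p::finite canonical \<Rightarrow> 'p canonical" where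
  "canonical_congruence A v = pack (A *v xi_of v) (scong A (sym_of v))"

lemma sym_of_add [simp]: "sym_of (v + w) = sym_of v + sym_of w"
  and sym_of_scaleR [simp]: "sym_of (c *\<^sub>R v) = c *\<^sub>R sym_of v"
  by (simp_all add: sym_of_def vec_eq_iff)

lemma pack_add: "pack (a + b) (s + t) = pack a s + pack b t"
  and pack_scaleR: "pack (c *\<^sub>R a) (c *\<^sub>R s) = c *\<^sub>R pack a s"
  by (simp_all add: vec_eq_iff pack_def split: sum.split)

lemma linear_canonical_congruence: "linear (canonical_congruence A)"
  by (intro linearI)
    (simp_all add: canonical_congruence_def matrix_vector_right_distrib matrix_vector_mult_scaleR
      linear_add[OF linear_scong] linear_cmul[OF linear_scong] pack_add pack_scaleR)

lemma diagonal_matrix_vector_nth: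
  fixes A :: "real^'n^'n"
  assumes "\<And>i j. i \<noteq> j \<Longrightarrow> A $ i $ j = 0"
  shows "(A *v x) $ i = A $ i $ i * x $ i"
proof -
  have "(\<Sum>j\<in>UNIV. A $ i $ j * x $ j) = (\<Sum>j\<in>UNIV. if j = i then A $ i $ i * x $ i else 0)"
    by (rule sum.cong) (use assms in auto)
  then show ?thesis by (simp add: matrix_vector_mult_def)
qed

lemma prod_sum_type:
  "(\<Prod>k\<in>(UNIV :: ('a::finite + 'b::finite) set). g k) = (\<Prod>i\<in>UNIV. g (Inl i)) * (\<Prod>j\<in>UNIV. g (Inr j))"
proof -
  have "prod g (Inl ` UNIV \<union> Inr ` UNIV) = prod g (range Inl) * prod g (range Inr)"
    by (rule prod.union_disjoint) auto
  then show ?thesis by (simp add: UNIV_sum prod.reindex)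
qed

text \<open>The symmetric component contributes the exponent p + 1, the vector component 1.\<close>

lemma abs_det_canonical_congruence:
  "\<bar>det (matrix (canonical_congruence (A :: real^'p^'p)))\<bar> = \<bar>det A\<bar> ^ (CARD('p) + 2)"
proof (rule det_matrix_action[where w = "\<lambda>a k. case k of Inl i \<Rightarrow> a i | Inr u \<Rightarrow> svec (\<chi> i j. a i * a j) $ u"])
  show "\<exists>k. \<forall>x. canonical_congruence A x $ k = 0" if "row i A = 0" for A :: "real^'p^'p" and i
    using that
    by (intro exI[of _ "Inl i"]) (simp add: canonical_congruence_def matrix_vector_mult_def row_def vec_eq_iff)
  show "canonical_congruence A x $ k = (case k of Inl i \<Rightarrow> A $ i $ i | Inr u \<Rightarrow> svec (\<chi> i j. A $ i $ i * A $ j $ j) $ u) * x $ k"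
    if "\<And>i j. i \<noteq> j \<Longrightarrow> A $ i $ j = 0" for A :: "real^'p^'p" and x k
    using that
    by (cases k) (simp_all add: canonical_congruence_def diagonal_matrix_vector_nth scong_diagonal xi_of_def sym_of_def)
  have "(\<Prod>u\<in>UNIV. \<bar>svec (\<chi> i j. a i * a j) $ u\<bar>) = \<bar>\<Prod>i\<in>UNIV. a i\<bar> ^ (CARD('p) + 1)" for a :: "'p \<Rightarrow> real"
    by (rule prod_uprod) (simp add: svec_nth transpose_def vec_eq_iff mult_ac)
  then show "(\<Prod>k\<in>UNIV. \<bar>case k of Inl i \<Rightarrow> a i | Inr u \<Rightarrow> svec (\<chi> i j. a i * a j) $ u\<bar>) = \<bar>\<Prod>i\<in>UNIV. a i\<bar> ^ (CARD('p) + 2)" for a :: "'p \<Rightarrow> real"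
    by (simp add: prod_sum_type abs_prod power_add)
  show "linear (canonical_congruence A)" for A :: "real^'p^'p" by (rule linear_canonical_congruence)
qed (simp_all add: canonical_congruence_def scong_mult matrix_vector_mul_assoc scong_def[of "mat 1"])

text \<open>The recentring of the mean direction in \<open>ddcumulant\<close>, separated off because
  it leaves determinants unchanged.\<close>

definition mean_shear :: "real^'p \<Rightarrow> 'p::finite canonical \<Rightarrow> 'p canonical" where
  "mean_shear m v = pack (xi_of v - conc_of v *v m) (sym_of v)"

lemma linear_mean_shear: "linear (mean_shear m)"
  by (intro linearI)
    (simp_all add: mean_shear_def matrix_vector_mult_add_rdistrib scaleR_matrix_vector_assoc[symmetric]
      scaleR_diff_right[symmetric] pack_scaleR add_diff_add pack_add)

text \<open>A shear is conjugate to its square by a dilation of the mean component, so its determinant is one.\<close>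

lemma det_mean_shear: "det (matrix (mean_shear m)) = 1"
proof -
  let ?D = "\<lambda>v. pack (2 *\<^sub>R xi_of v) (sym_of v) :: 'a canonical"
  let ?D' = "\<lambda>v. pack ((1/2) *\<^sub>R xi_of v) (sym_of v) :: 'a canonical"
  have lin: "linear ?D" "linear ?D'"
    by (intro linearI; simp add: pack_add[symmetric] pack_scaleR[symmetric] scaleR_add_right mult.commute)+
  let ?d = "\<lambda>f. det (matrix (f :: 'a canonical \<Rightarrow> 'a canonical))"
  have "conc_of (mean_shear k v) = conc_of v" for k and v :: "'a canonical"
    by (simp add: mean_shear_def conc_of_sym)
  then have "mean_shear m (mean_shear m (?D v)) = ?D (mean_shear m v)" for v
    by (simp add: mean_shear_def conc_of_sym scaleR_diff_right scaleR_2)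
  then have "?d (\<lambda>v. mean_shear m (mean_shear m (?D v))) = ?d (\<lambda>v. ?D (mean_shear m v))" by simp
  then have "?d (mean_shear m) * (?d (mean_shear m) * ?d ?D) = ?d ?D * ?d (mean_shear m)"
    using det_matrix_compose[OF linear_mean_shear linear_compose[OF lin(1) linear_mean_shear, unfolded o_def], of m m]
      det_matrix_compose[OF linear_mean_shear lin(1), of m]
      det_matrix_compose[OF lin(1) linear_mean_shear, of m] by simp
  moreover have "?d ?D \<noteq> 0"
  proof -
    have "(\<lambda>v. ?D' (?D v)) = id" by (simp add: fun_eq_iff)
    then have "?d (\<lambda>v. ?D' (?D v)) = 1" by simp
    then show ?thesis using det_matrix_compose[OF lin(2,1)] by auto
  qed
  moreover have "?d (mean_shear m) \<noteq> 0"
  proof -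
    have "(\<lambda>v. mean_shear (- m) (mean_shear m v)) = id"
      by (simp add: fun_eq_iff mean_shear_def conc_of_sym matrix_vector_mult_def vec_eq_iff sum_negf)
        (simp add: pack_def xi_of_def sym_of_def split: sum.split)
    then have "?d (\<lambda>v. mean_shear (- m) (mean_shear m v)) = 1" by simp
    then show ?thesis using det_matrix_compose[OF linear_mean_shear linear_mean_shear, of "- m" m] by auto
  qed
  ultimately show ?thesis by simp
qed

text \<open>The Hessian form at the null value, where the mean is 0 and the covariance is the
  identity.\<close>

definition standard_form :: "'p::finite canonical \<Rightarrow> 'p canonical \<Rightarrow> real" where
  "standard_form v w = xi_of v \<bullet> xi_of w + conc_of w \<bullet> conc_of v / 2"

definition standard_matrix :: "real ^ ('p::finite + 'p uprod) ^ ('p + 'p uprod)" where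
  "standard_matrix = (\<chi> j k. standard_form (axis j 1) (axis k 1))"

lemma linear_axis_expansion:
  fixes g :: "real^'k \<Rightarrow> real"
  assumes "linear g"
  shows "g v = (\<Sum>k\<in>UNIV. v $ k * g (axis k 1))"
proof -
  have "g v = g (\<Sum>k\<in>UNIV. v $ k *\<^sub>R axis k 1)"
    by (simp add: basis_expansion flip: scalar_mult_eq_scaleR)
  then show ?thesis by (simp add: linear_sum[OF assms] linear_cmul[OF assms])
qed

lemma linear_standard_form: "linear (\<lambda>v. standard_form v w)" "linear (standard_form v)"
  by (intro linearI; simp add: standard_form_def inner_add_left inner_add_right algebra_simps add_divide_distrib)+

lemma standard_form_matrix: "standard_form v w = v \<bullet> (standard_matrix *v w)"
proof -
  have "standard_form v w = (\<Sum>j\<in>UNIV. v $ j * standard_form (axis j 1) w)"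
    by (rule linear_axis_expansion[OF linear_standard_form(1)])
  also have "\<dots> = (\<Sum>j\<in>UNIV. v $ j * (\<Sum>k\<in>UNIV. w $ k * standard_form (axis j 1) (axis k 1)))"
    by (intro sum.cong refl arg_cong[where f = "(*) _"] linear_axis_expansion[OF linear_standard_form(2)])
  finally show ?thesis
    by (simp add: inner_vec_def matrix_vector_mult_def standard_matrix_def mult.commute)
qed

text \<open>The form is symmetric and positive definite. Its determinant is a factor common to all
  t, so its sign is all that the p-value depends on.\<close>

lemma det_standard_matrix: "det (standard_matrix :: real ^ ('p::finite + 'p uprod) ^ _) > 0"
proof -
  have sym: "standard_form v w = standard_form w v" for v w :: "'p canonical"
    by (simp add: standard_form_def inner_commute)
  have "transpose (standard_matrix :: real ^ ('p::finite + 'p uprod) ^ _) = standard_matrix"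
    unfolding standard_matrix_def transpose_def vec_eq_iff by (simp only: vec_lambda_beta) (blast intro: sym)
  moreover have "v \<bullet> (standard_matrix *v v) > 0" if "v \<noteq> 0" for v :: "'p canonical"
  proof -
    have "xi_of v \<noteq> 0 \<or> conc_of v \<noteq> 0" using canonical_eq_0 that by blast
    then have "xi_of v \<bullet> xi_of v + conc_of v \<bullet> conc_of v / 2 > 0"
      by (auto intro: add_pos_nonneg add_nonneg_pos)
    then show ?thesis by (simp add: standard_form_matrix[symmetric] standard_form_def)
  qed
  ultimately show ?thesis by (intro pos_def_det_pos) (simp add: pos_def_def)
qed

lemma matrix_apply_linear: "linear g \<Longrightarrow> matrix g *v x = g (x :: real^'k)" for g :: "real^'k \<Rightarrow> real^'m"
  by (simp add: matrix_works)

text \<open>The Hessian matrix is M^T Q M, with Q the one at the null value and M a shear followed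
  by congruence with B^T. Squaring |det M| = |det B|^(p + 2) gives the power p + 2 of the
  determinant of the covariance.\<close>

lemma det_ddcumulant:
  fixes \<phi> :: "'p::finite canonical"
  assumes "\<phi> \<in> mvn_params"
  shows "det (\<chi> j k. ddcumulant \<phi> (axis k 1) (axis j 1))
    = det (standard_matrix :: real ^ ('p + 'p uprod) ^ _) * det (matrix_inv (conc_of \<phi>)) ^ (CARD('p) + 2)"
proof -
  have "pos_def (matrix_inv (conc_of \<phi>))" using assms by (simp add: mvn_params_iff pos_def_inverse)
  then obtain B where B: "det B \<noteq> 0" "matrix_inv (conc_of \<phi>) = congruence B (mat 1)" by (rule pos_def_factor)
  let ?L = "\<lambda>v. canonical_congruence (transpose B) (mean_shear (mean_of \<phi>) v)"
  let ?M = "matrix ?L"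
  have linL: "linear ?L"
    using linear_compose[OF linear_mean_shear linear_canonical_congruence] by (simp add: o_def)
  have app: "?M *v v = ?L v" for v using linL by (rule matrix_apply_linear)
  have "ddcumulant \<phi> v w = standard_form (?L v) (?L w)" for v w
    by (simp add: ddcumulant_factor[OF B(2)] standard_form_def canonical_congruence_def mean_shear_def
        smat_scong conc_of_sym)
  then have dd: "ddcumulant \<phi> v w = (?M *v v) \<bullet> (standard_matrix *v (?M *v w))" for v w
    by (simp only: standard_form_matrix app)
  have "ddcumulant \<phi> (axis k 1) (axis j 1) = (transpose ?M ** standard_matrix ** ?M) $ k $ j" for j k
  proof -
    have "(?M *v axis k 1) \<bullet> (standard_matrix *v (?M *v axis j 1)) = axis k 1 \<bullet> (transpose ?M *v (standard_matrix *v (?M *v axis j 1)))"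
      by (simp only: inner_matrix_transpose[of "axis k 1" "transpose ?M"] transpose_transpose)
    also have "\<dots> = axis k 1 \<bullet> ((transpose ?M ** standard_matrix ** ?M) *v axis j 1)"
      by (simp only: matrix_vector_mul_assoc matrix_mul_assoc)
    also have "\<dots> = (transpose ?M ** standard_matrix ** ?M) $ k $ j"
      by (simp only: inner_axis' matrix_vector_mul_component inner_axis mult_1 mult_1_right inner_real_def)
    finally show ?thesis by (simp only: dd)
  qed
  then have "(\<chi> j k. ddcumulant \<phi> (axis k 1) (axis j 1)) = transpose (transpose ?M ** standard_matrix ** ?M)"
    unfolding transpose_def[of "transpose ?M ** standard_matrix ** ?M"] by (simp only:)
  then have "det (\<chi> j k. ddcumulant \<phi> (axis k 1) (axis j 1)) = det ?M * det (standard_matrix :: real ^ ('p + 'p uprod) ^ _) * det ?M"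
    by (simp only: det_transpose det_mul)
  moreover have "(det ?M)\<^sup>2 = det (matrix_inv (conc_of \<phi>)) ^ (CARD('p) + 2)"
  proof -
    have "\<bar>det ?M\<bar> = \<bar>det B\<bar> ^ (CARD('p) + 2)"
      by (simp only: det_matrix_compose[OF linear_canonical_congruence linear_mean_shear] det_mean_shear
          mult_1_right abs_det_canonical_congruence det_transpose)
    then have "\<bar>det ?M\<bar>\<^sup>2 = (\<bar>det B\<bar>\<^sup>2) ^ (CARD('p) + 2)"
      by (simp only: power_mult[symmetric] mult.commute)
    moreover have "(det B)\<^sup>2 = det (matrix_inv (conc_of \<phi>))" by (simp add: B(2) det_congruence)
    ultimately show ?thesis by (simp only: power2_abs)
  qed
  ultimately show ?thesis by (simp only: power2_eq_square mult_ac)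
qed

lemma det_scaleR: "det (r *\<^sub>R M) = r ^ CARD('k) * det M" for M :: "real^'k^'k"
proof -
  have "r *\<^sub>R M = mat r ** M"
    by (simp add: matrix_eq mat_mult_vector scaleR_matrix_vector_assoc[symmetric] flip: matrix_vector_mul_assoc)
  then show ?thesis by (metis det_mul det_matrix_scaleR matrix_scaleR)
qed

section \<open>The saddlepoint density on the null line\<close>

text \<open>The second moment along the null line: the identity at t = 0, the observed one at t =
  1.\<close>

definition obs_line :: "real \<Rightarrow> real^'p^'p \<Rightarrow> real^'p^'p::finite" where
  "obs_line t S = mat 1 + t *\<^sub>R (S - mat 1)"

lemma mvn_loglik_eq:
  assumes "\<phi> \<in> mvn_params" "n > 0"
  shows "mvn_loglik n y \<phi> = - (real n * real CARD('p) / 2 * ln (2 * pi))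
    + real n * objective (smean n y) (smom n y) (\<phi> :: 'p::finite canonical)"
proof -
  let ?\<Lambda> = "conc_of \<phi>" and ?m = "mean_of \<phi>" and ?\<xi> = "xi_of \<phi>"
  have pos: "det ?\<Lambda> > 0" using assms(1) by (rule det_conc_pos)
  have Lm: "?\<Lambda> *v ?m = ?\<xi>"
    using matrix_inv_right(1)[of ?\<Lambda>] pos by (simp add: mean_of_def matrix_vector_mul_assoc)
  have dens: "ln (mvn_density ?m ?\<Lambda> x) = ln (det ?\<Lambda>) / 2 - real CARD('p) / 2 * ln (2 * pi)
      - (?\<Lambda> \<bullet> outer x - 2 * (?\<xi> \<bullet> x) + ?\<xi> \<bullet> ?m) / 2" for x
  proof -
    have "(x - ?m) \<bullet> (?\<Lambda> *v (x - ?m)) = x \<bullet> (?\<Lambda> *v x) - x \<bullet> ?\<xi> - (?m \<bullet> (?\<Lambda> *v x) - ?m \<bullet> ?\<xi>)"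
      by (simp add: matrix_vector_mult_diff_distrib inner_diff_left inner_diff_right Lm)
    also have "?m \<bullet> (?\<Lambda> *v x) = ?\<xi> \<bullet> x"
      using inner_symmetric_swap[of ?\<Lambda> ?m x] by (simp add: Lm)
    finally have q: "(x - ?m) \<bullet> (?\<Lambda> *v (x - ?m)) = ?\<Lambda> \<bullet> outer x - 2 * (?\<xi> \<bullet> x) + ?\<xi> \<bullet> ?m"
      by (simp add: inner_outer inner_commute)
    have gen: "ln (sqrt (d / c ^ k)) = ln d / 2 - real k / 2 * ln c" if "d > 0" "c > 0" for d c :: real and k
      using that by (simp add: ln_sqrt ln_div ln_realpow field_simps)
    have e: "ln (sqrt (det ?\<Lambda> / (2 * pi) ^ CARD('p))) = ln (det ?\<Lambda>) / 2 - real CARD('p) / 2 * ln (2 * pi)"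
      by (rule gen) (use pos in simp_all)
    have "ln (a * exp b) = ln a + b" if "a > 0" for a b :: real using that by (simp add: ln_mult)
    from this[of "sqrt (det ?\<Lambda> / (2 * pi) ^ CARD('p))"]
    have "ln (sqrt (det ?\<Lambda> / (2 * pi) ^ CARD('p)) * exp b) = ln (det ?\<Lambda>) / 2 - real CARD('p) / 2 * ln (2 * pi) + b" for b
      using pos by (simp only: e) simp
    then show ?thesis unfolding mvn_density_def q by (simp only:)
  qed
  have s1: "(\<Sum>i=1..n. ?\<Lambda> \<bullet> outer (y i)) = real n * (?\<Lambda> \<bullet> smom n y)"
    using assms(2) by (simp add: smom_def inner_sum_right)
  have s2: "(\<Sum>i=1..n. ?\<xi> \<bullet> y i) = real n * (?\<xi> \<bullet> smean n y)"
    using assms(2) by (simp add: smean_def inner_sum_right)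
  have "mvn_loglik n y \<phi> = real n * (ln (det ?\<Lambda>) / 2 - real CARD('p) / 2 * ln (2 * pi))
      - ((\<Sum>i=1..n. ?\<Lambda> \<bullet> outer (y i)) - 2 * (\<Sum>i=1..n. ?\<xi> \<bullet> y i) + real n * (?\<xi> \<bullet> ?m)) / 2"
    unfolding mvn_loglik_def dens
    by (simp add: sum.distrib sum_subtractf sum_divide_distrib[symmetric] sum_distrib_left[symmetric])
  then show ?thesis
    unfolding s1 s2 objective_def cumulant_def by (simp add: field_simps)
qed

definition null_value :: "'p::finite canonical" where
  "null_value = pack 0 (svec (mat 1))"

lemma null_value: "conc_of null_value = mat 1" "xi_of null_value = 0" "mean_of null_value = 0"
  "null_value \<in> mvn_params"
proof -
  show c: "conc_of null_value = mat 1" and x: "xi_of null_value = 0"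
    by (simp_all add: null_value_def smat_svec transpose_mat)
  show "mean_of null_value = 0" by (simp add: mean_of_def x)
  show "null_value \<in> mvn_params" by (simp add: mvn_params_iff c pos_def_one)
qed

lemma mvn_null_params_eq: "mvn_null_params = {null_value :: 'p::finite canonical}"
proof -
  have "\<phi> = null_value" if "mean_of \<phi> = 0" "conc_of \<phi> = mat 1" for \<phi> :: "'p canonical"
  proof -
    have "matrix_inv (mat 1) = (mat 1 :: real^'p^'p)" by (rule matrix_inv_unique_left) simp
    then have "xi_of \<phi> = 0" using that by (simp add: mean_of_def)
    moreover have "sym_of \<phi> = svec (conc_of \<phi>)" by (simp add: conc_of_sym)
    ultimately show ?thesis using pack_xi_sym[of \<phi>] that by (simp add: null_value_def)
  qed
  then show ?thesis using null_value by (auto simp: mvn_null_params_def)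
qed

lemma eventually_line:
  assumes "\<phi> \<in> mvn_params"
  shows "eventually (\<lambda>h. \<phi> + h *\<^sub>R v \<in> mvn_params) (nhds (0::real))"
  using eventually_nhds_in_open[OF open_line, of 0 \<phi> v] assms by simp

context
  fixes n :: nat and y :: "nat \<Rightarrow> real^'p::finite"
  assumes n: "n > 0"
begin

private abbreviation "l0 \<equiv> mvn_loglik n y :: 'p canonical \<Rightarrow> real"
private abbreviation "m \<equiv> smean n y"
private abbreviation "S \<equiv> smom n y"
private abbreviation "T t \<equiv> tilted_loglik l0 (null_line l0 null_value t)"

text \<open>The formula for \<open>f\<close> is available on the parameter set only; as this set is
  open, agreement near \<phi> is enough for derivatives.\<close>

lemma partial_deriv_objective:
  fixes f :: "'p canonical \<Rightarrow> real"
  assumes f: "\<And>\<theta>. \<theta> \<in> mvn_params \<Longrightarrow> f \<theta> = c + real n * objective x X \<theta>" and \<phi>: "\<phi> \<in> mvn_params"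
  shows "partial_deriv k f \<phi> = real n * dobjective x X \<phi> (axis k 1)"
proof -
  have D: "((\<lambda>h. c + real n * objective x X (\<phi> + h *\<^sub>R axis k 1)) has_real_derivative real n * dobjective x X \<phi> (axis k 1)) (at 0)"
    using DERIV_objective[of \<phi> 0 "axis k 1" x X] \<phi> by (auto intro!: derivative_eq_intros)
  have ev: "eventually (\<lambda>h. f (\<phi> + h *\<^sub>R axis k 1) = c + real n * objective x X (\<phi> + h *\<^sub>R axis k 1)) (nhds 0)"
    using eventually_line[OF \<phi>] by eventually_elim (rule f)
  have "((\<lambda>h. f (\<phi> + h *\<^sub>R axis k 1)) has_real_derivative real n * dobjective x X \<phi> (axis k 1)) (at 0)"
    by (rule iffD2[OF DERIV_cong_ev[OF refl ev refl] D])
  then show ?thesis unfolding partial_deriv_def by (rule DERIV_imp_deriv)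
qed

lemma hessian_objective:
  fixes f :: "'p canonical \<Rightarrow> real"
  assumes f: "\<And>\<theta>. \<theta> \<in> mvn_params \<Longrightarrow> f \<theta> = c + real n * objective x X \<theta>" and \<phi>: "\<phi> \<in> mvn_params"
  shows "- hessian f \<phi> = real n *\<^sub>R (\<chi> j k. ddcumulant \<phi> (axis k 1) (axis j 1))"
proof -
  have "partial_deriv j (partial_deriv k f) \<phi> = - real n * ddcumulant \<phi> (axis k 1) (axis j 1)" for j k
  proof -
    have D: "((\<lambda>h. real n * dobjective x X (\<phi> + h *\<^sub>R axis j 1) (axis k 1)) has_real_derivative
        real n * - ddcumulant \<phi> (axis k 1) (axis j 1)) (at 0)"
      using DERIV_dobjective[of \<phi> 0 "axis j 1" x X "axis k 1"] \<phi> by (intro DERIV_cmult) simp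
    have ev: "eventually (\<lambda>h. partial_deriv k f (\<phi> + h *\<^sub>R axis j 1) = real n * dobjective x X (\<phi> + h *\<^sub>R axis j 1) (axis k 1)) (nhds 0)"
      using eventually_line[OF \<phi>] by eventually_elim (rule partial_deriv_objective[OF f])
    have "((\<lambda>h. partial_deriv k f (\<phi> + h *\<^sub>R axis j 1)) has_real_derivative
        real n * - ddcumulant \<phi> (axis k 1) (axis j 1)) (at 0)"
      by (rule iffD2[OF DERIV_cong_ev[OF refl ev refl] D])
    then show ?thesis unfolding partial_deriv_def[of j] by (simp add: DERIV_imp_deriv)
  qed
  then show ?thesis by (simp add: hessian_def vec_eq_iff)
qed

text \<open>The gradient at the null value is n times the displacement of the sufficient statistic
  from its null value, so the tilt moves mean and second moment linearly towards 0 and the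
  identity.\<close>

lemma tilted_null_line:
  assumes \<phi>: "\<phi> \<in> mvn_params"
  shows "T t \<phi> = - (real n * real CARD('p) / 2 * ln (2 * pi)) + real n * objective (t *\<^sub>R m) (obs_line t S) \<phi>"
proof -
  have grad: "gradient l0 null_value $ k = real n * dobjective m S null_value (axis k 1)" for k
    unfolding gradient_def using partial_deriv_objective[OF mvn_loglik_eq[OF _ n] null_value(4)] by simp
  have inv1: "matrix_inv (mat 1) = (mat 1 :: real^'p^'p)" by (rule matrix_inv_unique_left) simp
  have dob: "dobjective m S null_value v = xi_of v \<bullet> m - conc_of v \<bullet> (S - mat 1) / 2" for v
    by (simp add: dobjective_def dcumulant_def null_value inv1 inner_diff_right inner_commute diff_divide_distrib)
  have lin: "linear (\<lambda>v. dobjective m S null_value v)"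
    unfolding dob by (intro linearI) (simp_all add: inner_add_left add_divide_distrib right_diff_distrib)
  have "\<phi> \<bullet> gradient l0 null_value = real n * dobjective m S null_value \<phi>"
    unfolding linear_axis_expansion[OF lin, of \<phi>]
    by (simp add: inner_vec_def grad sum_distrib_left mult_ac)
  then have P: "\<phi> \<bullet> null_line l0 null_value t = - ((1 - t) * (real n * (xi_of \<phi> \<bullet> m - conc_of \<phi> \<bullet> (S - mat 1) / 2)))"
    by (simp add: null_line_def dob)
  have Q: "conc_of \<phi> \<bullet> obs_line t S = conc_of \<phi> \<bullet> S - (1 - t) * (conc_of \<phi> \<bullet> (S - mat 1))"
    by (simp add: obs_line_def inner_add_right inner_diff_right algebra_simps)
  have "- ((1 - t) * (N * (a - e / 2))) + (K + N * (a - b / 2 - u)) = K + N * (t * a - (b - (1 - t) * e) / 2 - u)"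
    for N a e K b u :: real by (simp add: field_simps)
  then show ?thesis
    by (simp only: tilted_loglik_def mvn_loglik_eq[OF \<phi> n] objective_def P Q inner_scaleR_right)
qed

private abbreviation "W t \<equiv> obs_line t S - outer (t *\<^sub>R m)"

text \<open>Sufficiency comes from the explicit maximiser, necessity from
  \<open>maximizer_imp_pos_def\<close>: outside the cone no maximum is attained.\<close>

lemma mle_exists_iff: "mle_exists mvn_params l0 (null_line l0 null_value t) \<longleftrightarrow> pos_def (W t)"
proof
  assume "mle_exists mvn_params l0 (null_line l0 null_value t)"
  then obtain \<phi> where \<phi>: "is_arg_max (T t) (\<lambda>\<phi>. \<phi> \<in> mvn_params) \<phi>" by (auto simp: mle_exists_def)
  then have mem: "\<phi> \<in> mvn_params" and "\<not> (\<exists>\<theta>. \<theta> \<in> mvn_params \<and> T t \<theta> > T t \<phi>)" by (auto simp: is_arg_max_def)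
  then have "objective (t *\<^sub>R m) (obs_line t S) \<theta> \<le> objective (t *\<^sub>R m) (obs_line t S) \<phi>" if "\<theta> \<in> mvn_params" for \<theta>
    using that n tilted_null_line[OF mem, of t] tilted_null_line[OF that, of t] by (auto simp: not_less)
  moreover have "transpose (obs_line t S) = obs_line t S"
  proof -
    have "transpose (A + t *\<^sub>R (B - A)) = transpose A + t *\<^sub>R (transpose B - transpose A)" for A B :: "real^'p^'p"
      by (simp add: transpose_def vec_eq_iff)
    then show ?thesis by (simp add: obs_line_def transpose_mat)
  qed
  ultimately show "pos_def (W t)" by (intro maximizer_imp_pos_def[OF mem])
next
  assume W: "pos_def (W t)"
  have "\<not> T t \<theta> > T t (mvn_mle (t *\<^sub>R m) (W t))" if "\<theta> \<in> mvn_params" for \<theta>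
    using objective_less_mle[OF W that] n
    by (cases "\<theta> = mvn_mle (t *\<^sub>R m) (W t)") (simp_all add: tilted_null_line mvn_mle(1)[OF W] that)
  then show "mle_exists mvn_params l0 (null_line l0 null_value t)"
    using mvn_mle(1)[OF W] by (auto simp: mle_exists_def is_arg_max_def)
qed

lemma mle_eq:
  assumes W: "pos_def (W t)"
  shows "mle mvn_params l0 (null_line l0 null_value t) = mvn_mle (t *\<^sub>R m) (W t)"
  unfolding mle_def arg_max_on_def arg_max_def
proof (rule some_equality)
  have less: "T t \<theta> < T t (mvn_mle (t *\<^sub>R m) (W t))" if "\<theta> \<in> mvn_params" "\<theta> \<noteq> mvn_mle (t *\<^sub>R m) (W t)" for \<theta>
    using objective_less_mle[OF W that] n by (simp add: tilted_null_line mvn_mle(1)[OF W] that)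
  then show "is_arg_max (T t) (\<lambda>\<phi>. \<phi> \<in> mvn_params) (mvn_mle (t *\<^sub>R m) (W t))"
    using mvn_mle(1)[OF W] by (auto simp: is_arg_max_def) (metis less_asym less_irrefl)
  show "\<phi> = mvn_mle (t *\<^sub>R m) (W t)" if "is_arg_max (T t) (\<lambda>\<phi>. \<phi> \<in> mvn_params) \<phi>" for \<phi>
    using that less mvn_mle(1)[OF W] by (auto simp: is_arg_max_def)
qed

lemma trace_inner: "mat 1 \<bullet> (A :: real^'p^'p) = trace A"
  using matrix_inner_trace[of "mat 1" A] by (simp add: transpose_mat)

text \<open>The likelihood ratio contributes det (W t) to the power n/2, the curvature the power -(p
  + 2)/2. Quantifying \<open>C\<close> before t records that the remaining factor is constant along
  the line.\<close>

lemma saddlepoint_eq: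
  "\<exists>C>0. \<forall>t. saddlepoint c mvn_params l0 null_value (null_line l0 null_value t)
    = (if pos_def (W t) then c * (C * (det (W t) powr ((real n - real CARD('p) - 2) / 2) *
        exp (- (real n / 2) * trace (obs_line t S)))) else 0)"
proof -
  let ?J = "real n ^ CARD('p + 'p uprod) * det (standard_matrix :: real ^ ('p + 'p uprod) ^ _)"
  let ?C = "exp (real n * real CARD('p) / 2) * ?J powr (- 1 / 2)"
  have J: "?J > 0" using det_standard_matrix n by (intro mult_pos_pos zero_less_power) simp_all
  have "saddlepoint c mvn_params l0 null_value (null_line l0 null_value t)
      = c * (?C * (det (W t) powr ((real n - real CARD('p) - 2) / 2) * exp (- (real n / 2) * trace (obs_line t S))))"
    if W: "pos_def (W t)" for t
  proof -
    let ?\<phi> = "mvn_mle (t *\<^sub>R m) (W t)"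
    have dW: "det (W t) > 0" using W by (rule pos_def_det_pos)
    have 1: "T t null_value = - (real n * real CARD('p) / 2 * ln (2 * pi)) - real n / 2 * trace (obs_line t S)"
      by (simp add: tilted_null_line null_value objective_def cumulant_def trace_inner)
    have "conc_of ?\<phi> \<bullet> obs_line t S = conc_of ?\<phi> \<bullet> W t + (t *\<^sub>R m) \<bullet> (conc_of ?\<phi> *v (t *\<^sub>R m))"
      unfolding inner_outer[symmetric] by (simp flip: inner_add_right)
    also have "conc_of ?\<phi> \<bullet> W t = real CARD('p)"
    proof -
      have "conc_of ?\<phi> \<bullet> W t = trace (matrix_inv (W t) ** W t)"
      proof -
        have "conc_of ?\<phi> \<bullet> W t = trace (conc_of ?\<phi> ** W t)"
          using matrix_inner_trace[of "conc_of ?\<phi>" "W t"] by (simp only: transpose_conc_of)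
        then show ?thesis by (simp only: mvn_mle(2)[OF W])
      qed
      then show ?thesis using dW by (simp add: matrix_inv_right trace_I)
    qed
    also have "conc_of ?\<phi> *v (t *\<^sub>R m) = xi_of ?\<phi>"
      unfolding mvn_mle(2)[OF W] by (simp add: mvn_mle_def)
    finally have q: "conc_of ?\<phi> \<bullet> obs_line t S = real CARD('p) + (t *\<^sub>R m) \<bullet> xi_of ?\<phi>" .
    have "objective (t *\<^sub>R m) (obs_line t S) ?\<phi> = xi_of ?\<phi> \<bullet> (t *\<^sub>R m) - (real CARD('p) + (t *\<^sub>R m) \<bullet> xi_of ?\<phi>) / 2
        - (xi_of ?\<phi> \<bullet> (t *\<^sub>R m) - ln (inverse (det (W t)))) / 2"
      unfolding objective_def cumulant_def unfolding q mvn_mle(4)[OF W] unfolding mvn_mle(2)[OF W] using dW by (simp add: det_matrix_inv)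
    also have "ln (inverse (det (W t))) = - ln (det (W t))" using dW by (simp add: ln_inverse)
    finally have o: "objective (t *\<^sub>R m) (obs_line t S) ?\<phi> = - (real CARD('p) / 2) - ln (det (W t)) / 2"
      by (simp add: inner_commute field_simps)
    have 2: "T t ?\<phi> = - (real n * real CARD('p) / 2 * ln (2 * pi)) - real n * real CARD('p) / 2 - real n / 2 * ln (det (W t))"
      unfolding tilted_null_line[OF mvn_mle(1)[OF W]] o by (simp add: field_simps)
    have "obs_information l0 (null_line l0 null_value t) ?\<phi> = real n *\<^sub>R (\<chi> j k. ddcumulant ?\<phi> (axis k 1) (axis j 1))"
      unfolding obs_information_def by (rule hessian_objective[OF tilted_null_line mvn_mle(1)[OF W]])
    then have "det (obs_information l0 (null_line l0 null_value t) ?\<phi>)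
      = real n ^ CARD('p + 'p uprod) * det (\<chi> j k. ddcumulant ?\<phi> (axis k 1) (axis j 1))"
      by (simp only: det_scaleR)
    then have det: "det (obs_information l0 (null_line l0 null_value t) ?\<phi>) = ?J * det (W t) ^ (CARD('p) + 2)"
      by (simp only: det_ddcumulant[OF mvn_mle(1)[OF W]] mvn_mle(3)[OF W] mult.assoc)
    have "exp (T t null_value - T t ?\<phi>) = exp (real n * real CARD('p) / 2) * (exp (- (real n / 2) * trace (obs_line t S)) * det (W t) powr (real n / 2))"
      unfolding 1 2 using dW by (simp add: powr_def flip: exp_add)
    moreover have "(?J * det (W t) ^ (CARD('p) + 2)) powr (- 1 / 2) = ?J powr (- 1 / 2) * det (W t) powr (- (real CARD('p) + 2) / 2)"
    proof -
      have "det (W t) ^ (CARD('p) + 2) = det (W t) powr real (CARD('p) + 2)"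
        by (rule powr_realpow[symmetric, OF dW])
      also have "real (CARD('p) + 2) = real CARD('p) + 2" by simp
      finally have "det (W t) ^ (CARD('p) + 2) = det (W t) powr (real CARD('p) + 2)" .
      then have "(det (W t) ^ (CARD('p) + 2)) powr (- 1 / 2) = det (W t) powr (- (real CARD('p) + 2) / 2)"
        by (simp only: powr_powr) (simp add: diff_divide_distrib add_divide_distrib)
      then show ?thesis using J dW by (simp only: powr_mult)
    qed
    moreover have "det (W t) powr (real n / 2) * det (W t) powr (- (real CARD('p) + 2) / 2) = det (W t) powr ((real n - real CARD('p) - 2) / 2)"
    proof -
      have "real n / 2 + - (real CARD('p) + 2) / 2 = (real n - real CARD('p) - 2) / 2" by (simp add: field_simps)
      then show ?thesis by (simp only: powr_add[symmetric])
    qed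
    moreover have "saddlepoint c mvn_params l0 null_value (null_line l0 null_value t)
      = c * exp (T t null_value - T t ?\<phi>) * det (obs_information l0 (null_line l0 null_value t) ?\<phi>) powr (- 1 / 2)"
      using W by (simp add: saddlepoint_def mle_exists_iff mle_eq)
    ultimately show ?thesis unfolding det by (simp only: mult_ac)
  qed
  moreover have "saddlepoint c mvn_params l0 null_value (null_line l0 null_value t) = 0" if "\<not> pos_def (W t)" for t
    using that by (simp add: saddlepoint_def mle_exists_iff)
  moreover have "?C > 0"
  proof -
    have "?J powr (- 1 / 2) > 0" using J by (simp only: powr_gt_zero)
    then show ?thesis by (rule mult_pos_pos[OF exp_gt_zero])
  qed
  ultimately show ?thesis by (intro exI[of _ ?C]) auto
qed

end

section \<open>The distribution of the directional p-value\<close>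

text \<open>The expectation of the sufficient statistic under the null hypothesis; subtracting it
  turns the null line into a ray from the origin.\<close>

definition null_point :: "(real^'p) \<times> (real^('p::finite uprod))" where
  "null_point = (0, svec (mat 1))"

text \<open>For a suitable \<open>K\<close> this is the density of the centred sufficient statistic
  under the null hypothesis. \<open>K\<close> is left free because \<open>ray_tail\<close> is
  unaffected by positive constant factors.\<close>

definition null_density :: "nat \<Rightarrow> real \<Rightarrow> (real^'p) \<times> (real^('p::finite uprod)) \<Rightarrow> real" where
  "null_density n K z = K * mdens ((real n - real CARD('p) - 2) / 2) (null_point + z) *
     exp (- (real n / 2) * trace (smat (snd (null_point + z))))"

lemma measurable_trace [measurable]: "(\<lambda>A :: real^'n^'n. trace A) \<in> borel_measurable borel"
  unfolding trace_def by (intro borel_measurable_continuous_onI continuous_intros)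

lemma measurable_null_density [measurable]: "null_density n K \<in> borel_measurable borel"
  unfolding null_density_def by measurable

lemma mdens_nonneg [simp]: "mdens e x \<ge> 0"
  by (simp add: mdens_def)

text \<open>The covariance at the point t z of the ray, quadratic in t since the mean enters through
  its outer product.\<close>

definition ray_cov :: "(real^'p) \<times> (real^('p::finite uprod)) \<Rightarrow> real \<Rightarrow> real^('p uprod)" where
  "ray_cov z t = svec (mat 1) + t *\<^sub>R snd z - svec (outer (t *\<^sub>R fst z))"

lemma null_density_ray:
  fixes z :: "(real^'p) \<times> (real^('p::finite uprod))"
  shows "null_density n K (t *\<^sub>R z) = K * wdens ((real n - real CARD('p) - 2) / 2) (ray_cov z t) *
     exp (- (real n / 2) * trace (smat (svec (mat 1) + t *\<^sub>R snd z)))"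
  by (simp add: null_density_def mdens_def null_point_def ray_cov_def)

lemma continuous_ray_cov: "continuous_on X (ray_cov z)"
  unfolding ray_cov_def by (intro continuous_intros)

lemma open_ray_cov: "open {t. pos_def (smat (ray_cov z t))}"
  using open_vimage[OF open_pos_def_smat continuous_ray_cov[of UNIV z]] by (simp add: vimage_def)

lemma ray_cov_0: "pos_def (smat (ray_cov z 0))"
proof -
  have "outer (0 :: real^'a) = 0" by (simp add: vec_eq_iff)
  then have "ray_cov z 0 = svec (mat 1)" by (simp add: ray_cov_def linear_0[OF linear_svec])
  then show ?thesis using pos_def_one by (simp add: smat_svec transpose_mat)
qed

lemma smat_add: "smat (v + w) = smat v + smat w"
  and smat_diff: "smat (v - w) = smat v - smat w"
  and smat_scaleR: "smat (c *\<^sub>R v) = c *\<^sub>R smat v"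
  by (simp_all add: vec_eq_iff)

lemma smat_ray_cov: "smat (ray_cov z t) = mat 1 + t *\<^sub>R smat (snd z) - outer (t *\<^sub>R fst z)"
  by (simp add: ray_cov_def smat_add smat_diff smat_scaleR smat_svec transpose_mat)

text \<open>Test the matrix on its own mean direction m. With a = |m|^2 and q the value of the form
  of \<open>snd z\<close> at m, the result is a + t q - t^2 a^2, which is negative for large
  t.\<close>

lemma ray_cov_bounded_support:
  fixes z :: "(real^'p) \<times> (real^('p::finite uprod))"
  assumes "fst z \<noteq> 0"
  obtains T where "T \<ge> 0" "\<And>t. t > T \<Longrightarrow> \<not> pos_def (smat (ray_cov z t))"
proof -
  let ?m = "fst z"
  let ?q = "?m \<bullet> (smat (snd z) *v ?m)" and ?a = "?m \<bullet> ?m"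
  \<comment> \<open>For t >= 1 positivity of the form forces t^2 a^2 < t (a + |q|), which gives this
    bound.\<close>
  let ?T = "max 1 ((?a + \<bar>?q\<bar>) / ?a\<^sup>2)"
  have a: "?a > 0" using assms by simp
  have "\<not> pos_def (smat (ray_cov z t))" if t: "t > ?T" for t
  proof
    assume "pos_def (smat (ray_cov z t))"
    then have "?m \<bullet> (smat (ray_cov z t) *v ?m) > 0" using assms by (simp add: pos_def_def)
    moreover have "?m \<bullet> (smat (ray_cov z t) *v ?m) = ?a + t * ?q - t\<^sup>2 * ?a\<^sup>2"
      by (simp add: smat_ray_cov matrix_vector_mult_diff_rdistrib matrix_vector_mult_add_rdistrib
          scaleR_matrix_vector_assoc[symmetric] outer_mult_vector inner_add_right inner_diff_right power2_eq_square)
    ultimately have "t\<^sup>2 * ?a\<^sup>2 < ?a + t * ?q" by simp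
    also have "\<dots> \<le> t * ?a + t * \<bar>?q\<bar>"
    proof -
      have "1 * ?a \<le> t * ?a" using t a by (intro mult_right_mono) auto
      moreover have "t * ?q \<le> t * \<bar>?q\<bar>" using t by (intro mult_left_mono) auto
      ultimately show ?thesis by simp
    qed
    finally have "t * (t * ?a\<^sup>2) < t * (?a + \<bar>?q\<bar>)" by (simp add: power2_eq_square algebra_simps)
    then have "t * ?a\<^sup>2 < ?a + \<bar>?q\<bar>" using t by (simp add: mult_less_cancel_left)
    then have "t < (?a + \<bar>?q\<bar>) / ?a\<^sup>2" using a by (simp add: less_divide_eq)
    then show False using t by simp
  qed
  then show ?thesis by (intro that[of ?T]) auto
qed

lemma null_density_ray_integrable:
  fixes z :: "(real^'p) \<times> (real^('p::finite uprod))"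
  assumes z: "fst z \<noteq> 0" and n: "CARD('p) + 2 \<le> n" and K: "K > 0"
  shows "set_integrable lborel {0<..} (ray (null_density n K) z)"
proof -
  let ?d = "DIM((real^'p) \<times> (real^('p uprod))) - 1" and ?e = "(real n - real CARD('p) - 2) / 2"
  obtain T where T: "T \<ge> 0" "\<And>t. t > T \<Longrightarrow> \<not> pos_def (smat (ray_cov z t))"
    using ray_cov_bounded_support[OF z] by metis
  let ?E = "\<lambda>t. exp (- (real n / 2) * trace (smat (svec (mat 1) + t *\<^sub>R snd z)))"
  \<comment> \<open>Adding 1 keeps the base of \<open>powr\<close> positive, so this majorant is
    continuous; it dominates because the exponent is nonnegative by n >= p + 2.\<close>
  let ?h = "\<lambda>t. t ^ ?d * (K * (1 + \<bar>det (smat (ray_cov z t))\<bar>) powr ?e * ?E t)"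
  have cont: "continuous_on {0..T} ?h"
    unfolding trace_def
    by (intro continuous_intros continuous_ray_cov) (simp add: add_pos_nonneg less_imp_neq[symmetric])
  obtain B where B: "\<And>t. t \<in> {0..T} \<Longrightarrow> ?h t \<le> B"
    by (rule compact_continuous_bound[OF compact_Icc cont]) blast
  have le: "ray (null_density n K) z t \<le> ?h t" "ray (null_density n K) z t \<ge> 0" if "t \<ge> 0" for t
  proof -
    have "det (smat (ray_cov z t)) powr ?e \<le> (1 + \<bar>det (smat (ray_cov z t))\<bar>) powr ?e" if "pos_def (smat (ray_cov z t))"
      using pos_def_det_pos[OF that] n by (intro powr_mono2) auto
    then have "wdens ?e (ray_cov z t) \<le> (1 + \<bar>det (smat (ray_cov z t))\<bar>) powr ?e"
      by (simp add: wdens_def)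
    then show "ray (null_density n K) z t \<le> ?h t" "ray (null_density n K) z t \<ge> 0"
      unfolding ray_def null_density_ray using that K
      by (auto intro!: mult_left_mono mult_right_mono mult_nonneg_nonneg)
  qed
  show ?thesis
    unfolding set_integrable_def
  proof (rule integrableI_bounded_set[where A = "{0..T}" and B = B])
    show "AE t in lborel. t \<in> {0..T} \<longrightarrow> norm (indicator {0<..} t *\<^sub>R ray (null_density n K) z t) \<le> B"
    proof (intro AE_I2 impI)
      fix t assume t: "t \<in> {0..T}"
      then have "0 \<le> ray (null_density n K) z t" "ray (null_density n K) z t \<le> B"
        using le[of t] B[OF t] by auto
      then show "norm (indicator {0<..} t *\<^sub>R ray (null_density n K) z t) \<le> B"
        by (simp add: indicator_def)
    qed
    show "AE t in lborel. t \<notin> {0..T} \<longrightarrow> indicator {0<..} t *\<^sub>R ray (null_density n K) z t = 0"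
      using T by (intro AE_I2) (auto simp: indicator_def ray_def null_density_ray wdens_def)
    show "emeasure lborel {0..T} < \<infinity>" using T(1) by simp
  qed simp_all
qed

text \<open>The cone is open and the covariance at t = 0 is the identity, so the density is positive
  on an initial piece of the ray.\<close>

lemma null_density_ray_pos:
  fixes z :: "(real^'p) \<times> (real^('p::finite uprod))"
  assumes z: "fst z \<noteq> 0" and n: "CARD('p) + 2 \<le> n" and K: "K > 0"
  shows "(LBINT t:{0<..}. ray (null_density n K) z t) > 0"
proof -
  let ?g = "\<lambda>t. indicator {0<..} t *\<^sub>R ray (null_density n K) z t"
  let ?U = "{t. pos_def (smat (ray_cov z t))} \<inter> {0<..}"
  have nonneg: "?g t \<ge> 0" for t
    using K by (simp add: indicator_def ray_def null_density_ray)
  have "open ?U" using open_ray_cov[of z] by (intro open_Int) auto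
  moreover obtain r where r: "r > 0" "ball 0 r \<subseteq> {t. pos_def (smat (ray_cov z t))}"
    using open_ray_cov[of z] ray_cov_0[of z] by (metis mem_Collect_eq open_contains_ball)
  then have "r / 2 \<in> ?U" by (auto simp: subset_iff dist_real_def)
  moreover have "ennreal (?g t) > 0" if "t \<in> ?U" for t
    using that K pos_def_det_pos[of "smat (ray_cov z t)"] by (simp add: ray_def null_density_ray wdens_def)
  ultimately have "(\<integral>\<^sup>+t. ennreal (?g t) \<partial>lborel) > 0"
    by (intro nn_integral_lborel_pos[of _ ?U "r / 2"]) simp_all
  also have "(\<integral>\<^sup>+t. ennreal (?g t) \<partial>lborel) = ennreal (LBINT t:{0<..}. ray (null_density n K) z t)"
    unfolding set_lebesgue_integral_def using nonneg null_density_ray_integrable[OF assms]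
    by (intro nn_integral_eq_integral) (simp_all add: set_integrable_def)
  finally show ?thesis by simp
qed

text \<open>For zero mean the covariance is affine in t and may remain positive definite for all t >
  0; such rays are discarded as a null set.\<close>

lemma AE_fst_nonzero: "AE z in (lborel :: ((real^'p) \<times> (real^('p::finite uprod))) measure). fst z \<noteq> 0"
proof -
  have "(\<integral>\<^sup>+z. indicator {0} (fst z) \<partial>(lborel :: ((real^'p) \<times> (real^('p uprod))) measure))
      = (\<integral>\<^sup>+v. emeasure lborel (UNIV :: (real^('p uprod)) set) * indicator {0 :: real^'p} v \<partial>lborel)"
    by (subst nn_integral_lborel_prod) (simp_all add: mult.commute)
  also have "\<dots> = 0" by (subst nn_integral_cmult_indicator) simp_all
  finally have "AE z in (lborel :: ((real^'p) \<times> (real^('p uprod))) measure). indicator {0} (fst z) = (0 :: ennreal)"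
    by (subst (asm) nn_integral_0_iff_AE) simp_all
  then show ?thesis by eventually_elim (simp add: indicator_def split: if_splits)
qed

text \<open>\<open>U\<close> is open, so its supremum is not attained and no point of
  \<open>U\<close> is lost at the endpoint. If the supremum lies below \<open>a\<close> the oriented
  integral runs backwards, but then \<open>g\<close> vanishes on both domains.\<close>

lemma interval_integral_to_sup:
  fixes g :: "real \<Rightarrow> real"
  assumes U: "open U" and g: "\<And>t. t \<notin> U \<Longrightarrow> g t = 0"
  shows "(LBINT t=ereal a..(SUP t\<in>U. ereal t). g t) = (LBINT t:{a<..}. g t)"
proof -
  let ?s = "SUP t\<in>U. ereal t"
  have lt: "ereal t < ?s" if t: "t \<in> U" for t
  proof -
    obtain r where r: "r > 0" "ball t r \<subseteq> U" using U t open_contains_ball by blast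
    then have "t + r / 2 \<in> U" by (auto simp: subset_iff dist_real_def)
    then have "ereal (t + r / 2) \<le> ?s" by (rule SUP_upper)
    moreover have "ereal t < ereal (t + r / 2)" using r by simp
    ultimately show ?thesis by (rule less_le_trans[rotated])
  qed
  show ?thesis
  proof (cases "ereal a \<le> ?s")
    case True
    have eq: "indicator (einterval (ereal a) ?s) t *\<^sub>R g t = indicator {a<..} t *\<^sub>R g t" for t
      using lt[of t] g[of t] by (cases "t \<in> U") (simp_all add: indicator_def einterval_def)
    show ?thesis
      using True by (simp only: interval_lebesgue_integral_def set_lebesgue_integral_def eq if_True)
  next
    case False
    have z1: "indicator (einterval ?s (ereal a)) t *\<^sub>R g t = 0" for t
      using lt[of t] g[of t] by (cases "t \<in> U") (auto simp: indicator_def einterval_def)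
    have z2: "indicator {a<..} t *\<^sub>R g t = 0" for t
    proof (cases "t \<in> U")
      case True
      then have "ereal t < ereal a" using lt[OF True] False by (meson less_trans not_le)
      then show ?thesis by simp
    qed (simp add: g)
    show ?thesis
      using False by (simp only: interval_lebesgue_integral_def set_lebesgue_integral_def z1 z2 if_False) simp
  qed
qed

text \<open>Along the ray the saddlepoint density and \<open>null_density\<close> differ by the
  constant \<open>?\<kappa>\<close>, which cancels. The identity holds for every sample, degenerate
  ones included.\<close>

lemma mvn_directional_pvalue_eq:
  fixes y :: "nat \<Rightarrow> real^'p::finite"
  assumes n: "n > 0" and c: "c > 0" and K: "K > 0"
  shows "mvn_directional_pvalue c n y = ray_tail (null_density n K) ((smean n y, svec (smom n y)) - null_point)"
proof -
  let ?z = "(smean n y, svec (smom n y)) - null_point"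
  let ?l0 = "mvn_loglik n y" and ?m = "smean n y" and ?S = "smom n y"
  let ?e = "(real n - real CARD('p) - 2) / 2"
  let ?sp = "\<lambda>t. saddlepoint c mvn_params ?l0 null_value (null_line ?l0 null_value t)"
  obtain C where C: "C > 0" "\<And>t. ?sp t
    = (if pos_def (obs_line t ?S - outer (t *\<^sub>R ?m)) then c * (C * (det (obs_line t ?S - outer (t *\<^sub>R ?m)) powr ?e *
        exp (- (real n / 2) * trace (obs_line t ?S)))) else 0)"
    using saddlepoint_eq[OF n] by blast
  have W: "smat (ray_cov ?z t) = obs_line t ?S - outer (t *\<^sub>R ?m)" for t
    by (simp add: smat_ray_cov null_point_def smat_diff smat_svec transpose_mat obs_line_def)
  have tr: "smat (svec (mat 1) + t *\<^sub>R snd ?z) = obs_line t ?S" for t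
    by (simp add: null_point_def smat_add smat_diff smat_scaleR smat_svec transpose_mat obs_line_def)
  let ?\<kappa> = "c * C / K"
  have \<kappa>: "?\<kappa> > 0" using c C(1) K by simp
  have sp: "?sp t = ?\<kappa> * null_density n K (t *\<^sub>R ?z)" for t
    unfolding C(2) null_density_ray wdens_def W tr using K by simp
  \<comment> \<open>p + p(p + 1)/2 coordinates: the number of constraints is the dimension in which
    polar coordinates are taken.\<close>
  have d: "CARD('p) * (CARD('p) + 3) div 2 = DIM((real^'p) \<times> (real^('p uprod)))"
    by (simp add: card_UNIV_uprod choose_two) (simp add: algebra_simps div_add_self2)
  let ?g = "\<lambda>t. t ^ (CARD('p) * (CARD('p) + 3) div 2 - 1) * ?sp t"
  have g: "?g t = ?\<kappa> * ray (null_density n K) ?z t" for t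
    unfolding d ray_def sp by simp
  let ?U = "{t. pos_def (smat (ray_cov ?z t))}"
  have ts: "t_sup mvn_params ?l0 null_value = (SUP t\<in>?U. ereal t)"
    by (simp add: t_sup_def mle_exists_iff[OF n] W)
  have zero: "?g t = 0" if "t \<notin> ?U" for t using that by (simp add: C(2) W)
  have int: "(LBINT t=ereal a..t_sup mvn_params ?l0 null_value. ?g t) = ?\<kappa> * (LBINT t:{a<..}. ray (null_density n K) ?z t)" for a
  proof -
    have "(LBINT t=ereal a..t_sup mvn_params ?l0 null_value. ?g t) = (LBINT t:{a<..}. ?g t)"
      unfolding ts by (rule interval_integral_to_sup[OF open_ray_cov zero])
    then show ?thesis unfolding g by (simp only: set_integral_mult_right)
  qed
  \<comment> \<open>The null set is a singleton, so the constrained estimate is the same for all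
    data.\<close>
  have am: "arg_max_on ?l0 mvn_null_params = null_value"
    unfolding arg_max_on_def arg_max_def mvn_null_params_eq
    by (rule some_equality) (auto simp: is_arg_max_def)
  have "mvn_directional_pvalue c n y = (LBINT t=ereal 1..t_sup mvn_params ?l0 null_value. ?g t) / (LBINT t=ereal 0..t_sup mvn_params ?l0 null_value. ?g t)"
    unfolding mvn_directional_pvalue_def directional_pvalue_def Let_def am one_ereal_def zero_ereal_def ..
  also have "\<dots> = ray_tail (null_density n K) ?z"
    unfolding int ray_tail_def by (rule mult_divide_mult_cancel_left) (use c C(1) K in simp)
  finally show ?thesis .
qed

section \<open>The law of an independent normal sample\<close>

lemma PiM_density:
  fixes g :: "'b::euclidean_space \<Rightarrow> ennreal"
  assumes [measurable]: "g \<in> borel_measurable borel" and fin: "finite I" and p: "prob_space (density lborel g)"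
  shows "(\<Pi>\<^sub>M i\<in>I. density lborel g) = density (\<Pi>\<^sub>M i\<in>I. lborel) (\<lambda>z. \<Prod>i\<in>I. g (z i))"
proof -
  interpret D: prob_space "density lborel g" by fact
  interpret PD: product_sigma_finite "\<lambda>_. density lborel g" ..
  interpret PL: product_sigma_finite "\<lambda>_. lborel :: 'b measure" ..
  have "density (\<Pi>\<^sub>M i\<in>I. lborel) (\<lambda>z. \<Prod>i\<in>I. g (z i)) = (\<Pi>\<^sub>M i\<in>I. density lborel g)"
  proof (rule PD.PiM_eqI[OF fin])
    show "sets (density (\<Pi>\<^sub>M i\<in>I. lborel) (\<lambda>z. \<Prod>i\<in>I. g (z i))) = sets (\<Pi>\<^sub>M i\<in>I. density lborel g)"
      by (simp cong: sets_PiM_cong)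
    fix A assume A: "\<And>i. i \<in> I \<Longrightarrow> A i \<in> sets (density lborel g)"
    then have [measurable]: "\<And>i. i \<in> I \<Longrightarrow> A i \<in> sets borel" by simp
    have "emeasure (density (\<Pi>\<^sub>M i\<in>I. lborel) (\<lambda>z. \<Prod>i\<in>I. g (z i))) (Pi\<^sub>E I A)
        = (\<integral>\<^sup>+z. (\<Prod>i\<in>I. g (z i)) * indicator (Pi\<^sub>E I A) z \<partial>(\<Pi>\<^sub>M i\<in>I. lborel))"
      using A fin by (intro emeasure_density) (auto intro!: sets_PiM_I_finite)
    also have "\<dots> = (\<integral>\<^sup>+z. (\<Prod>i\<in>I. g (z i) * indicator (A i) (z i)) \<partial>(\<Pi>\<^sub>M i\<in>I. lborel))"
    proof (rule nn_integral_cong)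
      fix z assume "z \<in> space (\<Pi>\<^sub>M i\<in>I. (lborel :: 'b measure))"
      then have "z \<in> Pi\<^sub>E I A \<longleftrightarrow> (\<forall>i\<in>I. z i \<in> A i)" by (auto simp: space_PiM PiE_def)
      then have "indicator (Pi\<^sub>E I A) z = (\<Prod>i\<in>I. indicator (A i) (z i) :: ennreal)"
        using fin by (cases "\<forall>i\<in>I. z i \<in> A i") (auto simp: indicator_def intro!: prod.neutral[symmetric] prod_zero[symmetric])
      then show "(\<Prod>i\<in>I. g (z i)) * indicator (Pi\<^sub>E I A) z = (\<Prod>i\<in>I. g (z i) * indicator (A i) (z i))"
        by (simp add: prod.distrib)
    qed
    also have "\<dots> = (\<Prod>i\<in>I. \<integral>\<^sup>+x. g x * indicator (A i) x \<partial>lborel)"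
      using fin by (intro PL.product_nn_integral_prod) simp_all
    also have "\<dots> = (\<Prod>i\<in>I. emeasure (density lborel g) (A i))"
      by (intro prod.cong refl) (simp add: emeasure_density)
    finally show "emeasure (density (\<Pi>\<^sub>M i\<in>I. lborel) (\<lambda>z. \<Prod>i\<in>I. g (z i))) (Pi\<^sub>E I A) = (\<Prod>i\<in>I. emeasure (density lborel g) (A i))" .
  qed
  then show ?thesis ..
qed

lemma (in prob_space) nn_integral_iid:
  fixes y :: "nat \<Rightarrow> 'a \<Rightarrow> 'b::euclidean_space"
  assumes indep: "indep_vars (\<lambda>_. borel) y {1..n}" and n: "n \<ge> 1"
    and y: "\<And>i. i \<in> {1..n} \<Longrightarrow> distributed M lborel (y i) g"
    and [measurable]: "g \<in> borel_measurable borel" "F \<in> borel_measurable (\<Pi>\<^sub>M i\<in>{1..n}. lborel)"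
  shows "(\<integral>\<^sup>+\<omega>. F (\<lambda>i\<in>{1..n}. y i \<omega>) \<partial>M) = (\<integral>\<^sup>+z. (\<Prod>i\<in>{1..n}. g (z i)) * F z \<partial>(\<Pi>\<^sub>M i\<in>{1..n}. lborel))"
proof -
  let ?I = "{1..n}"
  have rv: "random_variable borel (y i)" if "i \<in> ?I" for i
    using y[OF that] by (simp add: distributed_def)
  have D: "distr M borel (y i) = density lborel g" if "i \<in> ?I" for i
  proof -
    have "distr M borel (y i) = distr M lborel (y i)" by (rule distr_cong) simp_all
    then show ?thesis using y[OF that] by (simp add: distributed_def)
  qed
  have p: "prob_space (density lborel g)"
    using prob_space_distr[OF rv[of 1]] D[of 1] n by simp
  have ne: "?I \<noteq> {}" using n by simp
  have "distr M (\<Pi>\<^sub>M i\<in>?I. borel) (\<lambda>\<omega>. \<lambda>i\<in>?I. y i \<omega>) = (\<Pi>\<^sub>M i\<in>?I. distr M borel (y i))"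
    using indep indep_vars_iff_distr_eq_PiM'[where X = y and M' = "\<lambda>_. borel", OF ne rv] by simp
  also have "\<dots> = (\<Pi>\<^sub>M i\<in>?I. density lborel g)" by (intro PiM_cong) (simp_all add: D)
  also have "\<dots> = density (\<Pi>\<^sub>M i\<in>?I. lborel) (\<lambda>z. \<Prod>i\<in>?I. g (z i))" by (intro PiM_density p) simp_all
  finally have eq: "distr M (\<Pi>\<^sub>M i\<in>?I. borel) (\<lambda>\<omega>. \<lambda>i\<in>?I. y i \<omega>) = density (\<Pi>\<^sub>M i\<in>?I. lborel) (\<lambda>z. \<Prod>i\<in>?I. g (z i))" .
  have sets: "sets (\<Pi>\<^sub>M i\<in>?I. borel) = sets (\<Pi>\<^sub>M i\<in>?I. (lborel :: 'b measure))" by (intro sets_PiM_cong) simp_all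
  then have F': "F \<in> borel_measurable (\<Pi>\<^sub>M i\<in>?I. borel)" using assms(5) by (simp cong: measurable_cong_sets)
  have "(\<lambda>\<omega>. \<lambda>i\<in>?I. y i \<omega>) \<in> measurable M (\<Pi>\<^sub>M i\<in>?I. borel)" using rv by (intro measurable_restrict) auto
  then have "(\<integral>\<^sup>+\<omega>. F (\<lambda>i\<in>?I. y i \<omega>) \<partial>M) = (\<integral>\<^sup>+z. F z \<partial>distr M (\<Pi>\<^sub>M i\<in>?I. borel) (\<lambda>\<omega>. \<lambda>i\<in>?I. y i \<omega>))"
    using F' by (simp add: nn_integral_distr)
  also have "\<dots> = (\<integral>\<^sup>+z. (\<Prod>i\<in>?I. g (z i)) * F z \<partial>(\<Pi>\<^sub>M i\<in>?I. lborel))"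
    unfolding eq by (rule nn_integral_density) measurable
  finally show ?thesis .
qed

lemma measurable_mvn_density [measurable]: "mvn_density \<mu> \<Lambda> \<in> borel_measurable borel"
  unfolding mvn_density_def by measurable

lemma prod_standard_mvn_density:
  fixes z :: "nat \<Rightarrow> real^'p::finite"
  assumes "n > 0"
  shows "(\<Prod>i=1..n. mvn_density 0 (mat 1) (z i))
    = sqrt (1 / (2 * pi) ^ CARD('p)) ^ n * exp (- (real n / 2) * trace (smom n z))"
proof -
  have "real n * trace (smom n z) = (\<Sum>i=1..n. z i \<bullet> z i)"
    using assms by (simp add: trace_def smom_def inner_vec_def sum_distrib_left) (rule sum.swap)
  then have "exp (- (real n / 2) * trace (smom n z)) = (\<Prod>i=1..n. exp (- (z i \<bullet> z i) / 2))"
    by (simp add: sum_negf sum_divide_distrib[symmetric] flip: exp_sum)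
  then show ?thesis by (simp add: mvn_density_def prod.distrib)
qed

text \<open>Under the null hypothesis the joint density of the sample depends on the data only
  through the trace of the second moment, so it factors through the statistic and multiplies the law
  that the statistic has under Lebesgue measure.\<close>

lemma (in prob_space) distributed_sample_moments:
  fixes y :: "nat \<Rightarrow> 'a \<Rightarrow> real^'p::finite"
  assumes n: "CARD('p) + 2 \<le> n"
    and indep: "indep_vars (\<lambda>_. borel) y {1..n}"
    and y: "\<And>i. i \<in> {1..n} \<Longrightarrow> distributed M lborel (y i) (\<lambda>x. ennreal (mvn_density 0 (mat 1) x))"
  shows "\<exists>K>0. distributed M lborel (\<lambda>\<omega>. (smean n (\<lambda>i. y i \<omega>), svec (smom n (\<lambda>i. y i \<omega>))) - null_point)
    (\<lambda>z. ennreal (null_density n K z))"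
proof -
  let ?e = "(real n - real CARD('p) - 2) / 2"
  let ?T = "\<lambda>z :: nat \<Rightarrow> real^'p. (smean n z, svec (smom n z))"
  let ?X = "\<lambda>\<omega>. ?T (\<lambda>i. y i \<omega>) - null_point"
  let ?k = "sqrt (1 / (2 * pi) ^ CARD('p)) ^ n"
  let ?E = "\<lambda>x :: (real^'p) \<times> (real^('p uprod)). exp (- (real n / 2) * trace (smat (snd x)))"
  have k: "?k > 0" by simp
  have n0: "n > 0" and n1: "n \<ge> 1" using n by simp_all
  have [measurable]: "y i \<in> borel_measurable M" if "i \<in> {1..n}" for i
    using y[OF that] by (simp add: distributed_def)
  have X[measurable]: "?X \<in> borel_measurable M"
    unfolding smean_def smom_def by measurable
  have "\<exists>C. \<forall>f :: (real^'p) \<times> (real^('p uprod)) \<Rightarrow> ennreal. f \<in> borel_measurable borel \<longrightarrow>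
    (\<integral>\<^sup>+z. f (?T z) \<partial>(\<Pi>\<^sub>M i\<in>{1..n}. lborel)) = C * (\<integral>\<^sup>+x. ennreal (mdens ?e x) * f x \<partial>lborel)"
    by (rule sample_moment_law) (use n in simp_all)
  then obtain C where C: "\<And>f :: (real^'p) \<times> (real^('p uprod)) \<Rightarrow> ennreal. f \<in> borel_measurable borel \<Longrightarrow>
    (\<integral>\<^sup>+z. f (?T z) \<partial>(\<Pi>\<^sub>M i\<in>{1..n}. lborel)) = C * (\<integral>\<^sup>+x. ennreal (mdens ?e x) * f x \<partial>lborel)"
    by blast
  have law: "(\<integral>\<^sup>+\<omega>. f (?X \<omega>) \<partial>M) = C * (\<integral>\<^sup>+z. ennreal (null_density n ?k z) * f z \<partial>lborel)"
    if [measurable]: "f \<in> borel_measurable borel" for f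
  proof -
    have "(\<integral>\<^sup>+\<omega>. f (?X \<omega>) \<partial>M) = (\<integral>\<^sup>+\<omega>. (\<lambda>z. f (?T z - null_point)) (\<lambda>i\<in>{1..n}. y i \<omega>) \<partial>M)"
      by (simp only: smean_restrict smom_restrict)
    also have "\<dots> = (\<integral>\<^sup>+z. (\<Prod>i\<in>{1..n}. ennreal (mvn_density 0 (mat 1) (z i))) * f (?T z - null_point) \<partial>(\<Pi>\<^sub>M i\<in>{1..n}. lborel))"
      by (rule nn_integral_iid[OF indep n1 y]) measurable
    also have "\<dots> = (\<integral>\<^sup>+z. (\<lambda>x. ennreal (?k * ?E x) * f (x - null_point)) (?T z) \<partial>(\<Pi>\<^sub>M i\<in>{1..n}. lborel))"
    proof (rule nn_integral_cong)
      fix z :: "nat \<Rightarrow> real^'p"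
      have "(\<Prod>i\<in>{1..n}. ennreal (mvn_density 0 (mat 1) (z i))) = ennreal (\<Prod>i=1..n. mvn_density 0 (mat 1) (z i))"
        by (rule prod_ennreal) (simp add: mvn_density_def)
      then show "(\<Prod>i\<in>{1..n}. ennreal (mvn_density 0 (mat 1) (z i))) * f (?T z - null_point)
        = (\<lambda>x. ennreal (?k * ?E x) * f (x - null_point)) (?T z)"
        by (simp add: prod_standard_mvn_density[OF n0] smat_svec)
    qed
    also have "\<dots> = C * (\<integral>\<^sup>+x. ennreal (mdens ?e x) * (ennreal (?k * ?E x) * f (x - null_point)) \<partial>lborel)"
      by (rule C) measurable
    also have "(\<integral>\<^sup>+x. ennreal (mdens ?e x) * (ennreal (?k * ?E x) * f (x - null_point)) \<partial>lborel)
      = (\<integral>\<^sup>+x. ennreal (mdens ?e (x + null_point)) * (ennreal (?k * ?E (x + null_point)) * f (x + null_point - null_point)) \<partial>lborel)"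
      by (rule nn_integral_lborel_translate[symmetric]) measurable
    also have "\<dots> = (\<integral>\<^sup>+z. ennreal (null_density n ?k z) * f z \<partial>lborel)"
    proof (rule nn_integral_cong)
      fix x :: "(real^'p) \<times> (real^('p uprod))"
      have "ennreal (mdens ?e (x + null_point)) * ennreal (?k * ?E (x + null_point)) = ennreal (null_density n ?k x)"
        using k by (subst ennreal_mult[symmetric]) (simp_all add: null_density_def add.commute mult_ac)
      then show "ennreal (mdens ?e (x + null_point)) * (ennreal (?k * ?E (x + null_point)) * f (x + null_point - null_point))
        = ennreal (null_density n ?k x) * f x"
        by (simp only: mult.assoc[symmetric] add_diff_cancel_right')
    qed
    finally show ?thesis .
  qed
  \<comment> \<open>Total mass one excludes both C = 0 and an infinite C, which makes C a positive
    real factor.\<close>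
  have "C * (\<integral>\<^sup>+z. ennreal (null_density n ?k z) * 1 \<partial>(lborel :: ((real^'p) \<times> (real^('p uprod))) measure)) = 1"
    using law[of "\<lambda>_. 1"] by (simp add: emeasure_space_1)
  then have "C \<noteq> top" "C \<noteq> 0"
    by (auto simp: ennreal_top_mult split: if_splits)
  then obtain r where r: "C = ennreal r" "r > 0"
    by (cases C) (auto simp: less_le)
  have rk: "ennreal (null_density n (r * ?k) z) = C * ennreal (null_density n ?k z)" for z :: "(real^'p) \<times> (real^('p uprod))"
    using r k by (simp add: null_density_def mult.assoc flip: ennreal_mult')
  have "distr M lborel ?X = density lborel (\<lambda>z. ennreal (null_density n (r * ?k) z))"
  proof (rule measure_eqI)
    fix A assume "A \<in> sets (distr M lborel ?X)"
    then have A[measurable]: "A \<in> sets borel" by simp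
    have "emeasure (distr M lborel ?X) A = (\<integral>\<^sup>+x. indicator A x \<partial>distr M lborel ?X)" by simp
    also have "\<dots> = (\<integral>\<^sup>+\<omega>. indicator A (?X \<omega>) \<partial>M)" by (rule nn_integral_distr) measurable
    also have "\<dots> = C * (\<integral>\<^sup>+z. ennreal (null_density n ?k z) * indicator A z \<partial>lborel)"
      by (rule law) measurable
    also have "\<dots> = (\<integral>\<^sup>+z. C * (ennreal (null_density n ?k z) * indicator A z) \<partial>lborel)"
      by (rule nn_integral_cmult[symmetric]) measurable
    also have "\<dots> = (\<integral>\<^sup>+z. ennreal (null_density n (r * ?k) z) * indicator A z \<partial>lborel)"
      by (simp only: rk mult.assoc)
    also have "\<dots> = emeasure (density lborel (\<lambda>z. ennreal (null_density n (r * ?k) z))) A"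
      by (rule emeasure_density[symmetric]) measurable
    finally show "emeasure (distr M lborel ?X) A = emeasure (density lborel (\<lambda>z. ennreal (null_density n (r * ?k) z))) A" .
  qed simp
  then have "distributed M lborel ?X (\<lambda>z. ennreal (null_density n (r * ?k) z))"
    by (simp add: distributed_def)
  then show ?thesis using r(2) k by (intro exI[of _ "r * ?k"]) (simp add: mult_pos_pos)
qed

theorem theorem4:
  fixes M :: "'a measure"
    and n :: nat
    and y :: "nat \<Rightarrow> 'a \<Rightarrow> real^'p::finite"
    and \<mu> :: "real^'p"
    and \<Lambda> :: "real^'p^'p"
    and c :: real
  assumes "prob_space M"
    and "n \<ge> 3"
    and "CARD('p) \<ge> 1"
    and "n \<ge> CARD('p) + 2"
    and "pos_def \<Lambda>"
    and "prob_space.indep_vars M (\<lambda>_. borel) y {1..n}"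
    and "\<And>i. i \<in> {1..n} \<Longrightarrow> distributed M lborel (y i) (\<lambda>x. ennreal (mvn_density \<mu> \<Lambda> x))"
    and null_hypothesis: "\<mu> = 0 \<and> \<Lambda> = mat 1"
    and "c > 0"
  shows "distributed M lborel (\<lambda>\<omega>. mvn_directional_pvalue c n (\<lambda>i. y i \<omega>)) (indicator {0<..<1})"
proof -
  interpret prob_space M by fact
  have n: "n > 0" "CARD('p) + 2 \<le> n" using assms(2,4) by simp_all
  have "\<And>i. i \<in> {1..n} \<Longrightarrow> distributed M lborel (y i) (\<lambda>x. ennreal (mvn_density 0 (mat 1) x))"
    using assms(7) null_hypothesis by simp
  from distributed_sample_moments[OF n(2) assms(6) this] obtain K where K: "K > 0"
    and X: "distributed M lborel (\<lambda>\<omega>. (smean n (\<lambda>i. y i \<omega>), svec (smom n (\<lambda>i. y i \<omega>))) - null_point)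
      (\<lambda>z. ennreal (null_density n K z))" by blast
  have "distributed M lborel (\<lambda>\<omega>. ray_tail (null_density n K)
      ((smean n (\<lambda>i. y i \<omega>), svec (smom n (\<lambda>i. y i \<omega>))) - null_point)) (indicator {0<..<1})"
  proof (rule distributed_ray_tail[OF X])
    show "AE z in lborel. set_integrable lborel {0<..} (ray (null_density n K :: (real^'p) \<times> _ \<Rightarrow> real) z)"
      using AE_fst_nonzero by eventually_elim (rule null_density_ray_integrable[OF _ n(2) K])
    show "AE z in lborel. (LBINT t:{0<..}. ray (null_density n K :: (real^'p) \<times> _ \<Rightarrow> real) z t) > 0"
      using AE_fst_nonzero by eventually_elim (rule null_density_ray_pos[OF _ n(2) K])
    show "null_density n K z \<ge> 0" for z :: "(real^'p) \<times> (real^('p uprod))"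
      using K by (simp add: null_density_def)
  qed simp
  then show ?thesis by (simp only: mvn_directional_pvalue_eq[OF n(1) \<open>c > 0\<close> K])
qed

end
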